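(* Let $n,m,l\in\mathbb{N}$, let $\Phi:\mathbb{M}_n\to\mathbb{M}_l$ and $\Psi:\mathbb{M}_m\to\mathbb{M}_l$ be strictly positive linear maps, and let $p,q\in\mathbb{R}$ with $(p,q)\ne(0,0)$. Assume that either $0\le p,q\le1$ or $-1\le p,q\le0$. Let $f$ be a real function on $(0,\infty)$. If $x\mapsto f(x^{p+q})$ is operator monotone (resp., operator monotone decreasing) on $(0,\infty)$, then the function $$(A,B)\in\mathbb{P}_n\times\mathbb{P}_m\longmapsto\mathrm{Tr}\, f\bigl(\Phi(A^p)^{1/2}\Psi(B^q)\Phi(A^p)^{1/2}\bigr)$$ is jointly concave (resp., jointly convex).
   Context: $\mathbb{M}_n$ denotes the $n\times n$ complex matrices, $\mathbb{P}_n$ the positive definite ones, $\mathrm{Tr}$ the usual trace. A linear map $\Phi:\mathbb{M}_n\to\mathbb{M}_l$ is positive if it maps positive semidefinite matrices to positive semidefinite matrices, and strictly positive if it maps $\mathbb{P}_n$ into $\mathbb{P}_l$. A real function $h$ on $(0,\infty)$ is operator monotone (resp. operator monotone decreasing) if $A\le B$ implies $h(A)\le h(B)$ (resp. $h(A)\ge h(B)$) for all positive definite matrices $A,B$ of any size. *)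

theory Defs
  imports Complex_Main "Jordan_Normal_Form.Matrix"
begin

definition adj :: "complex mat \<Rightarrow> complex mat" where
  "adj A = mat (dim_col A) (dim_row A) (\<lambda>(i,j). cnj (A $$ (j,i)))"

definition mtrace :: "complex mat \<Rightarrow> complex" where
  "mtrace A = (\<Sum>i<dim_row A. A $$ (i,i))"

definition hermitian :: "nat \<Rightarrow> complex mat \<Rightarrow> bool" where
  "hermitian k A \<longleftrightarrow> A \<in> carrier_mat k k \<and> adj A = A"

definition qform :: "nat \<Rightarrow> complex mat \<Rightarrow> (nat \<Rightarrow> complex) \<Rightarrow> complex" where
  "qform k A v = (\<Sum>i<k. \<Sum>j<k. cnj (v i) * A $$ (i,j) * v j)"

definition psd :: "nat \<Rightarrow> complex mat \<Rightarrow> bool" where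
  "psd k A \<longleftrightarrow> hermitian k A \<and> (\<forall>v. 0 \<le> Re (qform k A v))"

definition pd :: "nat \<Rightarrow> complex mat \<Rightarrow> bool" where
  "pd k A \<longleftrightarrow> hermitian k A \<and> (\<forall>v. (\<exists>i<k. v i \<noteq> 0) \<longrightarrow> 0 < Re (qform k A v))"

definition loewner_le :: "nat \<Rightarrow> complex mat \<Rightarrow> complex mat \<Rightarrow> bool" where
  "loewner_le k A B \<longleftrightarrow> hermitian k A \<and> hermitian k B \<and> psd k (B - A)"

definition unitary :: "nat \<Rightarrow> complex mat \<Rightarrow> bool" where
  "unitary k U \<longleftrightarrow> U \<in> carrier_mat k k \<and> U * adj U = 1\<^sub>m k \<and> adj U * U = 1\<^sub>m k"

definition rdiag :: "nat \<Rightarrow> (nat \<Rightarrow> real) \<Rightarrow> complex mat" where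
  "rdiag k d = mat k k (\<lambda>(i,j). if i = j then complex_of_real (d i) else 0)"

(* Functional calculus for Hermitian matrices: if A = U diag(d) U^* with U unitary,
   then h(A) = U diag(h \<circ> d) U^*  (independent of the chosen diagonalization). *)
definition mat_fun :: "nat \<Rightarrow> (real \<Rightarrow> real) \<Rightarrow> complex mat \<Rightarrow> complex mat" where
  "mat_fun k h A = (SOME B. \<exists>U d. unitary k U \<and> A = U * rdiag k d * adj U
                              \<and> B = U * rdiag k (h \<circ> d) * adj U)"

definition operator_monotone :: "(real \<Rightarrow> real) \<Rightarrow> bool" where
  "operator_monotone h \<longleftrightarrow> (\<forall>k A B. pd k A \<longrightarrow> pd k B \<longrightarrow> loewner_le k A B
       \<longrightarrow> loewner_le k (mat_fun k h A) (mat_fun k h B))"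

definition operator_monotone_decreasing :: "(real \<Rightarrow> real) \<Rightarrow> bool" where
  "operator_monotone_decreasing h \<longleftrightarrow> (\<forall>k A B. pd k A \<longrightarrow> pd k B \<longrightarrow> loewner_le k A B
       \<longrightarrow> loewner_le k (mat_fun k h B) (mat_fun k h A))"

definition linear_map :: "nat \<Rightarrow> nat \<Rightarrow> (complex mat \<Rightarrow> complex mat) \<Rightarrow> bool" where
  "linear_map n l \<Phi> \<longleftrightarrow>
     (\<forall>A \<in> carrier_mat n n. \<Phi> A \<in> carrier_mat l l) \<and>
     (\<forall>A \<in> carrier_mat n n. \<forall>B \<in> carrier_mat n n. \<Phi> (A + B) = \<Phi> A + \<Phi> B) \<and>
     (\<forall>c. \<forall>A \<in> carrier_mat n n. \<Phi> (c \<cdot>\<^sub>m A) = c \<cdot>\<^sub>m \<Phi> A)"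

definition strictly_positive_map :: "nat \<Rightarrow> nat \<Rightarrow> (complex mat \<Rightarrow> complex mat) \<Rightarrow> bool" where
  "strictly_positive_map n l \<Phi> \<longleftrightarrow> linear_map n l \<Phi> \<and> (\<forall>A. pd n A \<longrightarrow> pd l (\<Phi> A))"

definition jointly_concave :: "nat \<Rightarrow> nat \<Rightarrow> (complex mat \<Rightarrow> complex mat \<Rightarrow> real) \<Rightarrow> bool" where
  "jointly_concave n m F \<longleftrightarrow> (\<forall>A1 A2 B1 B2 t. pd n A1 \<longrightarrow> pd n A2 \<longrightarrow> pd m B1 \<longrightarrow> pd m B2
     \<longrightarrow> 0 \<le> t \<longrightarrow> t \<le> 1 \<longrightarrow>
     t * F A1 B1 + (1 - t) * F A2 B2
       \<le> F (complex_of_real t \<cdot>\<^sub>m A1 + complex_of_real (1 - t) \<cdot>\<^sub>m A2)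
            (complex_of_real t \<cdot>\<^sub>m B1 + complex_of_real (1 - t) \<cdot>\<^sub>m B2))"

definition jointly_convex :: "nat \<Rightarrow> nat \<Rightarrow> (complex mat \<Rightarrow> complex mat \<Rightarrow> real) \<Rightarrow> bool" where
  "jointly_convex n m F \<longleftrightarrow> (\<forall>A1 A2 B1 B2 t. pd n A1 \<longrightarrow> pd n A2 \<longrightarrow> pd m B1 \<longrightarrow> pd m B2
     \<longrightarrow> 0 \<le> t \<longrightarrow> t \<le> 1 \<longrightarrow>
     F (complex_of_real t \<cdot>\<^sub>m A1 + complex_of_real (1 - t) \<cdot>\<^sub>m A2)
       (complex_of_real t \<cdot>\<^sub>m B1 + complex_of_real (1 - t) \<cdot>\<^sub>m B2)
     \<le> t * F A1 B1 + (1 - t) * F A2 B2)"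

end

theory Submission
  imports "HOL-Complex_Analysis.Conformal_Mappings" Defs "Jordan_Normal_Form.Schur_Decomposition"
begin

text \<open>
  An operator monotone function \<open>h\<close> is increasing and concave on scalars, so by Abel summation
  the claim for \<open>h = (\<lambda>x. f (x powr (p + q)))\<close> follows once, for every \<open>k\<close>, the sum of the \<open>k\<close>
  smallest eigenvalues of \<open>W(A,B) = (X\<^sup>\<half> Y X\<^sup>\<half>) powr (1 / (p + q))\<close> is jointly concave, where
  \<open>X = \<Phi>(A\<^sup>p)\<close> and \<open>Y = \<Psi>(B\<^sup>q)\<close>.

  For \<open>p, q \<ge> 0\<close>, diagonalize the pair \<open>(X, Y)\<close> at the convex combination in dual bases and compress to the
  \<open>k\<close> lowest eigenvectors. Interlacing bounds the eigenvalue sum at the other points by the trace \<open>\<tau>\<close>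
  of the compressed \<open>W\<close>, and a polar decomposition gives \<open>2 \<tau> \<le> Tr X Z powr (1 - p) + Tr Y Z' powr (1 - q)\<close>
  with \<open>Tr Z = Tr Z' = \<tau>\<close>. Now \<open>Tr \<Phi>(A\<^sup>p) Z powr (1 - p)\<close> is jointly concave for merely positive \<open>\<Phi>\<close>:
  this is Lieb's theorem, proved with the three lines theorem, where the unitaries on the
  boundary lines are diagonalized so that complete positivity is not needed.

  For \<open>p, q \<le> 0\<close>, Choi's inequality shows that the inverse of \<open>\<Phi>(A\<^sup>p)\<close> is the minimum over \<open>C\<close> of
  positive linear images of \<open>A powr (- p)\<close>, attained at \<open>C = A\<close>, which reduces this case to the first.
\<close>

subsection \<open>Adjoints, unitary and diagonal matrices\<close>

text \<open>The trial matrices \<open>Z\<close> depend on the point, although bounds at three points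
  have to be compared; they are therefore carried as a second variable of Lieb's theorem. The
  exponents \<open>p\<close> and \<open>1 - p\<close> add up to one, so averaging the points also
  averages the traces of the trial matrices. The compression, by contrast, is fixed at the convex
  combination, where the compressed matrices become the diagonal matrices of \<open>w^p\<close> and
  \<open>w^q\<close>. Young's inequality bounds the right-hand side there by
  \<open>(p + q) * \<sigma> + (2 - p - q) * \<tau>\<close>, with \<sigma> the sum of
  \<open>w\<close> and \<tau> the averaged trace; as the left-hand side is
  \<open>2 * \<tau>\<close>, the unknown \<tau> cancels to leave \<tau> \<le> \<sigma>. Dual bases
  are forced because the eigenvalues of \<open>X * Y\<close> are invariant when a change of basis
  acts on \<open>X\<close> and the dual change on \<open>Y\<close>. The smallest eigenvalues are the
  right ones to sum because the slopes of an increasing concave function are nonnegative and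
  decreasing, hence weigh small eigenvalues most.\<close>

definition cdiag :: "nat \<Rightarrow> (nat \<Rightarrow> complex) \<Rightarrow> complex mat" where
  "cdiag k d = mat k k (\<lambda>(i,j). if i = j then d i else 0)"

text \<open>Complex diagonals are needed for the eigenvalues of unitary matrices and for complex
  powers; this equation passes facts on \<open>cdiag\<close> to \<open>rdiag\<close>.\<close>

lemma rdiag_cdiag: "rdiag k d = cdiag k (\<lambda>i. of_real (d i))"
  by (simp add: rdiag_def cdiag_def)

lemma cdiag_carrier [simp]: "cdiag k d \<in> carrier_mat k k"
  by (simp add: cdiag_def)

lemma cdiag_dim [simp]: "dim_row (cdiag k d) = k" "dim_col (cdiag k d) = k"
  by (simp_all add: cdiag_def)

lemma cdiag_index [simp]: "i < k \<Longrightarrow> j < k \<Longrightarrow> cdiag k d $$ (i,j) = (if i = j then d i else 0)"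
  by (simp add: cdiag_def)

lemma cdiag_cong: "(\<And>i. i < k \<Longrightarrow> d i = e i) \<Longrightarrow> cdiag k d = cdiag k e"
  by (rule eq_matI) auto

lemma rdiag_carrier [simp]: "rdiag k d \<in> carrier_mat k k"
  by (simp add: rdiag_cdiag)

lemma rdiag_dim [simp]: "dim_row (rdiag k d) = k" "dim_col (rdiag k d) = k"
  by (simp_all add: rdiag_cdiag)

lemma adj_carrier: "A \<in> carrier_mat n m \<Longrightarrow> adj A \<in> carrier_mat m n"
  by (simp add: adj_def)

lemma adj_dim [simp]: "dim_row (adj A) = dim_col A" "dim_col (adj A) = dim_row A"
  by (simp_all add: adj_def)

lemma adj_index [simp]: "i < dim_col A \<Longrightarrow> j < dim_row A \<Longrightarrow> adj A $$ (i,j) = cnj (A $$ (j,i))"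
  by (simp add: adj_def)

lemma adj_adj [simp]: "adj (adj A) = A"
  by (rule eq_matI) auto

lemma index_mult_sum:
  "A \<in> carrier_mat a b \<Longrightarrow> B \<in> carrier_mat b c \<Longrightarrow> i < a \<Longrightarrow> j < c \<Longrightarrow>
    (A * B) $$ (i,j) = (\<Sum>k<b. A $$ (i,k) * (B $$ (k,j) :: complex))"
  by (auto simp: scalar_prod_def atLeast0LessThan intro!: sum.cong)

lemma adj_mult: "A \<in> carrier_mat a b \<Longrightarrow> B \<in> carrier_mat b c \<Longrightarrow> adj (A * B) = adj B * adj A"
  by (rule eq_matI) (auto simp: scalar_prod_def intro!: sum.cong)

lemma adj_add: "A \<in> carrier_mat a b \<Longrightarrow> B \<in> carrier_mat a b \<Longrightarrow> adj (A + B) = adj A + adj B"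
  by (rule eq_matI) auto

lemma adj_smult: "adj (c \<cdot>\<^sub>m A) = cnj c \<cdot>\<^sub>m adj A"
  by (rule eq_matI) auto

lemma adj_one [simp]: "adj (1\<^sub>m n) = 1\<^sub>m n"
  by (rule eq_matI) auto

lemma adj_zero [simp]: "adj (0\<^sub>m a b) = 0\<^sub>m b a"
  by (rule eq_matI) auto

lemma adj_cdiag: "adj (cdiag k d) = cdiag k (\<lambda>i. cnj (d i))"
  by (rule eq_matI) auto

lemma cdiag_mult: "cdiag k d * cdiag k e = cdiag k (\<lambda>i. d i * e i)"
proof (rule eq_matI)
  fix i j assume "i < dim_row (cdiag k (\<lambda>i. d i * e i))" "j < dim_col (cdiag k (\<lambda>i. d i * e i))"
  then show "(cdiag k d * cdiag k e) $$ (i, j) = cdiag k (\<lambda>i. d i * e i) $$ (i, j)"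
    by (subst index_mult_sum[of _ k k _ k]) (auto simp: if_distrib[of "\<lambda>x. x * _"] cong: if_cong)
qed auto

lemma cdiag_one: "cdiag k (\<lambda>_. 1) = 1\<^sub>m k"
  by (rule eq_matI) auto

lemma unitary_carrier: "unitary k U \<Longrightarrow> U \<in> carrier_mat k k"
  by (simp add: unitary_def)

lemma unitaryI:
  assumes "U \<in> carrier_mat k k" "adj U * U = 1\<^sub>m k"
  shows "unitary k U"
  using assms mat_mult_left_right_inverse[OF adj_carrier[OF assms(1)] assms(1,2)]
  by (simp add: unitary_def)

lemma unitary_adj: "unitary k U \<Longrightarrow> unitary k (adj U)"
  by (auto simp: unitary_def adj_carrier)

lemma mult_assoc_sq:
  "A \<in> carrier_mat n n \<Longrightarrow> B \<in> carrier_mat n n \<Longrightarrow> C \<in> carrier_mat n n \<Longrightarrow>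
    (A * B) * C = A * (B * (C :: complex mat))"
  by (rule assoc_mult_mat)

lemma mult_cancel_inverse:
  assumes "A \<in> carrier_mat n n" "B \<in> carrier_mat n n" "C \<in> carrier_mat n m" "A * B = 1\<^sub>m n"
  shows "A * (B * C) = (C :: complex mat)"
  using assms by (metis assoc_mult_mat left_mult_one_mat)

lemma unitary_mult:
  assumes U: "unitary k U" and V: "unitary k V"
  shows "unitary k (U * V)"
proof (rule unitaryI)
  note [simp] = unitary_carrier[OF U] unitary_carrier[OF V] adj_carrier[OF unitary_carrier[OF U]]
    adj_carrier[OF unitary_carrier[OF V]]
  show "U * V \<in> carrier_mat k k" by (rule mult_carrier_mat[of _ k k]) auto
  have "adj (U * V) * (U * V) = adj V * (adj U * (U * V))"
    by (simp add: adj_mult[of _ k k _ k] mult_assoc_sq[of _ k] mult_carrier_mat[of _ k k _ k])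
  also have "\<dots> = 1\<^sub>m k"
    using U V by (simp add: mult_cancel_inverse[of _ k _ _ k] unitary_def)
  finally show "adj (U * V) * (U * V) = 1\<^sub>m k" .
qed

subsection \<open>The spectral theorem\<close>

text \<open>Basis completion and Gram-Schmidt give an orthogonal basis that starts with
  \<open>v\<close>. It is not normalized, so each column is divided by its norm, and
  \<open>c\<close> is the reciprocal of the norm of \<open>v\<close>.\<close>

lemma exists_unitary_first_column:
  fixes v :: "complex Matrix.vec"
  assumes v: "v \<in> carrier_vec n" and v0: "v \<noteq> 0\<^sub>v n"
  shows "\<exists>W c. unitary n W \<and> (c::complex) \<noteq> 0 \<and> (\<forall>i<n. W $$ (i,0) = c * v $ i)"
proof -
  have n: "n \<noteq> 0" using v v0 by (metis carrier_vecD vec_of_dim_0)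
  interpret cof_vec_space n "TYPE(complex)" .
  define b where "b = basis_completion v"
  from basis_completion[OF v v0, folded b_def]
  have dist_b: "distinct b" and indep: "\<not> lin_dep (set b)" and b: "set b \<subseteq> carrier_vec n"
    and hdb: "hd b = v" and len_b: "length b = n" by auto
  from hdb len_b n obtain vs where bv: "b = v # vs" by (cases b, auto)
  define ws where "ws = gram_schmidt n b"
  from gram_schmidt_result[OF b dist_b indep refl, folded ws_def]
  have ws: "set ws \<subseteq> carrier_vec n" "corthogonal ws" "length ws = n"
    by (auto simp: len_b)
  from gram_schmidt_hd[OF v, of vs, folded bv] have hdws: "hd ws = v" unfolding ws_def .
  define r where "r i = sqrt (\<Sum>k<n. (cmod (ws ! i $ k))\<^sup>2)" for i
  define W where "W = mat n n (\<lambda>(k,i). ws ! i $ k / of_real (r i))"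
  have W: "W \<in> carrier_mat n n" by (simp add: W_def)
  have dim: "dim_vec (ws ! i) = n" if "i < n" for i
    using ws that by (metis carrier_vecD nth_mem subset_iff)
  have orth: "(\<Sum>k<n. ws ! i $ k * cnj (ws ! j $ k)) = 0" if "i < n" "j < n" "i \<noteq> j" for i j
    using corthogonalD[OF ws(2), of i j] that ws(3) dim
    by (auto simp: scalar_prod_def atLeast0LessThan)
  have sq: "(\<Sum>k<n. ws ! i $ k * cnj (ws ! i $ k)) = of_real ((r i)\<^sup>2)" for i
    by (simp add: r_def complex_norm_square[symmetric] sum_nonneg del: of_real_power)
  have r: "r i \<noteq> 0" if "i < n" for i
  proof -
    have "(\<Sum>k<n. ws ! i $ k * cnj (ws ! i $ k)) \<noteq> 0"
      using corthogonalD[OF ws(2), of i i] that ws(3) dim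
      by (auto simp: scalar_prod_def atLeast0LessThan)
    then show ?thesis using sq[of i] by auto
  qed
  have "adj W * W = 1\<^sub>m n"
  proof (rule eq_matI)
    fix i j assume "i < dim_row (1\<^sub>m n :: complex mat)" "j < dim_col (1\<^sub>m n :: complex mat)"
    then have ij: "i < n" "j < n" by auto
    have "(adj W * W) $$ (i,j) = (\<Sum>k<n. cnj (ws ! i $ k / of_real (r i)) * (ws ! j $ k / of_real (r j)))"
      using ij W by (subst index_mult_sum[of _ n n _ n]) (auto simp: W_def adj_carrier intro!: sum.cong)
    also have "\<dots> = (\<Sum>k<n. ws ! j $ k * cnj (ws ! i $ k)) / of_real (r i * r j)"
      by (simp add: sum_divide_distrib mult.commute)
    also have "\<dots> = (1\<^sub>m n :: complex mat) $$ (i,j)"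
      using ij orth[of j i] sq[of i] r[of i] by (auto simp: power2_eq_square)
    finally show "(adj W * W) $$ (i,j) = (1\<^sub>m n :: complex mat) $$ (i,j)" .
  qed (use W in auto)
  moreover have "ws ! 0 = v" using hdws ws n by (metis hd_conv_nth length_0_conv)
  ultimately show ?thesis
    using W r[of 0] n
    by (intro exI[of _ W] exI[of _ "1 / complex_of_real (r 0)"]) (auto simp: unitaryI W_def)
qed

lemma four_block_adj:
  assumes "A \<in> carrier_mat a a" "B \<in> carrier_mat a b" "C \<in> carrier_mat b a" "D \<in> carrier_mat b b"
  shows "adj (four_block_mat A B C D) = four_block_mat (adj A) (adj C) (adj B) (adj D)"
  using assms by (intro eq_matI) auto

text \<open>Induction by splitting off an eigenvector. Normality covers both uses: Hermitian
  matrices for the functional calculus, and unitary matrices for the boundary estimate in Lieb's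
  theorem.\<close>

theorem spectral_normal:
  assumes "A \<in> carrier_mat n n" "A * adj A = adj A * A"
  shows "\<exists>U d. unitary n U \<and> A = U * cdiag n d * adj U"
  using assms
proof (induction n arbitrary: A)
  case 0
  have "unitary 0 (1\<^sub>m 0)" by (auto simp: unitary_def)
  moreover have "A = 1\<^sub>m 0 * cdiag 0 (\<lambda>_. 0) * adj (1\<^sub>m 0)" using 0 by (intro eq_matI) auto
  ultimately show ?case by blast
next
  case (Suc n)
  let ?N = "Suc n"
  note A = Suc.prems(1)
  obtain e where "eigenvalue A e"
    using char_poly_factorized[OF A] eigenvalue_root_char_poly[OF A]
    by (metis length_0_conv linear_poly_root list.set_cases list.set_intros(1) neq_Nil_conv nat.distinct(1))
  then obtain v where v: "v \<in> carrier_vec ?N" "v \<noteq> 0\<^sub>v ?N" "A *\<^sub>v v = e \<cdot>\<^sub>v v"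
    using A unfolding eigenvalue_def eigenvector_def by auto
  obtain W c where W: "unitary ?N W" and c: "c \<noteq> 0" "\<And>i. i < ?N \<Longrightarrow> W $$ (i,0) = c * v $ i"
    using exists_unitary_first_column[OF v(1,2)] by auto
  note Wc = unitary_carrier[OF W] and Wa = adj_carrier[OF unitary_carrier[OF W]]
  note sq = mult_carrier_mat[of _ ?N ?N _ ?N]
  note [simp] = Wc Wa A adj_carrier[OF A]
  have WW: "W * adj W = 1\<^sub>m ?N" "adj W * W = 1\<^sub>m ?N" using W by (auto simp: unitary_def)
  define M where "M = adj W * A * W"
  have M: "M \<in> carrier_mat ?N ?N" by (simp add: M_def sq)
  have adjM: "adj M = adj W * (adj A * W)"
    by (simp add: M_def adj_mult[of _ ?N ?N _ ?N] sq)
  have AM: "A = W * (M * adj W)"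
    by (simp add: M_def mult_assoc_sq[of _ ?N] sq WW mult_cancel_inverse[of _ ?N _ _ ?N] right_mult_one_mat[of _ ?N])
  have normal: "M * adj M = adj M * M"
  proof -
    have "M * adj M = adj W * ((A * adj A) * W)"
      by (simp add: adjM) (simp add: M_def mult_assoc_sq[of _ ?N] sq WW mult_cancel_inverse[of _ ?N _ _ ?N])
    also have "\<dots> = adj M * M"
      by (simp add: adjM Suc.prems(2)) (simp add: M_def mult_assoc_sq[of _ ?N] sq WW mult_cancel_inverse[of _ ?N _ _ ?N])
    finally show ?thesis .
  qed
  have AW0: "(A * W) $$ (i,0) = e * W $$ (i,0)" if "i < ?N" for i
  proof -
    have "(A * W) $$ (i,0) = c * (\<Sum>k<?N. A $$ (i,k) * v $ k)"
      using that by (subst index_mult_sum[of _ ?N ?N _ ?N])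
        (auto simp: c sum_distrib_left algebra_simps simp del: sum.lessThan_Suc intro!: sum.cong)
    also have "(\<Sum>k<?N. A $$ (i,k) * v $ k) = (A *\<^sub>v v) $ i"
      using carrier_matD[OF A] v(1) that by (auto simp: scalar_prod_def atLeast0LessThan simp del: sum.lessThan_Suc intro!: sum.cong)
    also have "\<dots> = e * v $ i" using v that by simp
    finally show ?thesis using c that by simp
  qed
  have M0: "M $$ (i,0) = (if i = 0 then e else 0)" if "i < ?N" for i
  proof -
    have "M $$ (i,0) = (adj W * (A * W)) $$ (i,0)" by (simp add: M_def mult_assoc_sq[of _ ?N])
    also have "\<dots> = (\<Sum>k<?N. adj W $$ (i,k) * (A * W) $$ (k,0))"
      using that by (intro index_mult_sum[of _ ?N ?N _ ?N]) (auto simp: sq)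
    also have "\<dots> = e * (\<Sum>k<?N. adj W $$ (i,k) * W $$ (k,0))"
      by (simp add: AW0 sum_distrib_left algebra_simps del: sum.lessThan_Suc)
    also have "(\<Sum>k<?N. adj W $$ (i,k) * W $$ (k,0)) = (adj W * W) $$ (i,0)"
      using that by (intro index_mult_sum[symmetric, of _ ?N ?N _ ?N]) auto
    finally show ?thesis using that by (simp add: WW)
  qed
  have M0': "M $$ (0,j) = (if j = 0 then e else 0)" if "j < ?N" for j
  proof (cases "j = 0")
    case True then show ?thesis using M0[of 0] by simp
  next
    case False
    \<comment> \<open>For a normal matrix the first row and the first column have the same norm. The
      column has the single nonzero entry \<open>e\<close>, which is also the corner of the row, so
      the rest of the row vanishes.\<close>
    have "(\<Sum>k<?N. M $$ (0,k) * cnj (M $$ (0,k))) = (M * adj M) $$ (0,0)"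
      using M by (subst index_mult_sum[of _ ?N ?N _ ?N]) (auto simp: adj_carrier simp del: sum.lessThan_Suc)
    also have "\<dots> = (\<Sum>k<?N. cnj (M $$ (k,0)) * M $$ (k,0))"
      unfolding normal
      using M by (subst index_mult_sum[of _ ?N ?N _ ?N]) (auto simp: adj_carrier simp del: sum.lessThan_Suc)
    also have "\<dots> = cnj e * e"
      by (subst sum.lessThan_Suc_shift) (simp add: M0)
    finally have "(\<Sum>k<n. M $$ (0,Suc k) * cnj (M $$ (0,Suc k))) = 0"
      unfolding sum.lessThan_Suc_shift by (simp add: M0)
    then have "of_real (\<Sum>k<n. (cmod (M $$ (0,Suc k)))\<^sup>2) = (0::complex)"
      by (simp only: of_real_sum complex_norm_square[symmetric] of_real_power)
    then have "(\<Sum>k<n. (cmod (M $$ (0,Suc k)))\<^sup>2) = 0"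
      using of_real_eq_0_iff by blast
    then have "\<forall>k<n. M $$ (0,Suc k) = 0"
      by (subst (asm) sum_nonneg_eq_0_iff) auto
    then show ?thesis using that False by (cases j) auto
  qed
  define M' where "M' = mat n n (\<lambda>(i,j). M $$ (Suc i, Suc j))"
  have M': "M' \<in> carrier_mat n n" by (simp add: M'_def)
  define E where "E = mat 1 1 (\<lambda>_. e)"
  have E: "E \<in> carrier_mat 1 1" by (simp add: E_def)
  have Mblock: "M = four_block_mat E (0\<^sub>m 1 n) (0\<^sub>m n 1) M'"
    using M M0 M0' by (intro eq_matI) (auto simp: M'_def E_def)
  have "M * adj M = four_block_mat (E * adj E) (0\<^sub>m 1 n) (0\<^sub>m n 1) (M' * adj M')"
    unfolding Mblock using E M'
    by (subst four_block_adj[of _ 1 _ n]) (auto simp: adj_carrier mult_four_block_mat[of _ 1 1 _ n _ n _ _ 1 _ n])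
  moreover have "adj M * M = four_block_mat (adj E * E) (0\<^sub>m 1 n) (0\<^sub>m n 1) (adj M' * M')"
    unfolding Mblock using E M'
    by (subst four_block_adj[of _ 1 _ n]) (auto simp: adj_carrier mult_four_block_mat[of _ 1 1 _ n _ n _ _ 1 _ n])
  ultimately have blk: "four_block_mat (E * adj E) (0\<^sub>m 1 n) (0\<^sub>m n 1) (M' * adj M')
      = four_block_mat (adj E * E) (0\<^sub>m 1 n) (0\<^sub>m n 1) (adj M' * M')" using normal by simp
  have "M' * adj M' = adj M' * M'"
  proof (rule eq_matI)
    fix i j assume "i < dim_row (adj M' * M')" "j < dim_col (adj M' * M')"
    then have "i < n" "j < n" using M' by auto
    then show "(M' * adj M') $$ (i,j) = (adj M' * M') $$ (i,j)"
      using arg_cong[OF blk, of "\<lambda>X. X $$ (Suc i, Suc j)"] E M' by (simp del: index_mult_mat(1) add: index_mult_mat(2,3))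
  qed (use M' in auto)
  from Suc.IH[OF M' this] obtain U d where U: "unitary n U" and Ud: "M' = U * cdiag n d * adj U" by auto
  note Uc = unitary_carrier[OF U]
  define V where "V = four_block_mat (1\<^sub>m 1) (0\<^sub>m 1 n) (0\<^sub>m n 1) U"
  define d' where "d' i = (case i of 0 \<Rightarrow> e | Suc i \<Rightarrow> d i)" for i
  have V: "V \<in> carrier_mat ?N ?N" using Uc by (auto simp: V_def)
  have adjV: "adj V = four_block_mat (1\<^sub>m 1) (0\<^sub>m 1 n) (0\<^sub>m n 1) (adj U)"
    using Uc unfolding V_def by (subst four_block_adj[of _ 1 _ n]) (auto intro!: cong_four_block_mat eq_matI)
  have uV: "unitary ?N V"
  proof (rule unitaryI[OF V])
    have "adj V * V = four_block_mat (1\<^sub>m 1) (0\<^sub>m 1 n) (0\<^sub>m n 1) (1\<^sub>m n)"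
      unfolding adjV unfolding V_def using U Uc
      by (subst mult_four_block_mat[of _ 1 1 _ n _ n _ _ 1 _ n]) (auto simp: unitary_def adj_carrier)
    also have "\<dots> = 1\<^sub>m ?N" by (rule eq_matI) auto
    finally show "adj V * V = 1\<^sub>m ?N" .
  qed
  have D: "cdiag ?N d' = four_block_mat E (0\<^sub>m 1 n) (0\<^sub>m n 1) (cdiag n d)"
    by (rule eq_matI) (auto simp: E_def d'_def split: nat.splits)
  have "M = V * cdiag ?N d' * adj V"
    unfolding Mblock adjV D unfolding V_def Ud using U Uc E
    by (simp add: mult_four_block_mat[of _ 1 1 _ n _ n _ _ 1 _ n] adj_carrier mult_carrier_mat[of _ n n _ n])
  then have "A = (W * V) * cdiag ?N d' * adj (W * V)"
    using V adj_carrier[OF V] by (simp add: AM adj_mult[of _ ?N ?N _ ?N] mult_assoc_sq[of _ ?N] sq)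
  then show ?case using unitary_mult[OF W uV] by blast
qed

subsection \<open>Quadratic forms\<close>

lemma hermitian_carrier: "hermitian k A \<Longrightarrow> A \<in> carrier_mat k k"
  by (simp add: hermitian_def)

lemma pd_hermitian: "pd k A \<Longrightarrow> hermitian k A"
  by (simp add: pd_def)

lemma psd_hermitian: "psd k A \<Longrightarrow> hermitian k A"
  by (simp add: psd_def)

lemma pd_carrier: "pd k A \<Longrightarrow> A \<in> carrier_mat k k"
  by (simp add: pd_def hermitian_def)

lemma psd_carrier: "psd k A \<Longrightarrow> A \<in> carrier_mat k k"
  by (simp add: psd_def hermitian_def)

lemma hermitian_adj: "hermitian k A \<Longrightarrow> adj A = A"
  by (simp add: hermitian_def)

lemma sum_sandwich:
  "(\<Sum>i\<in>I. f i) * c * (\<Sum>j\<in>J. g j) = (\<Sum>i\<in>I. \<Sum>j\<in>J. f i * c * (g j :: complex))"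
  by (subst sum_distrib_right, subst sum_product) simp

lemma qform_congruence:
  assumes "S \<in> carrier_mat l k" "A \<in> carrier_mat l l"
  shows "qform k (adj S * A * S) v = qform l A (\<lambda>i. \<Sum>j<k. S $$ (i,j) * v j)"
proof -
  have "qform k (adj S * A * S) v
      = (\<Sum>i<k. \<Sum>j<k. cnj (v i) * (\<Sum>b<l. (\<Sum>a<l. cnj (S $$ (a,i)) * A $$ (a,b)) * S $$ (b,j)) * v j)"
    unfolding qform_def
  proof (intro sum.cong refl)
    fix i j assume "i \<in> {..<k}" "j \<in> {..<k}"
    then have ij: "i < k" "j < k" by auto
    have "(adj S * A * S) $$ (i,j) = (\<Sum>b<l. (adj S * A) $$ (i,b) * S $$ (b,j))"
      using assms ij adj_carrier[OF assms(1)] by (intro index_mult_sum) (auto intro: mult_carrier_mat)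
    also have "\<dots> = (\<Sum>b<l. (\<Sum>a<l. cnj (S $$ (a,i)) * A $$ (a,b)) * S $$ (b,j))"
      using assms ij adj_carrier[OF assms(1)]
      by (intro sum.cong refl, subst index_mult_sum[of _ k l _ l]) auto
    finally show "cnj (v i) * (adj S * A * S) $$ (i,j) * v j
      = cnj (v i) * (\<Sum>b<l. (\<Sum>a<l. cnj (S $$ (a,i)) * A $$ (a,b)) * S $$ (b,j)) * v j" by simp
  qed
  also have "\<dots> = (\<Sum>i<k. \<Sum>j<k. \<Sum>b<l. \<Sum>a<l. cnj (S $$ (a,i) * v i) * A $$ (a,b) * (S $$ (b,j) * v j))"
    by (simp add: sum_distrib_left sum_distrib_right algebra_simps)
  also have "\<dots> = (\<Sum>i<k. \<Sum>b<l. \<Sum>j<k. \<Sum>a<l. cnj (S $$ (a,i) * v i) * A $$ (a,b) * (S $$ (b,j) * v j))"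
    by (intro sum.cong refl sum.swap)
  also have "\<dots> = (\<Sum>b<l. \<Sum>i<k. \<Sum>j<k. \<Sum>a<l. cnj (S $$ (a,i) * v i) * A $$ (a,b) * (S $$ (b,j) * v j))"
    by (rule sum.swap)
  also have "\<dots> = (\<Sum>b<l. \<Sum>i<k. \<Sum>a<l. \<Sum>j<k. cnj (S $$ (a,i) * v i) * A $$ (a,b) * (S $$ (b,j) * v j))"
    by (intro sum.cong refl sum.swap)
  also have "\<dots> = (\<Sum>b<l. \<Sum>a<l. \<Sum>i<k. \<Sum>j<k. cnj (S $$ (a,i) * v i) * A $$ (a,b) * (S $$ (b,j) * v j))"
    by (intro sum.cong refl sum.swap)
  also have "\<dots> = (\<Sum>a<l. \<Sum>b<l. \<Sum>i<k. \<Sum>j<k. cnj (S $$ (a,i) * v i) * A $$ (a,b) * (S $$ (b,j) * v j))"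
    by (rule sum.swap)
  also have "\<dots> = qform l A (\<lambda>i. \<Sum>j<k. S $$ (i,j) * v j)"
    unfolding qform_def cnj_sum sum_sandwich ..
  finally show ?thesis .
qed

lemma qform_cdiag: "qform k (cdiag k d) v = (\<Sum>i<k. d i * of_real ((cmod (v i))\<^sup>2))"
proof -
  have "qform k (cdiag k d) v = (\<Sum>i<k. \<Sum>j<k. if i = j then cnj (v i) * d i * v j else 0)"
    unfolding qform_def by (intro sum.cong refl) auto
  also have "\<dots> = (\<Sum>i<k. d i * of_real ((cmod (v i))\<^sup>2))"
    unfolding complex_norm_square by (simp add: algebra_simps)
  finally show ?thesis .
qed

lemma qform_one: "qform k (1\<^sub>m k) v = of_real (\<Sum>i<k. (cmod (v i))\<^sup>2)"
  by (simp add: qform_cdiag flip: cdiag_one)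

lemma qform_add: "A \<in> carrier_mat k k \<Longrightarrow> B \<in> carrier_mat k k \<Longrightarrow>
    qform k (A + B) v = qform k A v + qform k B v"
  unfolding qform_def sum.distrib[symmetric] by (intro sum.cong refl) (simp add: algebra_simps)

lemma qform_smult: "A \<in> carrier_mat k k \<Longrightarrow> qform k (c \<cdot>\<^sub>m A) v = c * qform k A v"
  unfolding qform_def sum_distrib_left by (intro sum.cong refl) (simp add: algebra_simps)

lemma hermitian_index: "hermitian k A \<Longrightarrow> i < k \<Longrightarrow> j < k \<Longrightarrow> cnj (A $$ (i,j)) = A $$ (j,i)"
  using adj_index[of j A i] by (auto simp: hermitian_def)

lemma hermitian_qform_Im: assumes "hermitian k A" shows "Im (qform k A v) = 0"
proof -
  have "cnj (qform k A v) = (\<Sum>i<k. \<Sum>j<k. cnj (v j) * A $$ (j,i) * v i)"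
    unfolding qform_def by (auto simp: hermitian_index[OF assms] algebra_simps intro!: sum.cong)
  also have "\<dots> = qform k A v"
    unfolding qform_def by (rule sum.swap)
  finally show ?thesis by (metis complex_cnj_cancel_iff complex_eq_iff cnj.simps(2) equal_neg_zero)
qed

lemma hermitian_congruence:
  assumes "S \<in> carrier_mat l k" "hermitian l A"
  shows "hermitian k (adj S * A * S)"
proof -
  note A = hermitian_carrier[OF assms(2)]
  have "adj (adj S * A * S) = adj S * (A * S)"
    using adj_mult[OF mult_carrier_mat[OF adj_carrier[OF assms(1)] A] assms(1)]
      adj_mult[OF adj_carrier[OF assms(1)] A] hermitian_adj[OF assms(2)] by simp
  also have "\<dots> = adj S * A * S"
    using assoc_mult_mat[OF adj_carrier[OF assms(1)] A assms(1)] by simp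
  finally show ?thesis
    using assms A adj_carrier[OF assms(1)] by (auto simp: hermitian_def)
qed

lemma hermitian_add: "hermitian k A \<Longrightarrow> hermitian k B \<Longrightarrow> hermitian k (A + B)"
  by (auto simp: hermitian_def adj_add)

lemma hermitian_smult: "hermitian k A \<Longrightarrow> hermitian k (complex_of_real c \<cdot>\<^sub>m A)"
  by (auto simp: hermitian_def adj_smult)

lemma hermitian_one: "hermitian k (1\<^sub>m k)"
  by (auto simp: hermitian_def)

lemma hermitian_rdiag: "hermitian k (rdiag k d)"
  by (auto simp: hermitian_def rdiag_cdiag adj_cdiag)

lemma psd_congruence: "S \<in> carrier_mat l k \<Longrightarrow> psd l A \<Longrightarrow> psd k (adj S * A * S)"
  by (auto simp: psd_def hermitian_congruence qform_congruence hermitian_carrier)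

lemma psd_one: "psd k (1\<^sub>m k)"
  by (auto simp: psd_def hermitian_one qform_one sum_nonneg)

lemma psd_gram: assumes "S \<in> carrier_mat l k" shows "psd k (adj S * S)"
  using psd_congruence[OF assms psd_one] assms adj_carrier[OF assms] by simp

lemma psd_smult: "psd k A \<Longrightarrow> 0 \<le> c \<Longrightarrow> psd k (complex_of_real c \<cdot>\<^sub>m A)"
  by (auto simp: psd_def hermitian_smult qform_smult hermitian_carrier)

lemma pd_imp_psd: "pd k A \<Longrightarrow> psd k A"
proof -
  assume A: "pd k A"
  have "0 \<le> Re (qform k A v)" for v
  proof (cases "\<exists>i<k. v i \<noteq> 0")
    case True then show ?thesis using A by (force simp: pd_def)
  next
    case False then show ?thesis by (simp add: qform_def)
  qed
  then show ?thesis using A by (simp add: pd_def psd_def)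
qed

lemma pd_one: "pd k (1\<^sub>m k)"
  by (auto simp: pd_def hermitian_one qform_one intro!: sum_pos2)

lemma pd_add_psd: "pd k A \<Longrightarrow> psd k B \<Longrightarrow> pd k (A + B)"
  by (auto simp: pd_def psd_def hermitian_add qform_add hermitian_carrier intro!: add_pos_nonneg)

lemma pd_smult: "pd k A \<Longrightarrow> 0 < c \<Longrightarrow> pd k (complex_of_real c \<cdot>\<^sub>m A)"
  by (auto simp: pd_def hermitian_smult qform_smult hermitian_carrier)

lemma pd_convex:
  assumes "pd k A" "pd k B" "0 \<le> t" "t \<le> 1"
  shows "pd k (complex_of_real t \<cdot>\<^sub>m A + complex_of_real (1 - t) \<cdot>\<^sub>m B)"
proof (cases "t = 0")
  case True
  then have "pd k (complex_of_real (1 - t) \<cdot>\<^sub>m B + complex_of_real t \<cdot>\<^sub>m A)"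
    using assms by (intro pd_add_psd pd_smult psd_smult pd_imp_psd) auto
  then show ?thesis
    using comm_add_mat[of "complex_of_real t \<cdot>\<^sub>m A" k k "complex_of_real (1 - t) \<cdot>\<^sub>m B"] assms
    by (simp add: pd_carrier)
next
  case False
  then show ?thesis using assms by (intro pd_add_psd pd_smult psd_smult pd_imp_psd) auto
qed

text \<open>The left inverse \<open>T\<close> makes \<open>S\<close> injective. Rectangular
  \<open>S\<close> is allowed, so that compressions to fewer dimensions are covered.\<close>

lemma pd_congruence:
  assumes S: "S \<in> carrier_mat l k" and T: "T \<in> carrier_mat k l" "T * S = 1\<^sub>m k" and A: "pd l A"
  shows "pd k (adj S * A * S)"
  unfolding pd_def
proof (intro conjI allI impI)
  show "hermitian k (adj S * A * S)" using S A by (simp add: hermitian_congruence pd_hermitian)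
  fix v :: "nat \<Rightarrow> complex" assume v: "\<exists>i<k. v i \<noteq> 0"
  define w where "w i = (\<Sum>j<k. S $$ (i,j) * v j)" for i
  have vw: "v i = (\<Sum>j<l. T $$ (i,j) * w j)" if "i < k" for i
  proof -
    have "(\<Sum>j<l. T $$ (i,j) * w j) = (\<Sum>m<k. (\<Sum>j<l. T $$ (i,j) * S $$ (j,m)) * v m)"
      unfolding w_def sum_distrib_left sum_distrib_right by (subst sum.swap) (simp add: mult.assoc)
    also have "\<dots> = (\<Sum>m<k. (T * S) $$ (i,m) * v m)"
      using that S T by (intro sum.cong refl, subst index_mult_sum[of _ k l _ k]) auto
    also have "\<dots> = (\<Sum>m<k. if i = m then v m else 0)"
      unfolding T(2) using that by (intro sum.cong) auto
    also have "\<dots> = v i" using that by simp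
    finally show ?thesis by simp
  qed
  have "\<exists>i<l. w i \<noteq> 0"
  proof (rule ccontr)
    assume "\<not> (\<exists>i<l. w i \<noteq> 0)"
    then have "\<forall>i<k. v i = 0" using vw by simp
    then show False using v by auto
  qed
  then show "0 < Re (qform k (adj S * A * S) v)"
    using A by (simp add: qform_congruence[OF S pd_carrier[OF A]] pd_def flip: w_def)
qed

lemma pd_rdiag: assumes "\<And>i. i < k \<Longrightarrow> 0 < d i" shows "pd k (rdiag k d)"
proof -
  have "0 < (\<Sum>i<k. d i * (cmod (v i))\<^sup>2)" if "\<exists>i<k. v i \<noteq> 0" for v :: "nat \<Rightarrow> complex"
    using that assms by (auto intro!: sum_pos2 simp: less_imp_le)
  moreover have "Re (qform k (rdiag k d) v) = (\<Sum>i<k. d i * (cmod (v i))\<^sup>2)" for v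
    by (simp add: rdiag_cdiag qform_cdiag flip: of_real_power)
  ultimately show ?thesis by (auto simp: pd_def hermitian_rdiag)
qed

lemma psd_rdiag: assumes "\<And>i. i < k \<Longrightarrow> 0 \<le> d i" shows "psd k (rdiag k d)"
proof -
  have "Re (qform k (rdiag k d) v) = (\<Sum>i<k. d i * (cmod (v i))\<^sup>2)" for v
    by (simp add: rdiag_cdiag qform_cdiag flip: of_real_power)
  then show ?thesis using assms by (auto simp: psd_def hermitian_rdiag intro!: sum_nonneg)
qed

subsection \<open>Functional calculus\<close>

definition udec :: "nat \<Rightarrow> complex mat \<Rightarrow> (nat \<Rightarrow> real) \<Rightarrow> complex mat \<Rightarrow> bool" where
  "udec k U d A \<longleftrightarrow> unitary k U \<and> A = U * rdiag k d * adj U"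

lemma udec_unitary: "udec k U d A \<Longrightarrow> unitary k U"
  by (simp add: udec_def)

lemma udec_carrier: "udec k U d A \<Longrightarrow> A \<in> carrier_mat k k"
  by (auto simp: udec_def adj_def unitary_def)

lemma adj_conjugate_unitary:
  assumes U: "unitary k U" and X: "X \<in> carrier_mat k k"
  shows "adj U * (U * X * adj U) * U = X"
  using unitary_carrier[OF U] adj_carrier[OF unitary_carrier[OF U]] X U
  by (simp add: mult_assoc_sq[of _ k] mult_carrier_mat[of _ k k _ k]
      mult_cancel_inverse[of _ k _ _ k] unitary_def)

lemma adj_conjugate:
  assumes U: "U \<in> carrier_mat k k" and X: "X \<in> carrier_mat k k"
  shows "adj (U * X * adj U) = U * adj X * adj U"
  using U adj_carrier[OF U] X adj_carrier[OF X]
  by (simp add: mult_assoc_sq[of _ k] mult_carrier_mat[of _ k k _ k] adj_mult[of _ k k _ k])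

lemma conjugate_mult:
  assumes U: "unitary k U" and X: "X \<in> carrier_mat k k" and Y: "Y \<in> carrier_mat k k"
  shows "(U * X * adj U) * (U * Y * adj U) = U * (X * Y) * adj U"
  using unitary_carrier[OF U] adj_carrier[OF unitary_carrier[OF U]] X Y U
  by (simp add: mult_assoc_sq[of _ k] mult_carrier_mat[of _ k k _ k]
      mult_cancel_inverse[of _ k _ _ k] unitary_def)

lemma hermitian_udec: assumes "hermitian k A" shows "\<exists>U d. udec k U d A"
proof -
  note A = hermitian_carrier[OF assms]
  obtain U d where U: "unitary k U" and Ad: "A = U * cdiag k d * adj U"
    using spectral_normal[OF A] assms by (auto simp: hermitian_def)
  have "U * cdiag k (\<lambda>i. cnj (d i)) * adj U = U * cdiag k d * adj U"
    using adj_conjugate[OF unitary_carrier[OF U] cdiag_carrier, of d] assms Ad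
    by (simp add: adj_cdiag hermitian_adj)
  then have "cdiag k (\<lambda>i. cnj (d i)) = cdiag k d"
    using adj_conjugate_unitary[OF U cdiag_carrier] by metis
  then have "cnj (d i) = d i" if "i < k" for i
    using cdiag_index[OF that that] by metis
  then have "d i = of_real (Re (d i))" if "i < k" for i
    using that by (metis complex_eq_iff Re_complex_of_real Im_complex_of_real cnj.simps(2) equal_neg_zero)
  then have "cdiag k d = rdiag k (\<lambda>i. Re (d i))"
    unfolding rdiag_cdiag by (intro cdiag_cong) auto
  then show ?thesis using U Ad unfolding udec_def by auto
qed

lemma index_mult_cdiag:
  assumes "W \<in> carrier_mat l k" "i < l" "j < k"
  shows "(W * cdiag k x) $$ (i,j) = W $$ (i,j) * x j"
  using assms by (subst index_mult_sum[of _ l k _ k]; simp add: if_distrib[of "\<lambda>x. _ * x"] cong: if_cong)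

lemma index_cdiag_mult:
  assumes "W \<in> carrier_mat k l" "i < k" "j < l"
  shows "(cdiag k x * W) $$ (i,j) = x i * W $$ (i,j)"
  using assms by (subst index_mult_sum[of _ k k _ l]; simp add: if_distrib[of "\<lambda>x. x * _"] cong: if_cong)

lemma index_conjugate_cdiag:
  assumes "U \<in> carrier_mat k k" "i < k" "j < k"
  shows "(U * cdiag k d * adj U) $$ (i,j) = (\<Sum>m<k. d m * (U $$ (i,m) * cnj (U $$ (j,m))))"
proof -
  have "(U * cdiag k d * adj U) $$ (i,j) = (\<Sum>m<k. (U * cdiag k d) $$ (i,m) * adj U $$ (m,j))"
    using assms adj_carrier[OF assms(1)] by (intro index_mult_sum) (auto intro: mult_carrier_mat)
  also have "\<dots> = (\<Sum>m<k. d m * (U $$ (i,m) * cnj (U $$ (j,m))))"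
    using assms by (intro sum.cong refl) (auto simp: index_mult_cdiag[of _ k k] simp del: index_mult_mat(1))
  finally show ?thesis .
qed

lemma udec_permute:
  assumes dec: "udec k U d A" and bij: "bij_betw \<sigma> {..<k} {..<k}"
  shows "udec k (mat k k (\<lambda>(i,j). U $$ (i, \<sigma> j))) (d \<circ> \<sigma>) A"
proof -
  let ?V = "mat k k (\<lambda>(i,j). U $$ (i, \<sigma> j))"
  have V: "?V \<in> carrier_mat k k" by simp
  note U = unitary_carrier[OF udec_unitary[OF dec]]
  have \<sigma>: "\<sigma> i < k" if "i < k" for i using bij that by (auto simp: bij_betw_def)
  have eq: "?V * cdiag k (e \<circ> \<sigma>) * adj ?V = U * cdiag k e * adj U" for e
  proof (rule eq_matI)
    fix i j assume "i < dim_row (U * cdiag k e * adj U)" "j < dim_col (U * cdiag k e * adj U)"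
    then have ij: "i < k" "j < k" using U by auto
    have "(?V * cdiag k (e \<circ> \<sigma>) * adj ?V) $$ (i,j)
        = (\<Sum>m<k. e (\<sigma> m) * (U $$ (i,\<sigma> m) * cnj (U $$ (j,\<sigma> m))))"
      unfolding index_conjugate_cdiag[OF V ij] using ij by (intro sum.cong) auto
    also have "\<dots> = (U * cdiag k e * adj U) $$ (i,j)"
      unfolding index_conjugate_cdiag[OF U ij] by (rule sum.reindex_bij_betw[OF bij])
    finally show "(?V * cdiag k (e \<circ> \<sigma>) * adj ?V) $$ (i,j) = (U * cdiag k e * adj U) $$ (i,j)" .
  qed (use U V in auto)
  have "?V * adj ?V = 1\<^sub>m k"
  proof -
    have "?V * adj ?V = ?V * cdiag k ((\<lambda>_. 1) \<circ> \<sigma>) * adj ?V"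
      unfolding o_def cdiag_one right_mult_one_mat[OF V] ..
    also have "\<dots> = U * cdiag k (\<lambda>_. 1) * adj U" by (rule eq)
    also have "\<dots> = 1\<^sub>m k"
      unfolding cdiag_one right_mult_one_mat[OF U] using udec_unitary[OF dec] by (simp add: unitary_def)
    finally show ?thesis .
  qed
  then have "adj (adj ?V) * adj ?V = 1\<^sub>m k" unfolding adj_adj .
  from unitary_adj[OF unitaryI[OF adj_carrier[OF V] this]] have uV: "unitary k ?V" unfolding adj_adj .
  have "A = U * cdiag k (\<lambda>i. of_real (d i)) * adj U"
    using dec unfolding udec_def rdiag_cdiag by (rule conjunct2)
  also have "\<dots> = ?V * rdiag k (d \<circ> \<sigma>) * adj ?V"
    unfolding eq[symmetric] rdiag_cdiag o_def ..
  finally show ?thesis unfolding udec_def by (intro conjI uV)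
qed

text \<open>The key \<open>g\<close> permits decreasing as well as increasing order; the decreasing
  order serves negative exponents, where the eigenvalues are inverted afterwards.\<close>

lemma hermitian_udec_sorted:
  fixes g :: "real \<Rightarrow> real"
  assumes "hermitian k A"
  shows "\<exists>U d. udec k U d A \<and> (\<forall>j<k. \<forall>i\<le>j. g (d i) \<le> g (d j))"
proof -
  obtain U d where dec: "udec k U d A" using hermitian_udec[OF assms] by auto
  define xs where "xs = sort_key (g \<circ> d) [0..<k]"
  have xs: "length xs = k" "distinct xs" "set xs = {..<k}" "sorted (map (g \<circ> d) xs)"
    unfolding xs_def by auto
  have bij: "bij_betw ((!) xs) {..<k} {..<k}"
    by (rule bij_betw_nth[OF xs(2)]) (simp_all add: xs)
  have "g ((d \<circ> (!) xs) i) \<le> g ((d \<circ> (!) xs) j)" if "j < k" "i \<le> j" for i j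
    using sorted_nth_mono[OF xs(4) that(2)] that xs(1) by simp
  with udec_permute[OF dec bij] show ?thesis by blast
qed

lemma udec_qform:
  assumes "udec k U d A"
  shows "qform k A v = of_real (\<Sum>j<k. d j * (cmod (\<Sum>i<k. cnj (U $$ (i,j)) * v i))\<^sup>2)"
proof -
  note U = unitary_carrier[OF udec_unitary[OF assms]]
  have "qform k A v = qform k (rdiag k d) (\<lambda>i. \<Sum>j<k. adj U $$ (i,j) * v j)"
    using assms qform_congruence[OF adj_carrier[OF U] rdiag_carrier, of d v] by (simp add: udec_def)
  also have "\<dots> = of_real (\<Sum>j<k. d j * (cmod (\<Sum>i<k. adj U $$ (j,i) * v i))\<^sup>2)"
    by (simp add: rdiag_cdiag qform_cdiag)
  also have "(\<Sum>j<k. d j * (cmod (\<Sum>i<k. adj U $$ (j,i) * v i))\<^sup>2)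
      = (\<Sum>j<k. d j * (cmod (\<Sum>i<k. cnj (U $$ (i,j)) * v i))\<^sup>2)"
    using U by (intro sum.cong refl arg_cong2[where f="(*)"] arg_cong[where f="\<lambda>x. (cmod x)\<^sup>2"]) auto
  finally show ?thesis .
qed

lemma unitary_columns:
  assumes "unitary k U" "i < k" "j < k"
  shows "(\<Sum>m<k. cnj (U $$ (m,i)) * U $$ (m,j)) = (if i = j then 1 else 0)"
proof -
  note U = unitary_carrier[OF assms(1)]
  have "(\<Sum>m<k. cnj (U $$ (m,i)) * U $$ (m,j)) = (adj U * U) $$ (i,j)"
    using U assms by (subst index_mult_sum[of _ k k _ k]) (auto simp: adj_carrier)
  then show ?thesis using assms by (simp add: unitary_def)
qed

lemma unitary_columns_norm:
  assumes "unitary k U" "j < k"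
  shows "(\<Sum>m<k. (cmod (U $$ (m,j)))\<^sup>2) = 1"
proof -
  have "complex_of_real (\<Sum>m<k. (cmod (U $$ (m,j)))\<^sup>2) = 1"
    using unitary_columns[OF assms(1) assms(2) assms(2)]
    by (simp add: complex_norm_square mult.commute del: of_real_power)
  then show ?thesis using of_real_eq_1_iff by blast
qed

lemma unitary_rows_norm:
  assumes "unitary k U" "i < k"
  shows "(\<Sum>m<k. (cmod (U $$ (i,m)))\<^sup>2) = 1"
  using unitary_columns_norm[OF unitary_adj[OF assms(1)] assms(2)] unitary_carrier[OF assms(1)] assms(2)
  by simp

lemma udec_qform_column:
  assumes dec: "udec k U d A" and j: "j < k"
  shows "qform k A (\<lambda>i. U $$ (i,j)) = of_real (d j)"
proof -
  have "(\<Sum>m<k. d m * (cmod (\<Sum>i<k. cnj (U $$ (i,m)) * U $$ (i,j)))\<^sup>2) = (\<Sum>m<k. if m = j then d m else 0)"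
    using unitary_columns[OF udec_unitary[OF dec] _ j] by (intro sum.cong refl) auto
  then show ?thesis using j by (simp add: udec_qform[OF dec])
qed

lemma udec_pd: assumes dec: "udec k U d A" and "pd k A" and j: "j < k" shows "0 < d j"
proof -
  have "\<exists>i<k. U $$ (i,j) \<noteq> 0"
    using unitary_columns[OF udec_unitary[OF dec] j j] by (metis (no_types, lifting) lessThan_iff mult_zero_right sum.neutral zero_neq_one)
  then show ?thesis using assms udec_qform_column[OF dec j] by (auto simp: pd_def)
qed

lemma udec_psd: assumes dec: "udec k U d A" and "psd k A" and j: "j < k" shows "0 \<le> d j"
  using assms udec_qform_column[OF dec j] by (metis Re_complex_of_real psd_def)

lemma udec_imp_pd: 
  assumes "udec k U d A" "\<And>i. i < k \<Longrightarrow> 0 < d i" shows "pd k A"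
proof -
  note u = udec_unitary[OF assms(1)]
  show ?thesis
    using pd_congruence[OF adj_carrier[OF unitary_carrier[OF u]] unitary_carrier[OF u] _ pd_rdiag[of k d]] assms
    by (auto simp: udec_def unitary_def)
qed

text \<open>The unitary \<open>adj V * U\<close> intertwines the two diagonals, so its entry at
  \<open>(i,j)\<close> can be nonzero only if \<open>d j = e i\<close>; hence it also intertwines
  their images under \<open>h\<close>. This is what makes the choice inside \<open>mat_fun\<close>
  harmless.\<close>

lemma udec_unique:
  assumes 1: "udec k U d A" and 2: "udec k V e A"
  shows "U * rdiag k (h \<circ> d) * adj U = V * rdiag k (h \<circ> e) * adj V"
proof -
  note u = udec_unitary[OF 1] and v = udec_unitary[OF 2]
  note [simp] = unitary_carrier[OF u] unitary_carrier[OF v] adj_carrier[OF unitary_carrier[OF u]]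
    adj_carrier[OF unitary_carrier[OF v]]
  note s = mult_assoc_sq[of _ k] mult_carrier_mat[of _ k k _ k] mult_cancel_inverse[of _ k _ _ k]
    right_mult_one_mat[of _ k]
  have uu: "U * adj U = 1\<^sub>m k" "adj U * U = 1\<^sub>m k" "V * adj V = 1\<^sub>m k" "adj V * V = 1\<^sub>m k"
    using u v by (auto simp: unitary_def)
  define W where "W = adj V * U"
  have W: "W \<in> carrier_mat k k" by (simp add: W_def s)
  have eq: "U * rdiag k d * adj U = V * rdiag k e * adj V" using 1 2 by (simp add: udec_def)
  have "adj V * (U * rdiag k d * adj U) * U = adj V * (V * rdiag k e * adj V) * U" by (simp only: eq)
  then have eW: "W * rdiag k d = rdiag k e * W" by (simp add: W_def s uu)
  note ind = index_mult_cdiag[OF W] index_cdiag_mult[OF W]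
  have "W * rdiag k (h \<circ> d) = rdiag k (h \<circ> e) * W"
  proof (rule eq_matI)
    fix i j assume "i < dim_row (rdiag k (h \<circ> e) * W)" "j < dim_col (rdiag k (h \<circ> e) * W)"
    then have ij: "i < k" "j < k" using W by auto
    have "(W * rdiag k d) $$ (i,j) = (rdiag k e * W) $$ (i,j)" by (simp only: eW)
    then have "W $$ (i,j) = 0 \<or> d j = e i" using ij by (auto simp: rdiag_cdiag ind)
    then show "(W * rdiag k (h \<circ> d)) $$ (i,j) = (rdiag k (h \<circ> e) * W) $$ (i,j)"
      using ij by (auto simp: rdiag_cdiag ind)
  qed (use W in auto)
  then have "V * (W * rdiag k (h \<circ> d)) * adj U = V * (rdiag k (h \<circ> e) * W) * adj U" by simp
  then show ?thesis by (simp add: W_def s uu)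
qed

lemma mat_fun_udec: assumes "udec k U d A" shows "mat_fun k h A = U * rdiag k (h \<circ> d) * adj U"
proof -
  have "\<exists>B U d. unitary k U \<and> A = U * rdiag k d * adj U \<and> B = U * rdiag k (h \<circ> d) * adj U"
    using assms by (auto simp: udec_def)
  from someI_ex[OF this, folded mat_fun_def] obtain V e where
    "udec k V e A" "mat_fun k h A = V * rdiag k (h \<circ> e) * adj V" by (auto simp: udec_def)
  then show ?thesis using udec_unique[OF assms] by metis
qed

lemma udec_mat_fun: "udec k U d A \<Longrightarrow> udec k U (h \<circ> d) (mat_fun k h A)"
  by (simp add: mat_fun_udec udec_def)

subsection \<open>The trace\<close>

lemma mtrace_sum: "A \<in> carrier_mat k k \<Longrightarrow> mtrace A = (\<Sum>i<k. A $$ (i,i))"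
  by (auto simp: mtrace_def)

lemma mtrace_add: "A \<in> carrier_mat k k \<Longrightarrow> B \<in> carrier_mat k k \<Longrightarrow> mtrace (A + B) = mtrace A + mtrace B"
  by (simp add: mtrace_def sum.distrib)

lemma mtrace_smult: "A \<in> carrier_mat k k \<Longrightarrow> mtrace (c \<cdot>\<^sub>m A) = c * mtrace A"
  by (simp add: mtrace_def sum_distrib_left)

lemma mtrace_mult_comm:
  assumes "A \<in> carrier_mat n m" "B \<in> carrier_mat m n"
  shows "mtrace (A * B) = mtrace (B * A)"
proof -
  have "mtrace (A * B) = (\<Sum>i<n. \<Sum>j<m. A $$ (i,j) * B $$ (j,i))"
    using assms by (subst mtrace_sum[of _ n])
      (auto simp del: index_mult_mat(1) intro!: sum.cong index_mult_sum mult_carrier_mat)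
  also have "\<dots> = (\<Sum>j<m. \<Sum>i<n. B $$ (j,i) * A $$ (i,j))"
    by (subst sum.swap) (simp add: mult.commute)
  also have "\<dots> = mtrace (B * A)"
    using assms by (subst mtrace_sum[of _ m])
      (auto simp del: index_mult_mat(1) intro!: sum.cong index_mult_sum[symmetric] mult_carrier_mat)
  finally show ?thesis .
qed

lemma mtrace_udec: assumes "udec k U d A" shows "mtrace A = of_real (\<Sum>j<k. d j)"
proof -
  note u = udec_unitary[OF assms]
  note U = unitary_carrier[OF u] and aU = adj_carrier[OF unitary_carrier[OF u]]
  have "mtrace A = mtrace (adj U * (U * rdiag k d))"
    using assms U aU by (simp add: udec_def mtrace_mult_comm[of _ k k])
  also have "adj U * (U * rdiag k d) = rdiag k d"
    using u U aU by (simp add: mult_cancel_inverse[of _ k _ _ k] unitary_def)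
  finally show ?thesis by (simp add: mtrace_sum[of _ k] rdiag_cdiag)
qed

lemma mtrace_mult_udec:
  assumes dec: "udec k U d A" and X: "X \<in> carrier_mat k k"
  shows "mtrace (X * A) = (\<Sum>j<k. of_real (d j) * qform k X (\<lambda>i. U $$ (i,j)))"
proof -
  note U = unitary_carrier[OF udec_unitary[OF dec]]
  have "mtrace (X * A) = (\<Sum>i<k. \<Sum>a<k. X $$ (i,a) * A $$ (a,i))"
    using X udec_carrier[OF dec] by (subst mtrace_sum[of _ k])
      (auto simp del: index_mult_mat(1) intro!: sum.cong index_mult_sum mult_carrier_mat)
  also have "\<dots> = (\<Sum>i<k. \<Sum>a<k. \<Sum>j<k. of_real (d j) * (cnj (U $$ (i,j)) * X $$ (i,a) * U $$ (a,j)))"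
  proof (intro sum.cong refl)
    fix i a assume "i \<in> {..<k}" "a \<in> {..<k}"
    then have "A $$ (a,i) = (\<Sum>j<k. of_real (d j) * (U $$ (a,j) * cnj (U $$ (i,j))))"
      using dec index_conjugate_cdiag[OF U] by (auto simp: udec_def rdiag_cdiag)
    then show "X $$ (i,a) * A $$ (a,i)
        = (\<Sum>j<k. of_real (d j) * (cnj (U $$ (i,j)) * X $$ (i,a) * U $$ (a,j)))"
      by (simp add: sum_distrib_left algebra_simps)
  qed
  also have "\<dots> = (\<Sum>i<k. \<Sum>j<k. \<Sum>a<k. of_real (d j) * (cnj (U $$ (i,j)) * X $$ (i,a) * U $$ (a,j)))"
    by (intro sum.cong refl sum.swap)
  also have "\<dots> = (\<Sum>j<k. \<Sum>i<k. \<Sum>a<k. of_real (d j) * (cnj (U $$ (i,j)) * X $$ (i,a) * U $$ (a,j)))"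
    by (rule sum.swap)
  also have "\<dots> = (\<Sum>j<k. of_real (d j) * qform k X (\<lambda>i. U $$ (i,j)))"
    by (simp add: qform_def sum_distrib_left)
  finally show ?thesis .
qed

lemma mtrace_psd_mult:
  assumes "psd k P" "psd k Q"
  shows "Im (mtrace (P * Q)) = 0 \<and> 0 \<le> Re (mtrace (P * Q))"
proof -
  obtain U d where dec: "udec k U d Q" using hermitian_udec[OF psd_hermitian[OF assms(2)]] by auto
  show ?thesis
    unfolding mtrace_mult_udec[OF dec psd_carrier[OF assms(1)]]
    using assms udec_psd[OF dec assms(2)]
    by (auto simp: psd_def hermitian_qform_Im intro!: sum_nonneg sum.neutral)
qed

subsection \<open>Complex powers of positive definite matrices\<close>

text \<open>One diagonalization is chosen for \<open>A\<close> independently of the exponent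
  \<open>z\<close>. The entries are therefore fixed combinations of exponentials of
  \<open>z\<close>, which makes them entire functions.\<close>

definition cpow :: "nat \<Rightarrow> complex mat \<Rightarrow> complex \<Rightarrow> complex mat" where
  "cpow k A z = (let (U, d) = (SOME (U, d). udec k U d A)
     in U * cdiag k (\<lambda>i. exp (z * of_real (ln (d i)))) * adj U)"

lemma cpow_udec:
  assumes "pd k A"
  obtains U d where "udec k U d A" "\<And>i. i < k \<Longrightarrow> 0 < d i"
    "\<And>z. cpow k A z = U * cdiag k (\<lambda>i. exp (z * of_real (ln (d i)))) * adj U"
proof -
  obtain U d where Ud: "(SOME (U, d). udec k U d A) = (U, d)" by fastforce
  have "\<exists>x. case x of (U, d) \<Rightarrow> udec k U d A"
    using hermitian_udec[OF pd_hermitian[OF assms]] by auto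
  from someI_ex[OF this] Ud have dec: "udec k U d A" by auto
  show ?thesis
    by (rule that[OF dec udec_pd[OF dec assms]]) (auto simp: cpow_def Ud)
qed

lemma cpow_carrier [simp]: assumes "pd k A" shows "cpow k A z \<in> carrier_mat k k"
proof -
  obtain U d where dec: "udec k U d A"
    and cp: "\<And>z. cpow k A z = U * cdiag k (\<lambda>i. exp (z * of_real (ln (d i)))) * adj U"
    using cpow_udec[OF assms] by metis
  note U = unitary_carrier[OF udec_unitary[OF dec]]
  show ?thesis
    unfolding cp by (intro mult_carrier_mat[of _ k k] U adj_carrier[OF U] cdiag_carrier)
qed

lemma cpow_mult: assumes "pd k A" shows "cpow k A z * cpow k A w = cpow k A (z + w)"
proof -
  obtain U d where dec: "udec k U d A"
    and cp: "\<And>z. cpow k A z = U * cdiag k (\<lambda>i. exp (z * of_real (ln (d i)))) * adj U"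
    using cpow_udec[OF assms] by metis
  show ?thesis unfolding cp
    by (simp add: conjugate_mult[OF udec_unitary[OF dec]] cdiag_mult algebra_simps flip: exp_add)
qed

lemma cpow_mult_assoc:
  assumes "pd k A" "X \<in> carrier_mat k m"
  shows "cpow k A z * (cpow k A w * X) = cpow k A (z + w) * X"
  using assoc_mult_mat[OF cpow_carrier[OF assms(1)] cpow_carrier[OF assms(1)] assms(2)]
  by (simp add: cpow_mult[OF assms(1)])

lemma adj_cpow: assumes "pd k A" shows "adj (cpow k A z) = cpow k A (cnj z)"
proof -
  obtain U d where dec: "udec k U d A"
    and cp: "\<And>z. cpow k A z = U * cdiag k (\<lambda>i. exp (z * of_real (ln (d i)))) * adj U"
    using cpow_udec[OF assms] by metis
  show ?thesis unfolding cp
    by (simp add: adj_conjugate[OF unitary_carrier[OF udec_unitary[OF dec]]] adj_cdiag exp_cnj)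
qed

lemma cpow_0: assumes "pd k A" shows "cpow k A 0 = 1\<^sub>m k"
proof -
  obtain U d where dec: "udec k U d A"
    and cp: "\<And>z. cpow k A z = U * cdiag k (\<lambda>i. exp (z * of_real (ln (d i)))) * adj U"
    using cpow_udec[OF assms] by metis
  show ?thesis unfolding cp
    using udec_unitary[OF dec] right_mult_one_mat[OF unitary_carrier[OF udec_unitary[OF dec]]]
    by (simp add: cdiag_one unitary_def)
qed

lemma udec_cpow:
  assumes "pd k A" "udec k U d A"
  shows "udec k U (\<lambda>i. d i powr p) (cpow k A (of_real p))"
proof -
  obtain V e where dec: "udec k V e A" and e: "\<And>i. i < k \<Longrightarrow> 0 < e i"
    and cp: "\<And>z. cpow k A z = V * cdiag k (\<lambda>i. exp (z * of_real (ln (e i)))) * adj V"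
    using cpow_udec[OF assms(1)] by metis
  have "cdiag k (\<lambda>i. exp (of_real p * of_real (ln (e i)))) = rdiag k ((\<lambda>x. x powr p) \<circ> e)"
    unfolding rdiag_cdiag using e
    by (intro cdiag_cong) (force simp: powr_def exp_of_real simp flip: of_real_mult)
  then have "cpow k A (of_real p) = V * rdiag k ((\<lambda>x. x powr p) \<circ> e) * adj V"
    by (simp add: cp)
  also have "\<dots> = U * rdiag k ((\<lambda>x. x powr p) \<circ> d) * adj U"
    by (rule udec_unique[OF dec assms(2)])
  finally show ?thesis using udec_unitary[OF assms(2)] by (simp add: udec_def o_def)
qed

lemma mat_fun_powr: assumes "pd k A" shows "mat_fun k (\<lambda>x. x powr p) A = cpow k A (of_real p)"
proof -
  obtain U d where dec: "udec k U d A"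
    using hermitian_udec[OF pd_hermitian[OF assms]] by metis
  show ?thesis
    using udec_cpow[OF assms dec, of p] by (simp add: mat_fun_udec[OF dec] udec_def o_def)
qed

lemma pd_cpow: assumes "pd k A" shows "pd k (cpow k A (of_real p))"
proof -
  obtain U d where dec: "udec k U d A"
    using hermitian_udec[OF pd_hermitian[OF assms]] by metis
  have "0 < d i powr p" if "i < k" for i using udec_pd[OF dec assms that] by simp
  then show ?thesis by (rule udec_imp_pd[OF udec_cpow[OF assms dec]])
qed

lemma cpow_1: assumes "pd k A" shows "cpow k A 1 = A"
proof -
  obtain U d where dec: "udec k U d A"
    using hermitian_udec[OF pd_hermitian[OF assms]] by metis
  have "rdiag k (\<lambda>i. d i powr 1) = rdiag k d"
    unfolding rdiag_cdiag using udec_pd[OF dec assms] by (intro cdiag_cong) force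
  then show ?thesis
    using udec_cpow[OF assms dec, of 1] dec by (simp add: udec_def)
qed

lemma unitary_cpow: assumes "pd k A" shows "unitary k (cpow k A (\<i> * of_real y))"
  by (rule unitaryI) (simp_all add: assms adj_cpow cpow_mult cpow_0)

subsection \<open>Hadamard's three lines theorem\<close>

text \<open>Everything interpolated below is built by sums and products from exponentials of real
  affine functions of \<open>z\<close>. These are entire and bounded on the closed strip, and both
  properties are preserved.\<close>

definition strip_bounded :: "(complex \<Rightarrow> complex) \<Rightarrow> bool" where
  "strip_bounded g \<longleftrightarrow> g holomorphic_on UNIV \<and> (\<exists>B. \<forall>z. 0 \<le> Re z \<longrightarrow> Re z \<le> 1 \<longrightarrow> cmod (g z) \<le> B)"

lemma strip_bounded_const [intro]: "strip_bounded (\<lambda>_. c)"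
  by (auto simp: strip_bounded_def)

lemma strip_bounded_add [intro]:
  assumes "strip_bounded f" "strip_bounded g" shows "strip_bounded (\<lambda>z. f z + g z)"
proof -
  from assms obtain B C where "\<And>z. 0 \<le> Re z \<Longrightarrow> Re z \<le> 1 \<Longrightarrow> cmod (f z) \<le> B"
    "\<And>z. 0 \<le> Re z \<Longrightarrow> Re z \<le> 1 \<Longrightarrow> cmod (g z) \<le> C" by (auto simp: strip_bounded_def)
  then have "\<forall>z. 0 \<le> Re z \<longrightarrow> Re z \<le> 1 \<longrightarrow> cmod (f z + g z) \<le> B + C"
    by (meson add_mono norm_triangle_le)
  then show ?thesis using assms by (auto simp: strip_bounded_def intro!: holomorphic_intros)
qed

lemma strip_bounded_mult [intro]:
  assumes "strip_bounded f" "strip_bounded g" shows "strip_bounded (\<lambda>z. f z * g z)"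
proof -
  from assms obtain B C where B: "\<And>z. 0 \<le> Re z \<Longrightarrow> Re z \<le> 1 \<Longrightarrow> cmod (f z) \<le> B"
    and C: "\<And>z. 0 \<le> Re z \<Longrightarrow> Re z \<le> 1 \<Longrightarrow> cmod (g z) \<le> C" by (auto simp: strip_bounded_def)
  have "0 \<le> B" using order_trans[OF norm_ge_zero B[of 0]] by simp
  then have "\<forall>z. 0 \<le> Re z \<longrightarrow> Re z \<le> 1 \<longrightarrow> cmod (f z * g z) \<le> B * C"
    using B C by (simp add: norm_mult mult_mono)
  then show ?thesis using assms by (auto simp: strip_bounded_def intro!: holomorphic_intros)
qed

lemma strip_bounded_sum [intro]:
  "(\<And>i. i \<in> I \<Longrightarrow> strip_bounded (f i)) \<Longrightarrow> strip_bounded (\<lambda>z. \<Sum>i\<in>I. f i z)"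
  by (induction I rule: infinite_finite_induct) auto

lemma strip_bounded_exp [intro]:
  "strip_bounded (\<lambda>z. exp ((of_real c * z + of_real d) * of_real r))"
proof -
  have "cmod (exp ((of_real c * z + of_real d) * of_real r)) \<le> exp (\<bar>c * r\<bar> + \<bar>d * r\<bar>)"
    if "0 \<le> Re z" "Re z \<le> 1" for z
  proof -
    have "(c * Re z + d) * r \<le> \<bar>c * r\<bar> * Re z + \<bar>d * r\<bar>"
      using mult_right_mono[OF abs_ge_self[of "c * r"] that(1)] abs_ge_self[of "d * r"]
      by (simp add: algebra_simps)
    also have "\<dots> \<le> \<bar>c * r\<bar> + \<bar>d * r\<bar>" using that by (simp add: mult_left_le)
    finally show ?thesis by simp
  qed
  then show ?thesis by (auto simp: strip_bounded_def intro!: holomorphic_intros)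
qed

text \<open>With one bound \<open>T\<close> for both lines this is a maximum principle for the
  unbounded strip. The factor \<open>exp (\<epsilon> * (z^2 - 1))\<close> has modulus at most one
  there, because the real part of \<open>z^2 - 1\<close> is at most zero, and it decays with the
  height. The maximum modulus principle then applies on a tall rectangle, and \<epsilon> tends to
  zero.\<close>

theorem three_lines:
  assumes F: "strip_bounded F"
    and 0: "\<And>y. cmod (F (\<i> * of_real y)) \<le> T"
    and 1: "\<And>y. cmod (F (1 + \<i> * of_real y)) \<le> T"
    and x: "0 \<le> x" "x \<le> 1"
  shows "cmod (F (of_real x)) \<le> T"
proof -
  obtain B where B: "\<And>z. 0 \<le> Re z \<Longrightarrow> Re z \<le> 1 \<Longrightarrow> cmod (F z) \<le> B"
    using F by (auto simp: strip_bounded_def)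
  have hol: "F holomorphic_on UNIV" using F by (simp add: strip_bounded_def)
  have B0: "0 \<le> B" using order_trans[OF norm_ge_zero B[of 0]] by simp
  have T0: "0 \<le> T" by (rule order_trans[OF norm_ge_zero 0])
  have main: "cmod (F (of_real x)) * exp (\<epsilon> * (x\<^sup>2 - 1)) \<le> T + \<epsilon>" if \<epsilon>: "0 < \<epsilon>" for \<epsilon>
  proof -
    define g where "g z = F z * exp (of_real \<epsilon> * (z\<^sup>2 - 1))" for z
    have normg: "cmod (g z) = cmod (F z) * exp (\<epsilon> * ((Re z)\<^sup>2 - (Im z)\<^sup>2 - 1))" for z
      by (simp add: g_def norm_mult Re_power2)
    \<comment> \<open>The half-height \<open>r\<close> is taken so large that the global bound
      \<open>B\<close>, damped by the factor, falls below \<epsilon> on the horizontal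
      sides.\<close>
    have "((\<lambda>r. B * exp (- \<epsilon> * r\<^sup>2)) \<longlongrightarrow> 0) at_top"
      using \<epsilon> by real_asymp
    then have "eventually (\<lambda>r. B * exp (- \<epsilon> * r\<^sup>2) < \<epsilon>) at_top"
      using \<epsilon> by (rule order_tendstoD(2))
    from eventually_conj[OF this eventually_gt_at_top[of 0]]
    obtain r where r: "B * exp (- \<epsilon> * r\<^sup>2) < \<epsilon>" "0 < r"
      by (metis (mono_tags, lifting) eventually_happens' trivial_limit_at_top_linorder)
    let ?S = "cbox (Complex 0 (-r)) (Complex 1 r)"
    have S: "z \<in> ?S \<longleftrightarrow> 0 \<le> Re z \<and> Re z \<le> 1 \<and> - r \<le> Im z \<and> Im z \<le> r" for z
      by (auto simp: in_cbox_complex_iff)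
    have "cmod (g (of_real x)) \<le> T + \<epsilon>"
    proof (rule maximum_modulus_frontier[of g ?S])
      show "g holomorphic_on interior ?S" unfolding g_def
        by (intro holomorphic_intros holomorphic_on_subset[OF hol]) auto
      show "continuous_on (closure ?S) g" unfolding g_def
        by (intro continuous_intros holomorphic_on_imp_continuous_on holomorphic_on_subset[OF hol]) auto
      show "of_real x \<in> ?S" using x r by (simp add: S)
      fix z assume z: "z \<in> frontier ?S"
      then have zS: "0 \<le> Re z" "Re z \<le> 1" "- r \<le> Im z" "Im z \<le> r"
        by (auto simp: frontier_def S closure_cbox)
      have "z \<notin> box (Complex 0 (-r)) (Complex 1 r)"
        using z by (auto simp: frontier_def interior_cbox)
      then have cases: "Re z = 0 \<or> Re z = 1 \<or> Im z = - r \<or> Im z = r"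
        using zS by (auto simp: in_box_complex_iff)
      have le1: "exp (\<epsilon> * ((Re z)\<^sup>2 - (Im z)\<^sup>2 - 1)) \<le> 1"
        using zS \<epsilon> by (simp add: mult_le_0_iff) (smt (verit) power_le_one zero_le_power2)
      show "cmod (g z) \<le> T + \<epsilon>"
      proof (cases "Re z = 0 \<or> Re z = 1")
        case True
        then have "cmod (F z) \<le> T"
        proof
          assume "Re z = 0"
          then have "z = \<i> * of_real (Im z)" by (simp add: complex_eq_iff)
          then show ?thesis using 0[of "Im z"] by simp
        next
          assume "Re z = 1"
          then have "z = 1 + \<i> * of_real (Im z)" by (simp add: complex_eq_iff)
          then show ?thesis using 1[of "Im z"] by metis
        qed
        then have "cmod (g z) \<le> T * 1"
          unfolding normg using le1 T0 by (intro mult_mono) auto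
        then show ?thesis using \<epsilon> by simp
      next
        case False
        then have "(Im z)\<^sup>2 = r\<^sup>2" using cases by auto
        moreover have "(Re z)\<^sup>2 \<le> 1" using zS by (simp add: power_le_one)
        ultimately have "\<epsilon> * ((Re z)\<^sup>2 - (Im z)\<^sup>2 - 1) \<le> - \<epsilon> * r\<^sup>2"
          using \<epsilon> mult_left_mono[of "(Re z)\<^sup>2 - r\<^sup>2 - 1" "- r\<^sup>2" \<epsilon>] by simp
        then have "cmod (g z) \<le> B * exp (- \<epsilon> * r\<^sup>2)"
          unfolding normg using zS B0 by (intro mult_mono B) auto
        then show ?thesis using r T0 by simp
      qed
    qed auto
    then show ?thesis by (simp add: normg)
  qed
  have lim: "((\<lambda>\<epsilon>. cmod (F (of_real x)) * exp (\<epsilon> * (x\<^sup>2 - 1))) \<longlongrightarrow> cmod (F (of_real x)) * exp (0 * (x\<^sup>2 - 1))) (at_right 0)"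
    by (intro tendsto_intros)
  have lim2: "((\<lambda>\<epsilon>. T + \<epsilon>) \<longlongrightarrow> T + 0) (at_right 0)"
    by (intro tendsto_intros)
  have "cmod (F (of_real x)) * exp (0 * (x\<^sup>2 - 1)) \<le> T + 0"
    using main eventually_at_right_less[of "0::real"]
    by (intro tendsto_le[OF _ lim2 lim]) (auto elim: eventually_mono)
  then show ?thesis by simp
qed

subsection \<open>Positive functionals and positive bilinear forms\<close>

definition linear_fun :: "nat \<Rightarrow> (complex mat \<Rightarrow> complex) \<Rightarrow> bool" where
  "linear_fun n \<omega> \<longleftrightarrow>
     (\<forall>X \<in> carrier_mat n n. \<forall>Y \<in> carrier_mat n n. \<omega> (X + Y) = \<omega> X + \<omega> Y) \<and>
     (\<forall>c. \<forall>X \<in> carrier_mat n n. \<omega> (c \<cdot>\<^sub>m X) = c * \<omega> X)"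

lemma linear_fun_sum:
  assumes \<omega>: "linear_fun n \<omega>" and "finite S" "\<And>k. k \<in> S \<Longrightarrow> M k \<in> carrier_mat n n"
  shows "\<omega> (mat n n (\<lambda>ij. \<Sum>k\<in>S. c k * M k $$ ij)) = (\<Sum>k\<in>S. c k * \<omega> (M k))"
  using assms(2,3)
proof (induction S rule: finite_induct)
  case empty
  have "\<omega> (mat n n (\<lambda>ij. 0)) = \<omega> (0 \<cdot>\<^sub>m 0\<^sub>m n n)"
    by (rule arg_cong[where f=\<omega>], rule eq_matI) auto
  also have "\<dots> = 0" using \<omega> unfolding linear_fun_def by (metis mult_zero_left zero_carrier_mat)
  finally show ?case by simp
next
  case (insert x S)
  have "\<omega> (mat n n (\<lambda>ij. \<Sum>k\<in>insert x S. c k * M k $$ ij))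
      = \<omega> (c x \<cdot>\<^sub>m M x + mat n n (\<lambda>ij. \<Sum>k\<in>S. c k * M k $$ ij))"
  proof (rule arg_cong[where f=\<omega>], rule eq_matI)
  qed (use insert.hyps insert.prems[of x] in auto)
  also have "\<dots> = \<omega> (c x \<cdot>\<^sub>m M x) + \<omega> (mat n n (\<lambda>ij. \<Sum>k\<in>S. c k * M k $$ ij))"
    using \<omega> insert.prems by (auto simp: linear_fun_def)
  also have "\<dots> = (\<Sum>k\<in>insert x S. c k * \<omega> (M k))"
    using \<omega> insert by (auto simp: linear_fun_def)
  finally show ?case .
qed

definition unit_mat :: "nat \<Rightarrow> nat \<times> nat \<Rightarrow> complex mat" where
  "unit_mat n ab = mat n n (\<lambda>ij. if ij = ab then 1 else 0)"

lemma linear_fun_expand: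
  assumes \<omega>: "linear_fun n \<omega>" and X: "X \<in> carrier_mat n n"
  shows "\<omega> X = (\<Sum>ab \<in> {..<n} \<times> {..<n}. X $$ ab * \<omega> (unit_mat n ab))"
proof -
  have "X = mat n n (\<lambda>ij. \<Sum>ab \<in> {..<n} \<times> {..<n}. X $$ ab * unit_mat n ab $$ ij)"
  proof (rule eq_matI)
    fix i j assume "i < dim_row (mat n n (\<lambda>ij. \<Sum>ab \<in> {..<n} \<times> {..<n}. X $$ ab * unit_mat n ab $$ ij))"
      "j < dim_col (mat n n (\<lambda>ij. \<Sum>ab \<in> {..<n} \<times> {..<n}. X $$ ab * unit_mat n ab $$ ij))"
    then have ij: "i < n" "j < n" by auto
    have "(\<Sum>ab \<in> {..<n} \<times> {..<n}. X $$ ab * unit_mat n ab $$ (i,j))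
        = (\<Sum>ab \<in> {..<n} \<times> {..<n}. if ab = (i,j) then X $$ (i,j) else 0)"
      using ij by (intro sum.cong) (auto simp: unit_mat_def)
    then show "X $$ (i,j) = mat n n (\<lambda>ij. \<Sum>ab \<in> {..<n} \<times> {..<n}. X $$ ab * unit_mat n ab $$ ij) $$ (i,j)"
      using ij by simp
  qed (use X in auto)
  then have "\<omega> X = \<omega> (mat n n (\<lambda>ij. \<Sum>ab \<in> {..<n} \<times> {..<n}. X $$ ab * unit_mat n ab $$ ij))"
    by (rule arg_cong)
  then show ?thesis by (simp add: linear_fun_sum[OF \<omega>] unit_mat_def)
qed

definition rank_one :: "nat \<Rightarrow> complex mat \<Rightarrow> nat \<Rightarrow> complex mat" where
  "rank_one n W j = W * cdiag n (\<lambda>m. if m = j then 1 else 0) * adj W"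

lemma psd_rank_one: assumes "W \<in> carrier_mat n n" shows "psd n (rank_one n W j)"
proof -
  have "cdiag n (\<lambda>m. if m = j then 1 else 0) = rdiag n (\<lambda>m. if m = j then 1 else 0)"
    unfolding rdiag_cdiag by (rule cdiag_cong) simp
  then show ?thesis
    using psd_congruence[OF adj_carrier[OF assms] psd_rdiag[of n "\<lambda>m. if m = j then 1 else 0"]]
    by (simp add: rank_one_def)
qed

text \<open>On matrices diagonal in a common basis a functional is a linear expression in the
  eigenvalues, with coefficients independent of them; for a positive functional the coefficients are
  nonnegative. Matrix inequalities thus reduce to scalar ones wherever the matrices commute.\<close>

lemma linear_fun_conjugate_cdiag:
  assumes \<omega>: "linear_fun n \<omega>" and W: "W \<in> carrier_mat n n"
  shows "\<omega> (W * cdiag n u * adj W) = (\<Sum>j<n. u j * \<omega> (rank_one n W j))"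
proof -
  have "W * cdiag n u * adj W = mat n n (\<lambda>ij. \<Sum>m<n. u m * rank_one n W m $$ ij)"
  proof (rule eq_matI)
    fix a b assume "a < dim_row (mat n n (\<lambda>ij. \<Sum>m<n. u m * rank_one n W m $$ ij))"
      "b < dim_col (mat n n (\<lambda>ij. \<Sum>m<n. u m * rank_one n W m $$ ij))"
    then have ab: "a < n" "b < n" by auto
    have "rank_one n W m $$ (a,b) = W $$ (a,m) * cnj (W $$ (b,m))" if "m < n" for m
      using that unfolding rank_one_def index_conjugate_cdiag[OF W ab]
      by (simp add: if_distrib[of "\<lambda>x. x * _"] cong: if_cong)
    then show "(W * cdiag n u * adj W) $$ (a,b) = mat n n (\<lambda>ij. \<Sum>m<n. u m * rank_one n W m $$ ij) $$ (a,b)"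
      using ab by (simp add: index_conjugate_cdiag[OF W ab] del: index_mult_mat(1))
  qed (use W in auto)
  then show ?thesis
    using linear_fun_sum[OF \<omega>, of "{..<n}" "rank_one n W" u] psd_carrier[OF psd_rank_one[OF W]] by simp
qed

definition positive_fun :: "nat \<Rightarrow> (complex mat \<Rightarrow> complex) \<Rightarrow> bool" where
  "positive_fun n \<omega> \<longleftrightarrow> linear_fun n \<omega> \<and> (\<forall>P. psd n P \<longrightarrow> Im (\<omega> P) = 0 \<and> 0 \<le> Re (\<omega> P))"

lemma positive_fun_hermitian:
  assumes "positive_fun n \<omega>" "hermitian n H" shows "Im (\<omega> H) = 0"
proof -
  obtain W d where dec: "udec n W d H" using hermitian_udec[OF assms(2)] by auto
  note W = unitary_carrier[OF udec_unitary[OF dec]]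
  show ?thesis
    using dec linear_fun_conjugate_cdiag[OF _ W, of \<omega> "\<lambda>i. of_real (d i)"] assms(1) psd_rank_one[OF W]
    by (auto simp: udec_def rdiag_cdiag positive_fun_def)
qed

text \<open>Both \<open>Y + adj Y\<close> and \<open>\<i>\<close> times \<open>Y - adj Y\<close> are
  Hermitian, so their values are real; this relates the imaginary and the real parts.\<close>

lemma positive_fun_adj:
  assumes \<omega>: "positive_fun n \<omega>" and Y: "Y \<in> carrier_mat n n"
  shows "\<omega> (adj Y) = cnj (\<omega> Y)"
proof -
  note Y' = adj_carrier[OF Y]
  have lin: "\<omega> (A + B) = \<omega> A + \<omega> B" "\<omega> (c \<cdot>\<^sub>m A) = c * \<omega> A"
    if "A \<in> carrier_mat n n" "B \<in> carrier_mat n n" for A B c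
    using \<omega> that by (auto simp: positive_fun_def linear_fun_def)
  have "hermitian n (Y + adj Y)"
    using Y Y' by (auto simp: hermitian_def adj_add[of _ n n] comm_add_mat[of _ n n])
  from positive_fun_hermitian[OF \<omega> this] have 1: "Im (\<omega> Y) + Im (\<omega> (adj Y)) = 0"
    using Y Y' by (simp add: lin)
  have "hermitian n (\<i> \<cdot>\<^sub>m Y + (-\<i>) \<cdot>\<^sub>m adj Y)"
    using Y Y' by (auto simp: hermitian_def adj_add[of _ n n] adj_smult comm_add_mat[of _ n n])
  from positive_fun_hermitian[OF \<omega> this] have 2: "Re (\<omega> Y) - Re (\<omega> (adj Y)) = 0"
    using Y Y' by (simp add: lin)
  show ?thesis using 1 2 by (simp add: complex_eq_iff)
qed

text \<open>Positivity at \<open>adj T * T\<close> with \<open>T = V * S' - cnj c * S\<close>, where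
  the phase \<open>c\<close> turns the value to be estimated into its modulus and \<open>V\<close>
  drops out of the square terms. The arithmetic mean is kept on the right because it is linear in
  \<omega>, so that such bounds can be added up.\<close>

lemma positive_fun_cauchy_schwarz:
  assumes \<omega>: "positive_fun n \<omega>" and V: "unitary n V"
    and S: "S \<in> carrier_mat n n" and S': "S' \<in> carrier_mat n n"
  shows "cmod (\<omega> (adj S * V * S')) \<le> (Re (\<omega> (adj S * S)) + Re (\<omega> (adj S' * S'))) / 2"
proof -
  note Vc = unitary_carrier[OF V]
  note [simp] = S S' Vc adj_carrier[OF S] adj_carrier[OF S'] adj_carrier[OF Vc]
  note sq = mult_carrier_mat[of _ n n _ n]
  have lin: "\<omega> (A + B) = \<omega> A + \<omega> B" "\<omega> (c \<cdot>\<^sub>m A) = c * \<omega> A"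
    if "A \<in> carrier_mat n n" "B \<in> carrier_mat n n" for A B c
    using \<omega> that by (auto simp: positive_fun_def linear_fun_def)
  define Y where "Y = adj S * V * S'"
  have Y: "Y \<in> carrier_mat n n" by (simp add: Y_def sq)
  have adjY: "adj Y = adj S' * (adj V * S)"
    by (simp add: Y_def adj_mult[of _ n n _ n] sq)
  obtain c where c: "cmod c = 1" "c * \<omega> Y = of_real (cmod (\<omega> Y))"
  proof (cases "\<omega> Y = 0")
    case True then show ?thesis using that[of 1] by simp
  next
    case False
    show ?thesis
    proof (rule that[of "cnj (\<omega> Y) / of_real (cmod (\<omega> Y))"])
      show "cmod (cnj (\<omega> Y) / complex_of_real (cmod (\<omega> Y))) = 1"
        using False by (simp add: norm_divide)
      show "cnj (\<omega> Y) / complex_of_real (cmod (\<omega> Y)) * \<omega> Y = complex_of_real (cmod (\<omega> Y))"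
        using False complex_norm_square[of "\<omega> Y"]
        by (simp add: field_simps power2_eq_square)
    qed
  qed
  have cc: "cnj c * c = 1" using c(1) complex_norm_square[of c] by (simp add: mult.commute)
  define T where "T = V * S' + (- cnj c) \<cdot>\<^sub>m S"
  have T: "T \<in> carrier_mat n n" by (simp add: T_def sq)
  have "adj T = adj S' * adj V + (- c) \<cdot>\<^sub>m adj S"
    by (simp add: T_def adj_add[of _ n n] sq adj_smult adj_mult[of _ n n _ n])
  then have "adj T * T = (adj S' * adj V + (- c) \<cdot>\<^sub>m adj S) * (V * S') +
      (adj S' * adj V + (- c) \<cdot>\<^sub>m adj S) * ((- cnj c) \<cdot>\<^sub>m S)"
    unfolding T_def by (simp add: mult_add_distrib_mat[of _ n n _ n] sq)
  also have "(adj S' * adj V + (- c) \<cdot>\<^sub>m adj S) * (V * S') = adj S' * S' + (- c) \<cdot>\<^sub>m Y"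
    using V by (simp add: add_mult_distrib_mat[of _ n n _ _ n] sq mult_assoc_sq[of _ n] Y_def
        mult_cancel_inverse[of _ n _ _ n] unitary_def mult_smult_assoc_mat[of _ n n _ n])
  also have "(adj S' * adj V + (- c) \<cdot>\<^sub>m adj S) * ((- cnj c) \<cdot>\<^sub>m S) = (- cnj c) \<cdot>\<^sub>m adj Y + adj S * S"
  proof -
    have "(adj S' * adj V + (- c) \<cdot>\<^sub>m adj S) * ((- cnj c) \<cdot>\<^sub>m S)
        = (- cnj c) \<cdot>\<^sub>m (adj Y) + (- cnj c) \<cdot>\<^sub>m ((- c) \<cdot>\<^sub>m (adj S * S))"
      unfolding adjY by (simp add: add_mult_distrib_mat[of _ n n _ _ n] sq mult_assoc_sq[of _ n]
        mult_smult_assoc_mat[of _ n n _ n] mult_smult_distrib[of _ n n _ n] add_smult_distrib_left_mat[of _ n n])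
    also have "(- cnj c) \<cdot>\<^sub>m ((- c) \<cdot>\<^sub>m (adj S * S)) = adj S * S"
      using cc by (intro eq_matI) (auto simp: mult.assoc[symmetric] simp del: index_mult_mat(1))
    finally show ?thesis .
  qed
  finally have eq: "adj T * T = (adj S' * S' + (- c) \<cdot>\<^sub>m Y) + ((- cnj c) \<cdot>\<^sub>m adj Y + adj S * S)" .
  have "0 \<le> Re (\<omega> (adj T * T))" using \<omega> psd_gram[OF T] by (simp add: positive_fun_def)
  also have "\<omega> (adj T * T) = \<omega> (adj S' * S') - c * \<omega> Y - cnj c * cnj (\<omega> Y) + \<omega> (adj S * S)"
    unfolding eq using Y adj_carrier[OF Y] by (simp add: lin sq positive_fun_adj[OF \<omega>])
  also have "cnj c * cnj (\<omega> Y) = of_real (cmod (\<omega> Y))"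
    using c(2) by (metis complex_cnj_complex_of_real complex_cnj_mult)
  finally have "0 \<le> Re (\<omega> (adj S' * S')) - cmod (\<omega> Y) - cmod (\<omega> Y) + Re (\<omega> (adj S * S))"
    by (simp add: c(2))
  then show ?thesis by (simp add: Y_def)
qed

text \<open>A positive map becomes such a form through the trace pairing. The form treats its two
  arguments alike, so the estimate on one boundary line of the strip gives the other one by a
  swap.\<close>

definition positive_bilinear :: "nat \<Rightarrow> nat \<Rightarrow> (complex mat \<Rightarrow> complex mat \<Rightarrow> complex) \<Rightarrow> bool" where
  "positive_bilinear n l \<beta> \<longleftrightarrow>
     (\<forall>R \<in> carrier_mat l l. linear_fun n (\<lambda>X. \<beta> X R)) \<and>
     (\<forall>X \<in> carrier_mat n n. linear_fun l (\<beta> X)) \<and>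
     (\<forall>P Q. psd n P \<longrightarrow> psd l Q \<longrightarrow> Im (\<beta> P Q) = 0 \<and> 0 \<le> Re (\<beta> P Q))"

lemma positive_bilinear_swap: "positive_bilinear n l \<beta> \<Longrightarrow> positive_bilinear l n (\<lambda>R X. \<beta> X R)"
  by (auto simp: positive_bilinear_def)

lemma positive_bilinear_positive_fun:
  "positive_bilinear n l \<beta> \<Longrightarrow> psd n P \<Longrightarrow> positive_fun l (\<beta> P)"
  by (auto simp: positive_bilinear_def positive_fun_def psd_carrier)

lemma linear_fun_congruence:
  assumes \<omega>: "linear_fun n \<omega>" and K: "K \<in> carrier_mat n n"
  shows "linear_fun n (\<lambda>X. \<omega> (adj K * X * K))"
  using \<omega> K adj_carrier[OF K] unfolding linear_fun_def
  by (auto simp: mult_add_distrib_mat[of _ n n _ n] add_mult_distrib_mat[of _ n n _ _ n]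
    mult_smult_distrib[of _ n n _ n] mult_smult_assoc_mat[of _ n n _ n] mult_carrier_mat[of _ n n _ n])

text \<open>A positive map need not be completely positive, but a unitary generates a commutative
  algebra, so that the Schwarz-type bound still holds (the idea of the Russo--Dye theorem).\<close>

lemma positive_bilinear_unitary_bound:
  assumes \<beta>: "positive_bilinear n l \<beta>" and U: "unitary n U" and V: "unitary l V"
    and K: "K \<in> carrier_mat n n" and S: "S \<in> carrier_mat l l" and S': "S' \<in> carrier_mat l l"
  shows "cmod (\<beta> (adj K * U * K) (adj S * V * S'))
    \<le> (Re (\<beta> (adj K * K) (adj S * S)) + Re (\<beta> (adj K * K) (adj S' * S'))) / 2"
proof -
  note Uc = unitary_carrier[OF U]
  obtain W u where W: "unitary n W" and Wu: "U = W * cdiag n u * adj W"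
    using spectral_normal[OF Uc] U by (auto simp: unitary_def)
  note Wc = unitary_carrier[OF W]
  have "W * cdiag n (\<lambda>i. cnj (u i) * u i) * adj W = adj U * U"
    unfolding Wu by (simp add: adj_conjugate[OF Wc] adj_cdiag conjugate_mult[OF W] cdiag_mult)
  also have "\<dots> = 1\<^sub>m n" using U by (simp add: unitary_def)
  finally have "cdiag n (\<lambda>i. cnj (u i) * u i) = adj W * 1\<^sub>m n * W"
    using adj_conjugate_unitary[OF W cdiag_carrier] by metis
  also have "\<dots> = 1\<^sub>m n" using W right_mult_one_mat[OF adj_carrier[OF Wc]] by (simp add: unitary_def)
  finally have cd: "cdiag n (\<lambda>i. cnj (u i) * u i) = 1\<^sub>m n" .
  have u: "cmod (u i) = 1" if "i < n" for i
  proof -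
    have "cnj (u i) * u i = 1" using cd cdiag_index[OF that that, of "\<lambda>i. cnj (u i) * u i"] that by simp
    then have "complex_of_real ((cmod (u i))\<^sup>2) = 1" by (simp only: complex_norm_square mult.commute)
    then have "(cmod (u i))\<^sup>2 = 1" using of_real_eq_1_iff by blast
    then show ?thesis by (simp add: power2_eq_1_iff) (use norm_ge_zero[of "u i"] in linarith)
  qed
  define Q where "Q j = adj K * rank_one n W j * K" for j
  have Q: "psd n (Q j)" for j
    unfolding Q_def by (intro psd_congruence[OF K] psd_rank_one Wc)
  have lin: "linear_fun n (\<lambda>X. \<beta> (adj K * X * K) R)" if "R \<in> carrier_mat l l" for R
    using linear_fun_congruence[OF _ K, of "\<lambda>X. \<beta> X R"] \<beta> that by (auto simp: positive_bilinear_def)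
  have expand: "\<beta> (adj K * U * K) R = (\<Sum>j<n. u j * \<beta> (Q j) R)" if "R \<in> carrier_mat l l" for R
    using linear_fun_conjugate_cdiag[OF lin[OF that] Wc, of u] by (simp add: Wu Q_def)
  have one: "W * cdiag n (\<lambda>_. 1) * adj W = 1\<^sub>m n"
    using W Wc by (simp add: cdiag_one unitary_def)
  have expand1: "\<beta> (adj K * K) R = (\<Sum>j<n. \<beta> (Q j) R)" if "R \<in> carrier_mat l l" for R
    using linear_fun_conjugate_cdiag[OF lin[OF that] Wc, of "\<lambda>_. 1"] K adj_carrier[OF K]
    by (simp add: one Q_def)
  have car: "adj S * V * S' \<in> carrier_mat l l" "adj S * S \<in> carrier_mat l l" "adj S' * S' \<in> carrier_mat l l"
    using S S' adj_carrier[OF S] adj_carrier[OF S'] unitary_carrier[OF V] by (auto intro: mult_carrier_mat)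
  \<comment> \<open>The eigenvalues \<open>u j\<close> have modulus one and drop out. What remains
    is a sum of Cauchy-Schwarz bounds for the positive functionals \<open>\<beta> (Q j)\<close>, and
    the \<open>Q j\<close> add up to \<open>adj K * K\<close>.\<close>
  have "cmod (\<beta> (adj K * U * K) (adj S * V * S')) \<le> (\<Sum>j<n. cmod (u j * \<beta> (Q j) (adj S * V * S')))"
    unfolding expand[OF car(1)] by (rule norm_sum)
  also have "\<dots> \<le> (\<Sum>j<n. (Re (\<beta> (Q j) (adj S * S)) + Re (\<beta> (Q j) (adj S' * S'))) / 2)"
    using positive_fun_cauchy_schwarz[OF positive_bilinear_positive_fun[OF \<beta> Q] V S S']
    by (intro sum_mono) (simp add: norm_mult u)
  also have "\<dots> = (Re (\<beta> (adj K * K) (adj S * S)) + Re (\<beta> (adj K * K) (adj S' * S'))) / 2"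
    unfolding expand1[OF car(2)] expand1[OF car(3)]
    by (simp add: sum.distrib flip: sum_divide_distrib)
  finally show ?thesis .
qed

subsection \<open>Lieb's concavity theorem for positive bilinear forms\<close>

definition mat_strip_bounded :: "nat \<Rightarrow> nat \<Rightarrow> (complex \<Rightarrow> complex mat) \<Rightarrow> bool" where
  "mat_strip_bounded a b M \<longleftrightarrow>
    (\<forall>z. M z \<in> carrier_mat a b) \<and> (\<forall>i<a. \<forall>j<b. strip_bounded (\<lambda>z. M z $$ (i,j)))"

lemma mat_strip_bounded_mult:
  assumes "mat_strip_bounded a b M" "mat_strip_bounded b c N"
  shows "mat_strip_bounded a c (\<lambda>z. M z * N z)"
  unfolding mat_strip_bounded_def
proof (intro conjI allI impI)
  have M: "M z \<in> carrier_mat a b" and N: "N z \<in> carrier_mat b c" for z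
    using assms by (simp_all add: mat_strip_bounded_def)
  show "M z * N z \<in> carrier_mat a c" for z by (rule mult_carrier_mat[OF M N])
  fix i j assume ij: "i < a" "j < c"
  show "strip_bounded (\<lambda>z. (M z * N z) $$ (i,j))"
    unfolding index_mult_sum[OF M N ij] using assms ij
    by (intro strip_bounded_sum strip_bounded_mult) (simp_all add: mat_strip_bounded_def)
qed

lemma mat_strip_bounded_cpow:
  assumes "pd k A"
  shows "mat_strip_bounded k k (\<lambda>z. cpow k A (of_real c * z + of_real d))"
proof -
  obtain U e where dec: "udec k U e A"
    and cp: "\<And>z. cpow k A z = U * cdiag k (\<lambda>i. exp (z * of_real (ln (e i)))) * adj U"
    using cpow_udec[OF assms] by metis
  note U = unitary_carrier[OF udec_unitary[OF dec]]
  show ?thesis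
    unfolding mat_strip_bounded_def
  proof (intro conjI allI impI)
    fix i j assume ij: "i < k" "j < k"
    show "strip_bounded (\<lambda>z. cpow k A (of_real c * z + of_real d) $$ (i,j))"
      unfolding cp index_conjugate_cdiag[OF U ij] by (intro strip_bounded_sum strip_bounded_mult) auto
  qed (simp add: assms)
qed

lemma strip_bounded_bilinear:
  assumes \<beta>: "positive_bilinear n l \<beta>" and M: "mat_strip_bounded n n M" and N: "mat_strip_bounded l l N"
  shows "strip_bounded (\<lambda>z. \<beta> (M z) (N z))"
proof -
  have "\<beta> (M z) (N z) = (\<Sum>ab \<in> {..<n} \<times> {..<n}. M z $$ ab *
      (\<Sum>cd \<in> {..<l} \<times> {..<l}. N z $$ cd * \<beta> (unit_mat n ab) (unit_mat l cd)))" for z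
  proof -
    have Mz: "M z \<in> carrier_mat n n" and Nz: "N z \<in> carrier_mat l l"
      using M N by (auto simp: mat_strip_bounded_def)
    have "\<beta> (M z) (N z) = (\<Sum>ab \<in> {..<n} \<times> {..<n}. M z $$ ab * \<beta> (unit_mat n ab) (N z))"
      using linear_fun_expand[OF _ Mz, of "\<lambda>X. \<beta> X (N z)"] \<beta> Nz by (auto simp: positive_bilinear_def)
    also have "\<dots> = (\<Sum>ab \<in> {..<n} \<times> {..<n}. M z $$ ab *
      (\<Sum>cd \<in> {..<l} \<times> {..<l}. N z $$ cd * \<beta> (unit_mat n ab) (unit_mat l cd)))"
    proof (intro sum.cong refl arg_cong2[where f="(*)"])
      fix ab
      show "\<beta> (unit_mat n ab) (N z) = (\<Sum>cd \<in> {..<l} \<times> {..<l}. N z $$ cd * \<beta> (unit_mat n ab) (unit_mat l cd))"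
        using \<beta> by (intro linear_fun_expand[OF _ Nz]) (auto simp: positive_bilinear_def unit_mat_def)
    qed
    finally show ?thesis .
  qed
  moreover have "strip_bounded (\<lambda>z. M z $$ ab)" if "ab \<in> {..<n} \<times> {..<n}" for ab
    using M that by (auto simp: mat_strip_bounded_def)
  moreover have "strip_bounded (\<lambda>z. N z $$ ab)" if "ab \<in> {..<l} \<times> {..<l}" for ab
    using N that by (auto simp: mat_strip_bounded_def)
  ultimately show ?thesis by (simp only:) (intro strip_bounded_sum strip_bounded_mult strip_bounded_const; blast)
qed

text \<open>The interpolating function: at \<^term>\<open>z = of_real p\<close> its value is the form at the
  powers of \<open>A\<close> and \<open>Z\<close>, while on the boundary of the strip one argument is a congruence
  of a unitary matrix.\<close>

definition lieb_fun :: "nat \<Rightarrow> nat \<Rightarrow> (complex mat \<Rightarrow> complex mat \<Rightarrow> complex) \<Rightarrow> real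
    \<Rightarrow> complex mat \<Rightarrow> complex mat \<Rightarrow> complex mat \<Rightarrow> complex mat \<Rightarrow> complex \<Rightarrow> complex" where
  "lieb_fun n l \<beta> p C D A Z z =
    \<beta> (cpow n C ((of_real p - z) / 2) * cpow n A z * cpow n C ((of_real p - z) / 2))
      (cpow l D ((z - of_real p) / 2) * cpow l Z (1 - z) * cpow l D ((z - of_real p) / 2))"

lemma strip_bounded_lieb_fun:
  assumes "positive_bilinear n l \<beta>" "pd n C" "pd l D" "pd n A" "pd l Z"
  shows "strip_bounded (lieb_fun n l \<beta> p C D A Z)"
proof -
  have eqs: "(of_real p - z) / 2 = of_real (- 1/2) * z + of_real (p/2)"
    "(z - of_real p) / 2 = of_real (1/2) * z + of_real (- p/2)"
    "1 - z = of_real (-1) * z + of_real 1" for z :: complex by simp_all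
  have A: "mat_strip_bounded n n (\<lambda>z. cpow n A z)"
    using mat_strip_bounded_cpow[OF assms(4), of 1 0] by simp
  have "strip_bounded (\<lambda>z. lieb_fun n l \<beta> p C D A Z z)"
    unfolding lieb_fun_def eqs
    by (intro strip_bounded_bilinear[OF assms(1)] assms A mat_strip_bounded_cpow
      mat_strip_bounded_mult[of n n _ n] mat_strip_bounded_mult[of l l _ l])
  then show ?thesis by simp
qed

text \<open>On the imaginary axis all imaginary powers are unitary: the first argument is a
  congruence of a unitary by \<open>K\<close>, and the middle factor of the second is split as
  \<open>Z^(1/2) * V * Z^(1/2)\<close>. Taking adjoints flips the sign of \<open>y\<close>, which is
  why \<open>S\<close> and \<open>S'\<close> differ by that sign and two different terms appear on
  the right.\<close>

lemma lieb_fun_term_bound: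
  assumes \<beta>: "positive_bilinear n l \<beta>" and C: "pd n C" and D: "pd l D" and A: "pd n A" and Z: "pd l Z"
  shows "cmod (lieb_fun n l \<beta> p C D A Z (\<i> * of_real y)) \<le>
    (Re (\<beta> (cpow n C (of_real p)) (cpow l D ((\<i> * of_real y - of_real p) / 2) * Z * cpow l D ((- \<i> * of_real y - of_real p) / 2)))
   + Re (\<beta> (cpow n C (of_real p)) (cpow l D ((- \<i> * of_real y - of_real p) / 2) * Z * cpow l D ((\<i> * of_real y - of_real p) / 2)))) / 2"
proof -
  note sqn = mult_carrier_mat[of _ n n _ n] mult_assoc_sq[of _ n] cpow_mult cpow_mult_assoc[of n _ _ n]
  note sql = mult_carrier_mat[of _ l l _ l] mult_assoc_sq[of _ l] cpow_mult cpow_mult_assoc[of l _ _ l]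
  note [simp] = C D A Z
  define K where "K = cpow n C (of_real p / 2)"
  define U where "U = cpow n C (- \<i> * of_real y / 2) * cpow n A (\<i> * of_real y) * cpow n C (- \<i> * of_real y / 2)"
  define V where "V = cpow l Z (- \<i> * of_real y)"
  define S where "S = cpow l Z (1/2) * cpow l D ((- \<i> * of_real y - of_real p) / 2)"
  define S' where "S' = cpow l Z (1/2) * cpow l D ((\<i> * of_real y - of_real p) / 2)"
  have K: "K \<in> carrier_mat n n" "adj K = K" by (simp_all add: K_def adj_cpow)
  have S: "S \<in> carrier_mat l l" "adj S = cpow l D ((\<i> * of_real y - of_real p) / 2) * cpow l Z (1/2)"
    by (simp_all add: S_def sql adj_cpow adj_mult[of _ l l _ l])
  have S': "S' \<in> carrier_mat l l" "adj S' = cpow l D ((- \<i> * of_real y - of_real p) / 2) * cpow l Z (1/2)"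
    by (simp_all add: S'_def sql adj_cpow adj_mult[of _ l l _ l])
  have "unitary n (cpow n C (\<i> * of_real (- y / 2)))" "unitary n (cpow n A (\<i> * of_real y))"
    by (simp_all only: unitary_cpow C A)
  then have U: "unitary n U" unfolding U_def by (intro unitary_mult) simp_all
  have V: "unitary l V" unfolding V_def using unitary_cpow[OF Z, of "- y"] by simp
  have "adj K * K = cpow n C (of_real p)" unfolding K(2) unfolding K_def by (simp add: cpow_mult)
  moreover have "adj S * S = cpow l D ((\<i> * of_real y - of_real p) / 2) * Z * cpow l D ((- \<i> * of_real y - of_real p) / 2)"
    unfolding S(2) unfolding S_def by (simp add: sql pd_carrier[OF Z] cpow_1)
  moreover have "adj S' * S' = cpow l D ((- \<i> * of_real y - of_real p) / 2) * Z * cpow l D ((\<i> * of_real y - of_real p) / 2)"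
    unfolding S'(2) unfolding S'_def by (simp add: sql pd_carrier[OF Z] cpow_1)
  moreover have "adj K * U * K = cpow n C ((of_real p - \<i> * of_real y) / 2) * cpow n A (\<i> * of_real y)
      * cpow n C ((of_real p - \<i> * of_real y) / 2)"
    unfolding K(2) unfolding K_def U_def by (simp add: sqn diff_divide_distrib)
  moreover have "adj S * V * S' = cpow l D ((\<i> * of_real y - of_real p) / 2) * cpow l Z (1 - \<i> * of_real y)
      * cpow l D ((\<i> * of_real y - of_real p) / 2)"
    unfolding S(2) unfolding S'_def V_def by (simp add: sql)
  ultimately show ?thesis
    using positive_bilinear_unitary_bound[OF \<beta> U V K(1) S(1) S'(1)]
    unfolding lieb_fun_def by simp
qed

text \<open>The term bounds are linear in \<open>Z\<close>, so their convex combination puts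
  \<open>D\<close> in the place of \<open>Z1\<close> and \<open>Z2\<close>. Since \<open>D\<close>
  commutes with its own powers, the imaginary exponents on its two sides cancel and leave
  \<open>D^(1 - p)\<close>, a bound independent of \<open>y\<close>.\<close>

lemma lieb_fun_boundary:
  assumes \<beta>: "positive_bilinear n l \<beta>"
    and A: "pd n A1" "pd n A2" "pd n C" and Z: "pd l Z1" "pd l Z2" and t: "0 \<le> t" "t \<le> 1"
    and D: "D = complex_of_real t \<cdot>\<^sub>m Z1 + complex_of_real (1 - t) \<cdot>\<^sub>m Z2"
  shows "cmod (of_real t * lieb_fun n l \<beta> p C D A1 Z1 (\<i> * of_real y)
      + of_real (1 - t) * lieb_fun n l \<beta> p C D A2 Z2 (\<i> * of_real y))
    \<le> Re (\<beta> (cpow n C (of_real p)) (cpow l D (of_real (1 - p))))"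
proof -
  have pdD: "pd l D" unfolding D by (intro pd_convex Z t)
  note [simp] = pdD A Z pd_carrier[OF Z(1)] pd_carrier[OF Z(2)]
  let ?P = "cpow n C (of_real p)"
  let ?E = "cpow l D ((\<i> * of_real y - of_real p) / 2)"
  let ?E' = "cpow l D ((- \<i> * of_real y - of_real p) / 2)"
  have "linear_fun l (\<beta> ?P)" using \<beta> A by (simp add: positive_bilinear_def)
  then have lin: "\<And>X Y. X \<in> carrier_mat l l \<Longrightarrow> Y \<in> carrier_mat l l \<Longrightarrow> \<beta> ?P (X + Y) = \<beta> ?P X + \<beta> ?P Y"
    "\<And>c X. X \<in> carrier_mat l l \<Longrightarrow> \<beta> ?P (c \<cdot>\<^sub>m X) = c * \<beta> ?P X"
    by (auto simp: linear_fun_def)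
  have comb: "of_real t * \<beta> ?P (cpow l D a * Z1 * cpow l D b) + of_real (1 - t) * \<beta> ?P (cpow l D a * Z2 * cpow l D b)
      = \<beta> ?P (cpow l D (of_real (1 - p)))" if "a + 1 + b = of_real (1 - p)" for a b
  proof -
    have "cpow l D (of_real (1 - p)) = cpow l D a * D * cpow l D b"
      using cpow_1[OF pdD] that cpow_mult[OF pdD] by metis
    also have "\<dots> = cpow l D a * (of_real t \<cdot>\<^sub>m Z1 + of_real (1 - t) \<cdot>\<^sub>m Z2) * cpow l D b"
      by (simp only: D[symmetric])
    also have "\<dots> = of_real t \<cdot>\<^sub>m (cpow l D a * Z1 * cpow l D b) + of_real (1 - t) \<cdot>\<^sub>m (cpow l D a * Z2 * cpow l D b)"
      by (simp add: mult_add_distrib_mat[of _ l l _ l] add_mult_distrib_mat[of _ l l _ _ l]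
        mult_smult_distrib[of _ l l _ l] mult_smult_assoc_mat[of _ l l _ l] mult_carrier_mat[of _ l l _ l])
    finally show ?thesis by (simp add: lin mult_carrier_mat[of _ l l _ l])
  qed
  let ?R1 = "\<beta> ?P (?E * Z1 * ?E')" and ?R1' = "\<beta> ?P (?E' * Z1 * ?E)"
  let ?R2 = "\<beta> ?P (?E * Z2 * ?E')" and ?R2' = "\<beta> ?P (?E' * Z2 * ?E)"
  have "cmod (of_real t * lieb_fun n l \<beta> p C D A1 Z1 (\<i> * of_real y)
      + of_real (1 - t) * lieb_fun n l \<beta> p C D A2 Z2 (\<i> * of_real y))
    \<le> t * cmod (lieb_fun n l \<beta> p C D A1 Z1 (\<i> * of_real y)) + (1 - t) * cmod (lieb_fun n l \<beta> p C D A2 Z2 (\<i> * of_real y))"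
    using t by (intro norm_triangle_le) (simp add: norm_mult del: of_real_diff)
  also have "\<dots> \<le> t * ((Re ?R1 + Re ?R1') / 2) + (1 - t) * ((Re ?R2 + Re ?R2') / 2)"
    using t by (intro add_mono mult_left_mono lieb_fun_term_bound[OF \<beta>]) auto
  also have "\<dots> = (Re (of_real t * ?R1 + of_real (1 - t) * ?R2) + Re (of_real t * ?R1' + of_real (1 - t) * ?R2')) / 2"
    by (simp add: algebra_simps add_divide_distrib diff_divide_distrib)
  also have "\<dots> = Re (\<beta> ?P (cpow l D (of_real (1 - p))))"
    by (subst (1 2) comb) (simp_all add: field_simps)
  finally show ?thesis .
qed

text \<open>The reflection of the strip exchanges the two arguments of the form, which carries the
  line of real part one to the imaginary axis.\<close>

lemma lieb_fun_swap:
  "lieb_fun n l \<beta> p C D A Z (1 - z) = lieb_fun l n (\<lambda>R X. \<beta> X R) (1 - p) D C Z A z"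
  by (simp add: lieb_fun_def algebra_simps)

text \<open>At \<open>z = p\<close> the auxiliary powers of \<open>C\<close> and \<open>D\<close>
  have exponent zero, so the interpolating sum equals the left-hand side. On both boundary lines the
  same powers make the right-hand side the common bound.\<close>

theorem lieb_concavity:
  assumes \<beta>: "positive_bilinear n l \<beta>"
    and A: "pd n A1" "pd n A2" and Z: "pd l Z1" "pd l Z2" and t: "0 \<le> t" "t \<le> 1" and p: "0 \<le> p" "p \<le> 1"
    and C: "C = complex_of_real t \<cdot>\<^sub>m A1 + complex_of_real (1 - t) \<cdot>\<^sub>m A2"
    and D: "D = complex_of_real t \<cdot>\<^sub>m Z1 + complex_of_real (1 - t) \<cdot>\<^sub>m Z2"
  shows "t * Re (\<beta> (cpow n A1 (of_real p)) (cpow l Z1 (of_real (1 - p))))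
      + (1 - t) * Re (\<beta> (cpow n A2 (of_real p)) (cpow l Z2 (of_real (1 - p))))
    \<le> Re (\<beta> (cpow n C (of_real p)) (cpow l D (of_real (1 - p))))"
proof -
  have pdC: "pd n C" unfolding C by (intro pd_convex A t)
  have pdD: "pd l D" unfolding D by (intro pd_convex Z t)
  define F where "F z = of_real t * lieb_fun n l \<beta> p C D A1 Z1 z
      + of_real (1 - t) * lieb_fun n l \<beta> p C D A2 Z2 z" for z
  have at_p: "lieb_fun n l \<beta> p C D A Z (of_real p) = \<beta> (cpow n A (of_real p)) (cpow l Z (of_real (1 - p)))"
    if "pd n A" "pd l Z" for A Z
    using left_mult_one_mat[OF cpow_carrier[OF that(1)]] right_mult_one_mat[OF cpow_carrier[OF that(1)]]
      left_mult_one_mat[OF cpow_carrier[OF that(2)]] right_mult_one_mat[OF cpow_carrier[OF that(2)]]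
    by (simp add: lieb_fun_def cpow_0 pdC pdD)
  have "cmod (F (of_real p)) \<le> Re (\<beta> (cpow n C (of_real p)) (cpow l D (of_real (1 - p))))"
  proof (rule three_lines)
    have "strip_bounded (\<lambda>z. F z)" unfolding F_def
      by (intro strip_bounded_add strip_bounded_mult strip_bounded_const strip_bounded_lieb_fun \<beta> A Z pdC pdD)
    then show "strip_bounded F" by simp
    show "cmod (F (\<i> * of_real y)) \<le> Re (\<beta> (cpow n C (of_real p)) (cpow l D (of_real (1 - p))))" for y
      unfolding F_def by (rule lieb_fun_boundary[OF \<beta> A pdC Z t D])
    show "cmod (F (1 + \<i> * of_real y)) \<le> Re (\<beta> (cpow n C (of_real p)) (cpow l D (of_real (1 - p))))" for y
    proof -
      have eq: "1 + \<i> * of_real y = 1 - \<i> * of_real (- y)" by simp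
      show ?thesis
        using lieb_fun_boundary[OF positive_bilinear_swap[OF \<beta>] Z pdD A t C, of "1 - p" "- y"]
        unfolding F_def eq lieb_fun_swap by simp
    qed
  qed (use p in auto)
  then have "Re (F (of_real p)) \<le> Re (\<beta> (cpow n C (of_real p)) (cpow l D (of_real (1 - p))))"
    using complex_Re_le_cmod order_trans by blast
  then show ?thesis by (simp add: F_def at_p A Z del: of_real_diff)
qed

subsection \<open>Simultaneous diagonalization of a pair of forms\<close>

definition mv :: "nat \<Rightarrow> complex mat \<Rightarrow> (nat \<Rightarrow> complex) \<Rightarrow> nat \<Rightarrow> complex" where
  "mv k M y i = (\<Sum>j<k. M $$ (i,j) * y j)"

lemma mv_mult:
  assumes "A \<in> carrier_mat a b" "B \<in> carrier_mat b c" "i < a"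
  shows "mv c (A * B) y i = mv b A (mv c B y) i"
proof -
  have "mv c (A * B) y i = (\<Sum>k<c. (\<Sum>j<b. A $$ (i,j) * B $$ (j,k)) * y k)"
    unfolding mv_def using assms by (intro sum.cong refl, subst index_mult_sum[of _ a b _ c]) auto
  also have "\<dots> = (\<Sum>k<c. \<Sum>j<b. A $$ (i,j) * (B $$ (j,k) * y k))"
    by (simp add: sum_distrib_right mult.assoc)
  also have "\<dots> = mv b A (mv c B y) i"
    unfolding mv_def sum_distrib_left by (rule sum.swap)
  finally show ?thesis .
qed

lemma mv_one: "i < k \<Longrightarrow> mv k (1\<^sub>m k) y i = y i"
proof -
  assume i: "i < k"
  have "mv k (1\<^sub>m k) y i = (\<Sum>j<k. if j = i then y j else 0)"
    unfolding mv_def using i by (intro sum.cong) auto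
  then show ?thesis using i by simp
qed

lemma mv_adj:
  assumes "M \<in> carrier_mat l k"
  shows "(\<Sum>i<l. cnj (mv k M y i) * b i) = (\<Sum>j<k. cnj (y j) * mv l (adj M) b j)"
proof -
  have "(\<Sum>i<l. cnj (mv k M y i) * b i) = (\<Sum>i<l. \<Sum>j<k. cnj (y j) * (cnj (M $$ (i,j)) * b i))"
    unfolding mv_def cnj_sum sum_distrib_right by (intro sum.cong refl) (simp add: algebra_simps)
  also have "\<dots> = (\<Sum>j<k. \<Sum>i<l. cnj (y j) * (cnj (M $$ (i,j)) * b i))"
    by (rule sum.swap)
  also have "\<dots> = (\<Sum>j<k. cnj (y j) * mv l (adj M) b j)"
    unfolding mv_def sum_distrib_left using assms by (intro sum.cong refl) auto
  finally show ?thesis .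
qed

lemma qform_congruence_mv:
  "S \<in> carrier_mat l k \<Longrightarrow> A \<in> carrier_mat l l \<Longrightarrow> qform k (adj S * A * S) v = qform l A (mv k S v)"
  by (simp add: qform_congruence mv_def[abs_def])

lemma qform_gram: "S \<in> carrier_mat l k \<Longrightarrow> qform k (adj S * S) v = of_real (\<Sum>i<l. (cmod (mv k S v i))\<^sup>2)"
  using qform_congruence_mv[of S l k "1\<^sub>m l" v] adj_carrier[of S l k] by (simp add: qform_one)

lemma qform_rdiag: "qform k (rdiag k d) v = of_real (\<Sum>i<k. d i * (cmod (v i))\<^sup>2)"
  by (simp add: rdiag_cdiag qform_cdiag)

lemma cmod_sum_Cauchy_Schwarz:
  "(cmod (\<Sum>i\<in>I. cnj (x i) * y i))\<^sup>2 \<le> (\<Sum>i\<in>I. (cmod (x i))\<^sup>2) * (\<Sum>i\<in>I. (cmod (y i))\<^sup>2)"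
proof -
  have "cmod (\<Sum>i\<in>I. cnj (x i) * y i) \<le> (\<Sum>i\<in>I. cmod (x i) * cmod (y i))"
    using norm_sum[of "\<lambda>i. cnj (x i) * y i" I] by (simp add: norm_mult)
  then have "(cmod (\<Sum>i\<in>I. cnj (x i) * y i))\<^sup>2 \<le> (\<Sum>i\<in>I. cmod (x i) * cmod (y i))\<^sup>2"
    by (rule power_mono) simp
  also have "\<dots> \<le> (\<Sum>i\<in>I. (cmod (x i))\<^sup>2) * (\<Sum>i\<in>I. (cmod (y i))\<^sup>2)"
    by (rule Cauchy_Schwarz_ineq_sum)
  finally show ?thesis .
qed

text \<open>The numbers \<open>d\<close> are the eigenvalues of \<open>X * Y\<close>; the second form is diagonalized in the
  basis dual to the one which diagonalizes the first.\<close>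

definition pair_spec :: "nat \<Rightarrow> complex mat \<Rightarrow> complex mat \<Rightarrow> (nat \<Rightarrow> real) \<Rightarrow> bool" where
  "pair_spec l X Y d \<longleftrightarrow> (\<exists>T T'. T \<in> carrier_mat l l \<and> T' \<in> carrier_mat l l \<and>
      T' * T = 1\<^sub>m l \<and> T * T' = 1\<^sub>m l \<and> adj T * X * T = 1\<^sub>m l \<and> T' * Y * adj T' = rdiag l d)"

lemma pd_half:
  assumes "pd k X"
  shows "pd k (cpow k X (1/2))" "adj (cpow k X (1/2)) = cpow k X (1/2)"
  using pd_cpow[OF assms, of "1/2"] by (simp_all add: adj_cpow[OF assms])

text \<open>The basis \<open>X^(-1/2) * U\<close> turns \<open>X\<close> into the identity; in the
  dual basis \<open>Y\<close> is seen through \<open>X^(1/2) * Y * X^(1/2)\<close>, which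
  \<open>U\<close> diagonalizes.\<close>

lemma pair_spec_eigen:
  assumes X: "pd l X" and Y: "pd l Y"
  assumes dec: "udec l U d (cpow l X (1/2) * Y * cpow l X (1/2))"
  shows "pair_spec l X Y d"
proof -
  note sq = mult_carrier_mat[of _ l l _ l] mult_assoc_sq[of _ l] cpow_mult[OF X] cpow_mult_assoc[OF X, of _ l]
    left_mult_one_mat[of _ l l] right_mult_one_mat[of _ l l]
  note u = udec_unitary[OF dec]
  note [simp] = unitary_carrier[OF u] adj_carrier[OF unitary_carrier[OF u]] X pd_carrier[OF Y] pd_carrier[OF X]
  have uu: "adj U * U = 1\<^sub>m l" "U * adj U = 1\<^sub>m l" using u by (auto simp: unitary_def)
  define T where "T = cpow l X (-1/2) * U"
  define T' where "T' = adj U * cpow l X (1/2)"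
  have T: "T \<in> carrier_mat l l" "T' \<in> carrier_mat l l" by (simp_all add: T_def T'_def sq)
  have aT: "adj T = adj U * cpow l X (-1/2)" "adj T' = cpow l X (1/2) * U"
    by (simp_all add: T_def T'_def adj_mult[of _ l l _ l] adj_cpow)
  have "T' * T = 1\<^sub>m l" unfolding T_def T'_def by (simp add: sq cpow_0 uu)
  moreover have "T * T' = 1\<^sub>m l"
    unfolding T_def T'_def by (simp add: sq mult_cancel_inverse[of _ l _ _ l] uu cpow_0)
  moreover have "adj T * X * T = 1\<^sub>m l"
  proof -
    have "adj T * X * T = adj T * cpow l X 1 * T" by (simp add: cpow_1)
    also have "\<dots> = 1\<^sub>m l" unfolding aT unfolding T_def by (simp add: sq cpow_0 uu)
    finally show ?thesis .
  qed
  moreover have "T' * Y * adj T' = rdiag l d"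
  proof -
    have "T' * Y * adj T' = adj U * (cpow l X (1/2) * Y * cpow l X (1/2)) * U"
      unfolding aT unfolding T'_def by (simp add: sq)
    also have "\<dots> = rdiag l d"
      using dec adj_conjugate_unitary[OF u rdiag_carrier] by (simp add: udec_def)
    finally show ?thesis .
  qed
  ultimately show ?thesis using T by (auto simp: pair_spec_def)
qed

lemma pd_sandwich: assumes "pd l X" "pd l Y" shows "pd l (cpow l X (1/2) * Y * cpow l X (1/2))"
proof -
  have "cpow l X (-1/2) * cpow l X (1/2) = 1\<^sub>m l" by (simp add: cpow_mult assms cpow_0)
  from pd_congruence[OF cpow_carrier[OF assms(1)] cpow_carrier[OF assms(1)] this assms(2)]
  show ?thesis by (simp add: pd_half[OF assms(1)])
qed

lemma pair_spec_exists:
  fixes g :: "real \<Rightarrow> real"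
  assumes X: "pd l X" and Y: "pd l Y"
  obtains U d where "udec l U d (cpow l X (1/2) * Y * cpow l X (1/2))" "pair_spec l X Y d"
    "\<And>j. j < l \<Longrightarrow> 0 < d j" "\<And>i j. i \<le> j \<Longrightarrow> j < l \<Longrightarrow> g (d i) \<le> g (d j)"
proof -
  note M = pd_sandwich[OF X Y]
  obtain U d where dec: "udec l U d (cpow l X (1/2) * Y * cpow l X (1/2))" "\<forall>j<l. \<forall>i\<le>j. g (d i) \<le> g (d j)"
    using hermitian_udec_sorted[OF pd_hermitian[OF M], of g] by blast
  show ?thesis
    by (rule that[OF dec(1) pair_spec_eigen[OF X Y dec(1)] udec_pd[OF dec(1) M]]) (use dec(2) in auto)
qed

text \<open>Inverting both forms exchanges the roles of the two dual bases, up to adjoints, and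
  inverts the eigenvalues.\<close>

lemma pair_spec_inverse:
  assumes X: "pd l X" and Y: "pd l Y" and ps: "pair_spec l X Y d" and d: "\<And>j. j < l \<Longrightarrow> 0 < d j"
  shows "pair_spec l (cpow l X (-1)) (cpow l Y (-1)) (\<lambda>j. 1 / d j)"
proof -
  from ps obtain T T' where T: "T \<in> carrier_mat l l" "T' \<in> carrier_mat l l"
    and TT: "T' * T = 1\<^sub>m l" "T * T' = 1\<^sub>m l"
    and 1: "adj T * X * T = 1\<^sub>m l" and 2: "T' * Y * adj T' = rdiag l d"
    by (auto simp: pair_spec_def)
  note [simp] = T adj_carrier[OF T(1)] adj_carrier[OF T(2)] X Y pd_carrier[OF X] pd_carrier[OF Y]
  note sq = mult_carrier_mat[of _ l l _ l] mult_assoc_sq[of _ l] right_mult_one_mat[of _ l l] left_mult_one_mat[of _ l l]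
  have aTT: "adj T * adj T' = 1\<^sub>m l" "adj T' * adj T = 1\<^sub>m l"
    using arg_cong[OF TT(1), of adj] arg_cong[OF TT(2), of adj] by (simp_all add: adj_mult[of _ l l _ l])
  have inv: "cpow l M (-1) * M = 1\<^sub>m l" if "pd l M" for M
    using cpow_mult[OF that, of "-1" 1] by (simp add: cpow_1[OF that] cpow_0[OF that])
  note canc = mult_cancel_inverse[of _ l _ _ l, OF _ _ _ aTT(1)] mult_cancel_inverse[of _ l _ _ l, OF _ _ _ aTT(2)]
    mult_cancel_inverse[of _ l _ _ l, OF _ _ _ TT(1)] mult_cancel_inverse[of _ l _ _ l, OF _ _ _ TT(2)]
    mult_cancel_inverse[of _ l _ _ l, OF _ _ _ inv[OF X]] mult_cancel_inverse[of _ l _ _ l, OF _ _ _ inv[OF Y]]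
  have "T' * cpow l X (-1) * adj T' = T' * cpow l X (-1) * adj T' * (adj T * X * T)"
    unfolding 1 by (simp add: sq)
  also have "\<dots> = 1\<^sub>m l" by (simp add: sq canc TT)
  finally have A: "T' * cpow l X (-1) * adj T' = 1\<^sub>m l" .
  define Q where "Q = adj T * cpow l Y (-1) * T"
  have Q: "Q \<in> carrier_mat l l" by (simp add: Q_def sq)
  have "Q * rdiag l d = adj T * cpow l Y (-1) * T * (T' * Y * adj T')"
    unfolding Q_def 2 ..
  also have "\<dots> = 1\<^sub>m l" by (simp add: sq canc aTT)
  finally have QD: "Q * rdiag l d = 1\<^sub>m l" .
  have "rdiag l d * rdiag l (\<lambda>j. 1 / d j) = cdiag l (\<lambda>_. 1)"
    unfolding rdiag_cdiag cdiag_mult using d by (intro cdiag_cong) force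
  then have D: "rdiag l d * rdiag l (\<lambda>j. 1 / d j) = 1\<^sub>m l" by (simp add: cdiag_one)
  have "Q = Q * (rdiag l d * rdiag l (\<lambda>j. 1 / d j))" unfolding D using Q by (simp add: sq)
  also have "\<dots> = (Q * rdiag l d) * rdiag l (\<lambda>j. 1 / d j)" using Q by (simp add: sq)
  also have "\<dots> = rdiag l (\<lambda>j. 1 / d j)" unfolding QD by (simp add: sq)
  finally have B: "Q = rdiag l (\<lambda>j. 1 / d j)" .
  show ?thesis unfolding pair_spec_def
    by (rule exI[of _ "adj T'"], rule exI[of _ "adj T"]) (use A B aTT in \<open>simp add: Q_def\<close>)
qed

section \<open>Interlacing for compressions of a pair of forms\<close>

lemma exists_nonzero_solution:
  fixes M :: "nat \<Rightarrow> nat \<Rightarrow> complex"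
  shows "\<exists>y. (\<exists>m\<le>j. y m \<noteq> 0) \<and> (\<forall>i<j. (\<Sum>m\<le>j. M i m * y m) = 0)"
proof -
  \<comment> \<open>The \<open>j\<close> equations in \<open>j + 1\<close> unknowns are completed by
    a zero row to a square singular system.\<close>
  define B where "B = mat (Suc j) (Suc j) (\<lambda>(i,m). if i < j then M i m else 0)"
  have B: "B \<in> carrier_mat (Suc j) (Suc j)" by (simp add: B_def)
  have "det B = (\<Sum>m<Suc j. B $$ (j,m) * cofactor B j m)"
    by (rule laplace_expansion_row[OF B]) simp
  also have "\<dots> = 0" by (rule sum.neutral) (auto simp: B_def)
  finally obtain v where v: "v \<in> carrier_vec (Suc j)" "v \<noteq> 0\<^sub>v (Suc j)" "B *\<^sub>v v = 0\<^sub>v (Suc j)"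
    using det_0_iff_vec_prod_zero_field[OF B] by auto
  show ?thesis
  proof (intro exI[of _ "\<lambda>m. v $ m"] conjI allI impI)
    show "\<exists>m\<le>j. v $ m \<noteq> 0"
      using v(1,2) by (metis carrier_vecD eq_vecI index_zero_vec(1) index_zero_vec(2) less_Suc_eq_le)
    fix i assume i: "i < j"
    have "(\<Sum>m\<le>j. M i m * v $ m) = (B *\<^sub>v v) $ i"
      using v(1) i by (auto simp: B_def scalar_prod_def atLeast0LessThan lessThan_Suc_atMost intro!: sum.cong)
    then show "(\<Sum>m\<le>j. M i m * v $ m) = 0" using v(3) i by simp
  qed
qed

text \<open>A dimension count as in Cauchy interlacing, for two forms at once. A test vector
  \<open>y\<close> supported on the first \<open>j + 1\<close> coordinates of the compressed pair is
  sent to \<open>b\<close> by \<open>V * R\<close> and to \<open>a\<close> by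
  \<open>W * adj R'\<close>. These matrices are dual, so \<open>a\<close> and \<open>b\<close> pair
  to the squared norm \<open>N\<close> of \<open>y\<close>, while \<open>X'\<close> at
  \<open>b\<close> equals \<open>N\<close> and \<open>Y'\<close> at \<open>a\<close> is at most
  \<open>\<nu> j * N\<close>.\<close>

theorem pair_spec_interlacing:
  assumes ps: "pair_spec l X Y z" and X: "X \<in> carrier_mat l l" and Y: "Y \<in> carrier_mat l l"
    and z: "\<And>i. i < l \<Longrightarrow> 0 < z i" "\<And>i j. i \<le> j \<Longrightarrow> j < l \<Longrightarrow> z i \<le> z j"
    and X': "X' \<in> carrier_mat l l" "\<And>v. Re (qform l X v) \<le> Re (qform l X' v)"
    and Y': "Y' \<in> carrier_mat l l" "\<And>v. Re (qform l Y v) \<le> Re (qform l Y' v)"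
    and V: "V \<in> carrier_mat l k" and W: "W \<in> carrier_mat l k" and WV: "adj W * V = 1\<^sub>m k"
    and ps': "pair_spec k (adj V * X' * V) (adj W * Y' * W) \<nu>"
    and \<nu>: "\<And>i j. i \<le> j \<Longrightarrow> j < k \<Longrightarrow> \<nu> i \<le> \<nu> j"
    and j: "j < k" "k \<le> l"
  shows "z j \<le> \<nu> j"
proof -
  from ps obtain T T' where T: "T \<in> carrier_mat l l" "T' \<in> carrier_mat l l"
    and TT: "T' * T = 1\<^sub>m l" "T * T' = 1\<^sub>m l"
    and TX: "adj T * X * T = 1\<^sub>m l" and TY: "T' * Y * adj T' = rdiag l z"
    by (auto simp: pair_spec_def)
  from ps' obtain R R' where R: "R \<in> carrier_mat k k" "R' \<in> carrier_mat k k"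
    and RR: "R' * R = 1\<^sub>m k" "R * R' = 1\<^sub>m k"
    and RX: "adj R * (adj V * X' * V) * R = 1\<^sub>m k" and RY: "R' * (adj W * Y' * W) * adj R' = rdiag k \<nu>"
    by (auto simp: pair_spec_def)
  note aT = adj_carrier[OF T(1)] adj_carrier[OF T(2)] and aR = adj_carrier[OF R(1)] adj_carrier[OF R(2)]
  note aV = adj_carrier[OF V] and aW = adj_carrier[OF W]
  note VR = mult_carrier_mat[OF V R(1)] and WR = mult_carrier_mat[OF W aR(2)]
  \<comment> \<open>These \<open>j\<close> conditions remove from \<open>b\<close> its components
    along the first \<open>j\<close> vectors of the basis that diagonalizes the large pair.\<close>
  obtain y0 where y0: "\<exists>m\<le>j. y0 m \<noteq> 0" "\<And>i. i < j \<Longrightarrow> (\<Sum>m\<le>j. (T' * (V * R)) $$ (i,m) * y0 m) = 0"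
    using exists_nonzero_solution[where j=j and M="\<lambda>i m. (T' * (V * R)) $$ (i,m)"] by auto
  define y where "y m = (if m \<le> j then y0 m else 0)" for m
  define N where "N = (\<Sum>m<k. (cmod (y m))\<^sup>2)"
  have N: "0 < N"
  proof -
    obtain m where "m \<le> j" "y0 m \<noteq> 0" using y0(1) by auto
    then show ?thesis unfolding N_def using j by (intro sum_pos2[of _ m]) (auto simp: y_def)
  qed
  define a where "a = mv k (W * adj R') y"
  define b where "b = mv k (V * R) y"
  have b0: "mv l T' b i = 0" if "i < j" for i
  proof -
    have "mv l T' b i = mv k (T' * (V * R)) y i"
      unfolding b_def using that j by (intro mv_mult[symmetric, OF T(2) VR]) auto
    also have "\<dots> = (\<Sum>m\<le>j. (T' * (V * R)) $$ (i,m) * y0 m)"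
      unfolding mv_def using j by (intro sum.mono_neutral_cong_right) (auto simp: y_def)
    finally show ?thesis using y0(2)[OF that] by simp
  qed
  have ab: "(\<Sum>i<l. cnj (a i) * b i) = of_real N"
  proof -
    have prod1: "adj (W * adj R') * (V * R) = 1\<^sub>m k"
    proof -
      have "adj (W * adj R') * (V * R) = R' * (adj W * V) * R"
        using R aR V W aV aW
        by (simp add: adj_mult[OF W aR(2)] assoc_mult_mat[of _ k k _ l _ k] assoc_mult_mat[of _ k l _ k _ k]
          assoc_mult_mat[of _ k k _ k _ k] mult_carrier_mat[of _ l k _ k] mult_carrier_mat[of _ k l _ k])
      then show ?thesis using R WV RR by simp
    qed
    have "(\<Sum>i<l. cnj (a i) * b i) = (\<Sum>m<k. cnj (y m) * mv l (adj (W * adj R')) b m)"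
      unfolding a_def by (rule mv_adj[OF WR])
    also have "\<dots> = (\<Sum>m<k. cnj (y m) * mv k (adj (W * adj R') * (V * R)) y m)"
      unfolding b_def using mv_mult[OF adj_carrier[OF WR] VR] by (intro sum.cong refl) auto
    also have "\<dots> = (\<Sum>m<k. cnj (y m) * y m)"
      unfolding prod1 by (intro sum.cong refl) (simp add: mv_one)
    also have "\<dots> = of_real N"
      unfolding N_def of_real_sum complex_norm_square by (simp add: mult.commute)
    finally show ?thesis .
  qed
  have qX': "Re (qform l X' b) = N"
  proof -
    have "adj (V * R) * X' * (V * R) = adj R * (adj V * X' * V) * R"
      using R aR V aV X'(1)
      by (simp add: adj_mult[OF V R(1)] assoc_mult_mat[of _ k k _ l _ l] assoc_mult_mat[of _ k l _ l _ k]
          assoc_mult_mat[of _ k l _ k _ k] assoc_mult_mat[of _ k k _ l _ k] assoc_mult_mat[of _ k k _ k _ k]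
          assoc_mult_mat[of _ l l _ k _ k] mult_carrier_mat[of _ l k _ k] mult_carrier_mat[of _ k l _ k]
          mult_carrier_mat[of _ k l _ l] mult_carrier_mat[of _ l l _ k])
    then have "qform l X' b = qform k (1\<^sub>m k) y"
      unfolding b_def using qform_congruence_mv[OF VR X'(1), of y] RX by simp
    then show ?thesis by (simp add: qform_one N_def)
  qed
  have qY': "Re (qform l Y' a) \<le> \<nu> j * N"
  proof -
    have "adj (W * adj R') * Y' * (W * adj R') = R' * (adj W * Y' * W) * adj R'"
      using R aR W aW Y'(1)
      by (simp add: adj_mult[OF W aR(2)] assoc_mult_mat[of _ k k _ l _ l] assoc_mult_mat[of _ k l _ l _ k]
          assoc_mult_mat[of _ k l _ k _ k] assoc_mult_mat[of _ k k _ l _ k] assoc_mult_mat[of _ k k _ k _ k]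
          assoc_mult_mat[of _ l l _ k _ k] mult_carrier_mat[of _ l k _ k] mult_carrier_mat[of _ k l _ k]
          mult_carrier_mat[of _ k l _ l] mult_carrier_mat[of _ l l _ k])
    then have "qform l Y' a = of_real (\<Sum>m<k. \<nu> m * (cmod (y m))\<^sup>2)"
      unfolding a_def using qform_congruence_mv[OF WR Y'(1), of y] RY by (simp add: qform_rdiag)
    then have "Re (qform l Y' a) = (\<Sum>m<k. \<nu> m * (cmod (y m))\<^sup>2)"
      using Re_complex_of_real by metis
    also have "\<dots> \<le> (\<Sum>m<k. \<nu> j * (cmod (y m))\<^sup>2)"
    proof (rule sum_mono)
      fix m assume "m \<in> {..<k}"
      then show "\<nu> m * (cmod (y m))\<^sup>2 \<le> \<nu> j * (cmod (y m))\<^sup>2"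
        using \<nu>[of m j] j by (cases "m \<le> j") (auto simp: y_def mult_right_mono)
    qed
    finally show ?thesis by (simp add: N_def sum_distrib_left)
  qed
  have qX: "Re (qform l X b) = (\<Sum>i<l. (cmod (mv l T' b i))\<^sup>2)"
  proof -
    have "X = adj T' * T'"
    proof -
      have "adj T' * (adj T * X * T) * T' = (adj T' * adj T) * (X * (T * T'))"
        using T aT X by (simp add: mult_assoc_sq[of _ l] mult_carrier_mat[of _ l l _ l])
      also have "adj T' * adj T = 1\<^sub>m l" using TT(2) T by (simp flip: adj_mult)
      finally show ?thesis using TT TX X T aT by simp
    qed
    then show ?thesis using qform_gram[OF T(2)] by simp
  qed
  have qY: "Re (qform l Y a) = (\<Sum>i<l. z i * (cmod (mv l (adj T) a i))\<^sup>2)"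
  proof -
    have "Y = adj (adj T) * rdiag l z * adj T"
    proof -
      have "T * (T' * Y * adj T') * adj T = (T * T') * (Y * (adj T' * adj T))"
        using T aT Y by (simp add: mult_assoc_sq[of _ l] mult_carrier_mat[of _ l l _ l])
      also have "adj T' * adj T = 1\<^sub>m l" using TT(2) T by (simp flip: adj_mult)
      finally show ?thesis using TT TY Y T aT by simp
    qed
    then have "qform l Y a = qform l (rdiag l z) (mv l (adj T) a)"
      using qform_congruence_mv[OF aT(1) rdiag_carrier, of z a] by simp
    then show ?thesis by (simp add: qform_rdiag)
  qed
  \<comment> \<open>In dual coordinates the pairing of \<open>a\<close> and \<open>b\<close> runs
    over indices from \<open>j\<close> on, where \<open>z i\<close> is at least \<open>z j\<close>.
    Cauchy-Schwarz then bounds the square of \<open>N\<close> by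
    \<open>(\<nu> j * N / z j) * N\<close>.\<close>
  have ab': "(\<Sum>i<l. cnj (a i) * b i) = (\<Sum>i\<in>{j..<l}. cnj (mv l (adj T) a i) * mv l T' b i)"
  proof -
    have "(\<Sum>i<l. cnj (a i) * b i) = (\<Sum>i<l. cnj (a i) * mv l (T * T') b i)"
      unfolding TT by (intro sum.cong refl) (simp add: mv_one)
    also have "\<dots> = (\<Sum>i<l. cnj (a i) * mv l T (mv l T' b) i)"
      using mv_mult[OF T] by (intro sum.cong refl) auto
    also have "\<dots> = (\<Sum>i<l. cnj (mv l (adj T) a i) * mv l T' b i)"
      using mv_adj[OF aT(1), of a "mv l T' b"] by simp
    also have "\<dots> = (\<Sum>i\<in>{j..<l}. cnj (mv l (adj T) a i) * mv l T' b i)"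
      using b0 by (intro sum.mono_neutral_right) auto
    finally show ?thesis .
  qed
  have zj: "0 < z j" using z(1) j by simp
  have "N\<^sup>2 = (cmod (\<Sum>i<l. cnj (a i) * b i))\<^sup>2" using ab N by simp
  also have "\<dots> \<le> (\<Sum>i\<in>{j..<l}. (cmod (mv l (adj T) a i))\<^sup>2) * (\<Sum>i\<in>{j..<l}. (cmod (mv l T' b i))\<^sup>2)"
    unfolding ab' by (rule cmod_sum_Cauchy_Schwarz)
  finally have cs: "N\<^sup>2 \<le> \<dots>" .
  have "z j * (\<Sum>i\<in>{j..<l}. (cmod (mv l (adj T) a i))\<^sup>2) \<le> (\<Sum>i\<in>{j..<l}. z i * (cmod (mv l (adj T) a i))\<^sup>2)"
    unfolding sum_distrib_left using z(2) by (intro sum_mono mult_right_mono) auto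
  also have "\<dots> \<le> (\<Sum>i<l. z i * (cmod (mv l (adj T) a i))\<^sup>2)"
    using z(1) by (intro sum_mono2) (auto simp: less_imp_le)
  also have "\<dots> \<le> \<nu> j * N" using qY qY' Y'(2)[of a] by simp
  finally have 1: "z j * (\<Sum>i\<in>{j..<l}. (cmod (mv l (adj T) a i))\<^sup>2) \<le> \<nu> j * N" .
  have "(\<Sum>i\<in>{j..<l}. (cmod (mv l T' b i))\<^sup>2) \<le> (\<Sum>i<l. (cmod (mv l T' b i))\<^sup>2)"
    by (intro sum_mono2) auto
  also have "\<dots> \<le> N" using qX qX' X'(2)[of b] by simp
  finally have 2: "(\<Sum>i\<in>{j..<l}. (cmod (mv l T' b i))\<^sup>2) \<le> N" .
  have nn: "0 \<le> (\<Sum>i\<in>{j..<l}. (cmod (mv l (adj T) a i))\<^sup>2)" by (simp add: sum_nonneg)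
  have "z j * N\<^sup>2 \<le> z j * ((\<Sum>i\<in>{j..<l}. (cmod (mv l (adj T) a i))\<^sup>2) * N)"
    using cs 2 nn zj by (intro mult_left_mono order_trans[OF cs]) auto
  also have "\<dots> \<le> (\<nu> j * N) * N" using mult_right_mono[OF 1, of N] N by (simp add: mult.assoc)
  finally have "z j * N\<^sup>2 \<le> \<nu> j * N\<^sup>2" by (simp add: power2_eq_square algebra_simps)
  then show ?thesis using N by simp
qed

text \<open>A replacement for the trace Young inequality: \<open>ZX\<close> and \<open>ZY\<close> are powers of
  \<open>P\<^sup>\<half>QP\<^sup>\<half>\<close> and \<open>Q\<^sup>\<half>PQ\<^sup>\<half>\<close>, whose eigenbases are matched by the polar decomposition.\<close>

lemma pair_variational:
  fixes a b s :: real
  assumes P: "pd k P" and Q: "pd k Q" and ab: "0 < a + b" and s: "s = 1 / (a + b)"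
  obtains \<nu> ZX ZY where "pair_spec k P Q \<nu>" "\<And>j. j < k \<Longrightarrow> 0 < \<nu> j"
    "\<And>i j. i \<le> j \<Longrightarrow> j < k \<Longrightarrow> \<nu> i \<le> \<nu> j" "pd k ZX" "pd k ZY"
    "mtrace ZX = of_real (\<Sum>j<k. \<nu> j powr s)" "mtrace ZY = of_real (\<Sum>j<k. \<nu> j powr s)"
    "2 * (\<Sum>j<k. \<nu> j powr s) \<le> Re (mtrace (P * cpow k ZX (of_real (1 - a))))
       + Re (mtrace (Q * cpow k ZY (of_real (1 - b))))"
proof -
  obtain U \<nu> where dec: "udec k U \<nu> (cpow k P (1/2) * Q * cpow k P (1/2))" and ps: "pair_spec k P Q \<nu>"
    and \<nu>: "\<And>j. j < k \<Longrightarrow> 0 < \<nu> j" "\<And>i j. i \<le> j \<Longrightarrow> j < k \<Longrightarrow> \<nu> i \<le> \<nu> j"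
    using pair_spec_exists[OF P Q, of id] by (metis id_apply)
  note u = udec_unitary[OF dec]
  note sq = mult_carrier_mat[of _ k k _ k] mult_assoc_sq[of _ k]
  note [simp] = unitary_carrier[OF u] adj_carrier[OF unitary_carrier[OF u]] P Q pd_carrier[OF P] pd_carrier[OF Q]
  have QQ: "cpow k Q (1/2) * (cpow k Q (1/2) * X) = Q * X" if "X \<in> carrier_mat k k" for X
    using cpow_mult_assoc[OF Q that, of "1/2" "1/2"] by (simp add: cpow_1)
  have dd: "rdiag k x * rdiag k y = rdiag k (\<lambda>j. x j * y j)" for x y
    by (simp add: rdiag_cdiag cdiag_mult)
  \<comment> \<open>\<open>Q^(1/2) * P^(1/2)\<close> sends the unit eigenvectors in \<open>U\<close>
    to eigenvectors of \<open>Q^(1/2) * P * Q^(1/2)\<close> with squared norm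
    \<open>\<nu> j\<close>. The factor \<open>r\<close> normalizes them, so \<open>U2\<close> is the
    matched eigenbasis.\<close>
  define r where "r j = \<nu> j powr (-1/2)" for j
  have r: "r j * (\<nu> j * r j) = 1" if "j < k" for j
    using \<nu>(1)[OF that] by (simp add: r_def powr_minus powr_half_sqrt field_simps)
  define U2 where "U2 = cpow k Q (1/2) * (cpow k P (1/2) * (U * rdiag k r))"
  have aU2: "adj U2 = rdiag k r * (adj U * (cpow k P (1/2) * cpow k Q (1/2)))"
    unfolding U2_def by (simp add: adj_mult[of _ k k _ k] sq pd_half(2) hermitian_adj[OF hermitian_rdiag])
  have spec: "adj U * (cpow k P (1/2) * (Q * (cpow k P (1/2) * U))) = rdiag k \<nu>"
  proof -
    have "adj U * (cpow k P (1/2) * Q * cpow k P (1/2)) * U = rdiag k \<nu>"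
      using dec adj_conjugate_unitary[OF u rdiag_carrier] by (simp add: udec_def)
    then show ?thesis by (simp add: sq)
  qed
  have spec': "adj U * (cpow k P (1/2) * (Q * (cpow k P (1/2) * (U * rdiag k x)))) = rdiag k (\<lambda>j. \<nu> j * x j)" for x
    using arg_cong[OF spec, of "\<lambda>M. M * rdiag k x"] by (simp add: sq dd)
  have U2c: "U2 \<in> carrier_mat k k" by (simp add: U2_def sq)
  have u2: "unitary k U2"
  proof (rule unitaryI[OF U2c])
    have "adj U2 * U2 = rdiag k (\<lambda>j. r j * (\<nu> j * r j))"
      unfolding aU2 unfolding U2_def by (simp add: sq QQ spec' dd)
    also have "\<dots> = cdiag k (\<lambda>_. 1)"
      unfolding rdiag_cdiag
    proof (rule cdiag_cong)
      fix j assume "j < k"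
      then show "complex_of_real (r j * (\<nu> j * r j)) = 1" by (simp only: r of_real_1)
    qed
    finally show "adj U2 * U2 = 1\<^sub>m k" by (simp add: cdiag_one)
  qed
  define ZX where "ZX = U * rdiag k (\<lambda>j. \<nu> j powr s) * adj U"
  define ZY where "ZY = U2 * rdiag k (\<lambda>j. \<nu> j powr s) * adj U2"
  have decX: "udec k U (\<lambda>j. \<nu> j powr s) ZX" and decY: "udec k U2 (\<lambda>j. \<nu> j powr s) ZY"
    using u u2 by (simp_all add: udec_def ZX_def ZY_def)
  have pdZ: "pd k ZX" "pd k ZY"
    using udec_imp_pd[OF decX] udec_imp_pd[OF decY] \<nu>(1) by (simp_all add: less_imp_neq[symmetric])
  define x where "x j = (\<Sum>i<k. (cmod ((cpow k P (1/2) * U) $$ (i,j)))\<^sup>2)" for j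
  define y where "y j = (\<Sum>i<k. (cmod ((cpow k Q (1/2) * U2) $$ (i,j)))\<^sup>2)" for j
  have col: "qform k R (\<lambda>i. W $$ (i,j)) = of_real (\<Sum>i<k. (cmod ((cpow k R (1/2) * W) $$ (i,j)))\<^sup>2)"
    if "pd k R" "W \<in> carrier_mat k k" "j < k" for R W j
  proof -
    have "R = adj (cpow k R (1/2)) * cpow k R (1/2)"
      using that by (simp add: pd_half(2) cpow_mult cpow_1)
    then have "qform k R (\<lambda>i. W $$ (i,j)) = of_real (\<Sum>i<k. (cmod (mv k (cpow k R (1/2)) (\<lambda>i. W $$ (i,j)) i))\<^sup>2)"
      using qform_gram[OF cpow_carrier[OF that(1)], of "1/2"] by simp
    also have "(\<Sum>i<k. (cmod (mv k (cpow k R (1/2)) (\<lambda>i. W $$ (i,j)) i))\<^sup>2)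
        = (\<Sum>i<k. (cmod ((cpow k R (1/2) * W) $$ (i,j)))\<^sup>2)"
      using that by (intro sum.cong refl) (subst index_mult_sum[of _ k k _ k], auto simp: mv_def)
    finally show ?thesis .
  qed
  have trX: "Re (mtrace (P * cpow k ZX (of_real (1 - a)))) = (\<Sum>j<k. (\<nu> j powr s) powr (1 - a) * x j)"
    using mtrace_mult_udec[OF udec_cpow[OF pdZ(1) decX] pd_carrier[OF P], of "1 - a"] col[OF P, of U]
    by (simp add: x_def del: of_real_diff of_real_sum of_real_power)
  have trY: "Re (mtrace (Q * cpow k ZY (of_real (1 - b)))) = (\<Sum>j<k. (\<nu> j powr s) powr (1 - b) * y j)"
    using mtrace_mult_udec[OF udec_cpow[OF pdZ(2) decY] pd_carrier[OF Q], of "1 - b"] col[OF Q U2c]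
    by (simp add: y_def del: of_real_diff of_real_sum of_real_power)
  \<comment> \<open>\<open>x j\<close> and \<open>y j\<close> are the values of \<open>P\<close> and
    \<open>Q\<close> at matched eigenvectors. The inner product of the two columns involved is the
    square root of \<open>\<nu> j\<close>, so this is Cauchy-Schwarz.\<close>
  have xy: "\<nu> j \<le> x j * y j" if j: "j < k" for j
  proof -
    have M1: "cpow k P (1/2) * U \<in> carrier_mat k k" and M2: "cpow k Q (1/2) * U2 \<in> carrier_mat k k"
      using U2c by (simp_all add: sq)
    have "adj (cpow k Q (1/2) * U2) * (cpow k P (1/2) * U) = rdiag k (\<lambda>j. r j * \<nu> j)"
      using U2c unfolding adj_mult[OF cpow_carrier[OF Q] U2c] aU2
      by (simp add: sq pd_half(2) adj_carrier QQ spec dd)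
    then have "of_real (r j * \<nu> j) = (adj (cpow k Q (1/2) * U2) * (cpow k P (1/2) * U)) $$ (j,j)"
      using j by (simp add: rdiag_cdiag)
    also have "\<dots> = (\<Sum>i<k. cnj ((cpow k Q (1/2) * U2) $$ (i,j)) * (cpow k P (1/2) * U) $$ (i,j))"
      using j M1 M2 adj_carrier[OF M2] carrier_matD[OF U2c] carrier_matD[OF cpow_carrier[OF Q, of "1/2"]]
      by (subst index_mult_sum[OF _ M1]) (auto simp del: index_mult_mat(1))
    finally have "(cmod (of_real (r j * \<nu> j)))\<^sup>2 \<le> y j * x j"
      unfolding x_def y_def using cmod_sum_Cauchy_Schwarz by metis
    moreover have "(cmod (of_real (r j * \<nu> j)))\<^sup>2 = \<nu> j"
    proof -
      have "(cmod (of_real (r j * \<nu> j)))\<^sup>2 = \<nu> j * (r j * (\<nu> j * r j))"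
        by (simp only: norm_of_real power2_abs) (simp add: power2_eq_square)
      then show ?thesis using r[OF j] by simp
    qed
    ultimately show ?thesis by (simp add: mult.commute)
  qed
  have "2 * (\<Sum>j<k. \<nu> j powr s) \<le> (\<Sum>j<k. (\<nu> j powr s) powr (1 - a) * x j + (\<nu> j powr s) powr (1 - b) * y j)"
    unfolding sum_distrib_left
  proof (rule sum_mono)
    fix j assume "j \<in> {..<k}"
    then have j: "j < k" by simp
    define \<alpha> where "\<alpha> = (\<nu> j powr s) powr (1 - a) * x j"
    define \<beta> where "\<beta> = (\<nu> j powr s) powr (1 - b) * y j"
    have nn: "0 \<le> \<alpha>" "0 \<le> \<beta>" by (simp_all add: \<alpha>_def \<beta>_def x_def y_def sum_nonneg)
    \<comment> \<open>This exponent count is where \<open>s = 1 / (a + b)\<close> enters: the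
      geometric mean of the two summands is at least \<open>\<nu> j powr s\<close>, and the
      arithmetic mean dominates it.\<close>
    have e: "s * (1 - a) + s * (1 - b) + 1 = s + s"
    proof -
      have "s * (a + b) = 1" using ab s by simp
      then show ?thesis by (simp add: algebra_simps)
    qed
    have "(\<nu> j powr s)\<^sup>2 = \<nu> j powr (s * (1 - a) + s * (1 - b) + 1)"
      unfolding e powr_add by (rule power2_eq_square)
    also have "\<dots> = (\<nu> j powr s) powr (1 - a) * (\<nu> j powr s) powr (1 - b) * \<nu> j"
      using \<nu>(1)[OF j] by (simp add: powr_add powr_powr)
    also have "\<dots> \<le> (\<nu> j powr s) powr (1 - a) * (\<nu> j powr s) powr (1 - b) * (x j * y j)"
      by (intro mult_left_mono xy j) simp
    also have "\<dots> = \<alpha> * \<beta>" by (simp add: \<alpha>_def \<beta>_def)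
    finally have "(2 * \<nu> j powr s)\<^sup>2 \<le> 4 * (\<alpha> * \<beta>)" by (simp add: power2_eq_square)
    also have "\<dots> \<le> (\<alpha> + \<beta>)\<^sup>2"
      using zero_le_power2[of "\<alpha> - \<beta>"] by (simp add: power2_eq_square algebra_simps)
    finally have "2 * \<nu> j powr s \<le> \<alpha> + \<beta>" using nn by (meson add_nonneg_nonneg power2_le_imp_le)
    then show "2 * \<nu> j powr s \<le> (\<nu> j powr s) powr (1 - a) * x j + (\<nu> j powr s) powr (1 - b) * y j"
      by (simp add: \<alpha>_def \<beta>_def)
  qed
  then have "2 * (\<Sum>j<k. \<nu> j powr s) \<le> Re (mtrace (P * cpow k ZX (of_real (1 - a))))
       + Re (mtrace (Q * cpow k ZY (of_real (1 - b))))"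
    by (simp only: trX trY sum.distrib)
  from that[OF ps \<nu> pdZ mtrace_udec[OF decX] mtrace_udec[OF decY] this] show ?thesis .
qed

text \<open>The scalar Young inequality, averaged with the weights
  \<open>(cmod (E $$ (i,j)))\<^sup>2\<close>. They form a doubly stochastic matrix because
  \<open>E\<close> is unitary, so each of the two terms sums up to a trace.\<close>

lemma mtrace_rdiag_cpow_le:
  assumes D: "pd k D" and w: "\<And>i. i < k \<Longrightarrow> 0 < w i" and a: "0 \<le> a" "a \<le> 1"
  shows "Re (mtrace (rdiag k (\<lambda>i. w i powr a) * cpow k D (of_real (1 - a))))
    \<le> a * (\<Sum>i<k. w i) + (1 - a) * Re (mtrace D)"
proof -
  obtain E \<delta> where dec: "udec k E \<delta> D" using hermitian_udec[OF pd_hermitian[OF D]] by auto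
  note \<delta> = udec_pd[OF dec D] and E = udec_unitary[OF dec]
  have "Re (mtrace (rdiag k (\<lambda>i. w i powr a) * cpow k D (of_real (1 - a))))
      = (\<Sum>j<k. \<delta> j powr (1 - a) * (\<Sum>i<k. w i powr a * (cmod (E $$ (i,j)))\<^sup>2))"
    by (simp add: mtrace_mult_udec[OF udec_cpow[OF D dec] rdiag_carrier] qform_rdiag
        del: of_real_diff of_real_sum of_real_power of_real_mult)
  also have "\<dots> = (\<Sum>j<k. \<Sum>i<k. w i powr a * \<delta> j powr (1 - a) * (cmod (E $$ (i,j)))\<^sup>2)"
    by (simp add: sum_distrib_left algebra_simps)
  also have "\<dots> \<le> (\<Sum>j<k. \<Sum>i<k. (a * w i + (1 - a) * \<delta> j) * (cmod (E $$ (i,j)))\<^sup>2)"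
    using a w \<delta> by (intro sum_mono mult_right_mono Youngs_inequality_0) auto
  also have "\<dots> = (\<Sum>j<k. \<Sum>i<k. a * w i * (cmod (E $$ (i,j)))\<^sup>2) + (\<Sum>j<k. \<Sum>i<k. (1 - a) * \<delta> j * (cmod (E $$ (i,j)))\<^sup>2)"
    by (simp add: ring_distribs sum.distrib)
  also have "(\<Sum>j<k. \<Sum>i<k. a * w i * (cmod (E $$ (i,j)))\<^sup>2) = (\<Sum>i<k. \<Sum>j<k. a * w i * (cmod (E $$ (i,j)))\<^sup>2)"
    by (rule sum.swap)
  also have "\<dots> = a * (\<Sum>i<k. w i)"
    unfolding sum_distrib_left[symmetric] by (simp add: unitary_rows_norm[OF E] sum_distrib_left)
  also have "(\<Sum>j<k. \<Sum>i<k. (1 - a) * \<delta> j * (cmod (E $$ (i,j)))\<^sup>2) = (1 - a) * Re (mtrace D)"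
    unfolding sum_distrib_left[symmetric] mtrace_udec[OF dec]
    by (simp add: unitary_columns_norm[OF E] sum_distrib_left)
  finally show ?thesis .
qed

subsection \<open>Strictly positive maps\<close>

lemma strictly_positive_map_linear:
  assumes "strictly_positive_map n l \<Phi>"
  shows "\<And>A. A \<in> carrier_mat n n \<Longrightarrow> \<Phi> A \<in> carrier_mat l l"
    "\<And>A B. A \<in> carrier_mat n n \<Longrightarrow> B \<in> carrier_mat n n \<Longrightarrow> \<Phi> (A + B) = \<Phi> A + \<Phi> B"
    "\<And>c A. A \<in> carrier_mat n n \<Longrightarrow> \<Phi> (c \<cdot>\<^sub>m A) = c \<cdot>\<^sub>m \<Phi> A"
  using assms by (auto simp: strictly_positive_map_def Defs.linear_map_def)

lemma strictly_positive_map_pd: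
  "strictly_positive_map n l \<Phi> \<Longrightarrow> pd n A \<Longrightarrow> pd l (\<Phi> A)"
  by (simp add: strictly_positive_map_def)

text \<open>Adding a positive multiple of the identity makes \<open>P\<close> positive definite.
  Subtracting the Hermitian image of the identity shows that the image of \<open>P\<close> is
  Hermitian, and a small multiple excludes a negative value of its form.\<close>

lemma strictly_positive_map_psd:
  assumes \<Phi>: "strictly_positive_map n l \<Phi>" and P: "psd n P"
  shows "psd l (\<Phi> P)"
proof -
  note lin = strictly_positive_map_linear[OF \<Phi>]
  note Pc = psd_carrier[OF P]
  have one_smult: "(1::complex) \<cdot>\<^sub>m M = M" for M by (rule eq_matI) auto
  have one: "pd l (\<Phi> (1\<^sub>m n))" by (rule strictly_positive_map_pd[OF \<Phi> pd_one])
  have shift: "pd l (\<Phi> P + of_real \<epsilon> \<cdot>\<^sub>m \<Phi> (1\<^sub>m n))" if "0 < \<epsilon>" for \<epsilon>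
  proof -
    have "pd n (of_real \<epsilon> \<cdot>\<^sub>m 1\<^sub>m n + P)" by (intro pd_add_psd pd_smult pd_one P that)
    then have "pd n (P + of_real \<epsilon> \<cdot>\<^sub>m 1\<^sub>m n)" using comm_add_mat[of P n n "of_real \<epsilon> \<cdot>\<^sub>m 1\<^sub>m n"] Pc by simp
    from strictly_positive_map_pd[OF \<Phi> this] show ?thesis using Pc by (simp add: lin)
  qed
  have herm: "hermitian l (\<Phi> P)"
  proof -
    have 1: "hermitian l (\<Phi> P + \<Phi> (1\<^sub>m n))" using pd_hermitian[OF shift[of 1]]
      by (simp add: one_smult)
    have "adj (\<Phi> P) = \<Phi> P"
    proof (rule eq_matI)
      fix i j assume "i < dim_row (\<Phi> P)" "j < dim_col (\<Phi> P)"
      then have ij: "i < l" "j < l" using lin(1)[OF Pc] by auto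
      show "adj (\<Phi> P) $$ (i,j) = \<Phi> P $$ (i,j)"
        using hermitian_index[OF 1 ij(2,1)] hermitian_index[OF pd_hermitian[OF one] ij(2,1)] ij lin(1)[OF Pc]
          lin(1)[OF one_carrier_mat] by auto
    qed (use lin(1)[OF Pc] in auto)
    then show ?thesis using lin(1)[OF Pc] by (simp add: hermitian_def)
  qed
  have "0 \<le> Re (qform l (\<Phi> P) v)" for v
  proof (rule ccontr)
    define x where "x = Re (qform l (\<Phi> P) v)"
    define y where "y = Re (qform l (\<Phi> (1\<^sub>m n)) v)"
    assume "\<not> 0 \<le> Re (qform l (\<Phi> P) v)"
    then have x: "x < 0" by (simp add: x_def)
    have y: "0 \<le> y" using pd_imp_psd[OF one] by (simp add: y_def psd_def)
    \<comment> \<open>Chosen so that \<open>x + \<epsilon> * y\<close> becomes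
      \<open>x / (y + 1)\<close>, still negative; the added one covers \<open>y = 0\<close>.\<close>
    define \<epsilon> where "\<epsilon> = - x / (y + 1)"
    have \<epsilon>: "0 < \<epsilon>" unfolding \<epsilon>_def using x y by (intro divide_pos_pos) auto
    have "0 \<le> x + \<epsilon> * y"
      using pd_imp_psd[OF shift[OF \<epsilon>]] lin(1)[OF Pc] lin(1)[OF one_carrier_mat]
      by (simp add: psd_def qform_add qform_smult x_def y_def)
    moreover have "x + \<epsilon> * y = x / (y + 1)" using y by (simp add: \<epsilon>_def field_simps)
    moreover have "x / (y + 1) < 0" using x y by (intro divide_neg_pos) auto
    ultimately show False by simp
  qed
  then show ?thesis using herm by (simp add: psd_def)
qed

text \<open>This is the form to which Lieb's theorem is applied: the compressed image of a power,
  paired with a power of the trial matrix.\<close>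

lemma positive_bilinear_mtrace:
  assumes \<Phi>: "strictly_positive_map n l \<Phi>" and V: "V \<in> carrier_mat l k"
  shows "positive_bilinear n k (\<lambda>X R. mtrace (adj V * \<Phi> X * V * R))"
proof -
  note lin = strictly_positive_map_linear[OF \<Phi>]
  note aV = adj_carrier[OF V]
  note cs = mult_carrier_mat[of _ k l _ l] mult_carrier_mat[of _ k l _ k] mult_carrier_mat[of _ k k _ k]
  have "linear_fun n (\<lambda>X. mtrace (adj V * \<Phi> X * V * R))" if R: "R \<in> carrier_mat k k" for R
    unfolding linear_fun_def using V aV R
    by (auto simp: lin mult_add_distrib_mat[of _ k l _ l] add_mult_distrib_mat[of _ k l _ _ k] cs
        add_mult_distrib_mat[of _ k k _ _ k] mtrace_add[of _ k] mult_smult_distrib[of _ k l _ l]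
        mult_smult_assoc_mat[of _ k l _ k] mult_smult_assoc_mat[of _ k k _ k] mtrace_smult[of _ k])
  moreover have "linear_fun k (\<lambda>R. mtrace (adj V * \<Phi> X * V * R))" if X: "X \<in> carrier_mat n n" for X
    unfolding linear_fun_def using V aV lin(1)[OF X]
    by (auto simp: cs mult_add_distrib_mat[of _ k k _ k] mtrace_add[of _ k] mult_smult_distrib[of _ k k _ k]
        mtrace_smult[of _ k])
  moreover have "Im (mtrace (adj V * \<Phi> P * V * Q)) = 0 \<and> 0 \<le> Re (mtrace (adj V * \<Phi> P * V * Q))"
    if "psd n P" "psd k Q" for P Q
    by (intro mtrace_psd_mult[of k] psd_congruence[OF V] strictly_positive_map_psd[OF \<Phi>] that)
  ultimately show ?thesis unfolding positive_bilinear_def by blast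
qed

subsection \<open>Concavity of sums of the smallest eigenvalues\<close>

text \<open>\<tau> is the trace of the \<open>s\<close>-th power for the compressed pair. The
  variational bound supplies the trial matrices, and interlacing together with monotonicity of
  \<open>powr s\<close> gives the lower bound of \<tau> by the partial sum.\<close>

lemma compressed_variational:
  fixes a b s :: real
  assumes \<Phi>: "strictly_positive_map n l \<Phi>" and \<Psi>: "strictly_positive_map m l \<Psi>"
    and A: "pd n A" and B: "pd m B" and ab: "0 < a + b" and s: "s = 1 / (a + b)"
    and ps: "pair_spec l X Y z" and X: "X \<in> carrier_mat l l" and Y: "Y \<in> carrier_mat l l"
    and z: "\<And>i. i < l \<Longrightarrow> 0 < z i" "\<And>i j. i \<le> j \<Longrightarrow> j < l \<Longrightarrow> z i \<le> z j"
    and X': "\<And>v. Re (qform l X v) \<le> Re (qform l (\<Phi> (cpow n A (of_real a))) v)"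
    and Y': "\<And>v. Re (qform l Y v) \<le> Re (qform l (\<Psi> (cpow m B (of_real b))) v)"
    and V: "V \<in> carrier_mat l k" and W: "W \<in> carrier_mat l k" and WV: "adj W * V = 1\<^sub>m k"
    and k: "k \<le> l"
  obtains \<tau> ZX ZY where "pd k ZX" "pd k ZY" "mtrace ZX = of_real \<tau>" "mtrace ZY = of_real \<tau>"
    "(\<Sum>j<k. z j powr s) \<le> \<tau>"
    "2 * \<tau> \<le> Re (mtrace (adj V * \<Phi> (cpow n A (of_real a)) * V * cpow k ZX (of_real (1 - a))))
       + Re (mtrace (adj W * \<Psi> (cpow m B (of_real b)) * W * cpow k ZY (of_real (1 - b))))"
proof -
  let ?P = "adj V * \<Phi> (cpow n A (of_real a)) * V" and ?Q = "adj W * \<Psi> (cpow m B (of_real b)) * W"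
  have pA: "pd l (\<Phi> (cpow n A (of_real a)))" and pB: "pd l (\<Psi> (cpow m B (of_real b)))"
    by (intro strictly_positive_map_pd[OF \<Phi>] strictly_positive_map_pd[OF \<Psi>] pd_cpow A B)+
  have VW: "adj V * W = 1\<^sub>m k"
    using arg_cong[OF WV, of adj] by (simp add: adj_mult[OF adj_carrier[OF W] V])
  have P: "pd k ?P" by (rule pd_congruence[OF V adj_carrier[OF W] WV pA])
  have Q: "pd k ?Q" by (rule pd_congruence[OF W adj_carrier[OF V] VW pB])
  from pair_variational[OF P Q ab s] obtain \<nu> ZX ZY where
    1: "pair_spec k ?P ?Q \<nu>" and 2: "\<And>j. j < k \<Longrightarrow> 0 < \<nu> j"
    and 3: "\<And>i j. i \<le> j \<Longrightarrow> j < k \<Longrightarrow> \<nu> i \<le> \<nu> j" and 4: "pd k ZX" "pd k ZY"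
    "mtrace ZX = of_real (\<Sum>j<k. \<nu> j powr s)" "mtrace ZY = of_real (\<Sum>j<k. \<nu> j powr s)"
    and 5: "2 * (\<Sum>j<k. \<nu> j powr s) \<le> Re (mtrace (?P * cpow k ZX (of_real (1 - a))))
       + Re (mtrace (?Q * cpow k ZY (of_real (1 - b))))" by blast
  have "z j \<le> \<nu> j" if "j < k" for j
    by (rule pair_spec_interlacing[OF ps X Y z pd_carrier[OF pA] X' pd_carrier[OF pB] Y' V W WV 1 3 that k])
  then have "(\<Sum>j<k. z j powr s) \<le> (\<Sum>j<k. \<nu> j powr s)"
    using z(1) k s ab by (intro sum_mono powr_mono2) (auto simp: less_imp_le)
  from that[OF 4 this 5] show ?thesis .
qed

text \<open>The pairs at the two end points enter through inequalities, whereas the pair at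
  \<open>C\<close> and \<open>D\<close> is exact. In this shape the result also applies to majorants
  that touch at the convex combination, as negative exponents require.\<close>

theorem smallest_eigenvalue_sums_concave:
  fixes a b s t :: real
  assumes \<Phi>: "strictly_positive_map n l \<Phi>" and \<Psi>: "strictly_positive_map m l \<Psi>"
    and A: "pd n A1" "pd n A2" and B: "pd m B1" "pd m B2" and t: "0 \<le> t" "t \<le> 1"
    and a: "0 \<le> a" "a \<le> 1" and b: "0 \<le> b" "b \<le> 1" and ab: "0 < a + b" and s: "s = 1 / (a + b)"
    and C: "C = complex_of_real t \<cdot>\<^sub>m A1 + complex_of_real (1 - t) \<cdot>\<^sub>m A2"
    and D: "D = complex_of_real t \<cdot>\<^sub>m B1 + complex_of_real (1 - t) \<cdot>\<^sub>m B2"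
    and ps0: "pair_spec l (\<Phi> (cpow n C (of_real a))) (\<Psi> (cpow m D (of_real b))) z0"
    and z0: "\<And>i. i < l \<Longrightarrow> 0 < z0 i"
    and ps1: "pair_spec l X1 Y1 z1" and XY1: "X1 \<in> carrier_mat l l" "Y1 \<in> carrier_mat l l"
    and z1: "\<And>i. i < l \<Longrightarrow> 0 < z1 i" "\<And>i j. i \<le> j \<Longrightarrow> j < l \<Longrightarrow> z1 i \<le> z1 j"
    and X1: "\<And>v. Re (qform l X1 v) \<le> Re (qform l (\<Phi> (cpow n A1 (of_real a))) v)"
    and Y1: "\<And>v. Re (qform l Y1 v) \<le> Re (qform l (\<Psi> (cpow m B1 (of_real b))) v)"
    and ps2: "pair_spec l X2 Y2 z2" and XY2: "X2 \<in> carrier_mat l l" "Y2 \<in> carrier_mat l l"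
    and z2: "\<And>i. i < l \<Longrightarrow> 0 < z2 i" "\<And>i j. i \<le> j \<Longrightarrow> j < l \<Longrightarrow> z2 i \<le> z2 j"
    and X2: "\<And>v. Re (qform l X2 v) \<le> Re (qform l (\<Phi> (cpow n A2 (of_real a))) v)"
    and Y2: "\<And>v. Re (qform l Y2 v) \<le> Re (qform l (\<Psi> (cpow m B2 (of_real b))) v)"
    and k: "k \<le> l"
  shows "t * (\<Sum>j<k. z1 j powr s) + (1 - t) * (\<Sum>j<k. z2 j powr s) \<le> (\<Sum>j<k. z0 j powr s)"
proof -
  let ?X = "\<Phi> (cpow n C (of_real a))" and ?Y = "\<Psi> (cpow m D (of_real b))"
  have pdC: "pd n C" unfolding C by (intro pd_convex A t)
  have pdD: "pd m D" unfolding D by (intro pd_convex B t)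
  have X: "?X \<in> carrier_mat l l" and Y: "?Y \<in> carrier_mat l l"
    by (intro strictly_positive_map_linear(1)[OF \<Phi>] strictly_positive_map_linear(1)[OF \<Psi>] cpow_carrier pdC pdD)+
  from ps0 obtain T T' where T: "T \<in> carrier_mat l l" "T' \<in> carrier_mat l l"
    and TT: "T' * T = 1\<^sub>m l" and TX: "adj T * ?X * T = 1\<^sub>m l" and TY: "T' * ?Y * adj T' = rdiag l z0"
    by (auto simp: pair_spec_def)
  note aT = adj_carrier[OF T(1)] adj_carrier[OF T(2)]
  define w where "w j = z0 j powr s" for j
  have w: "0 < w j" if "j < k" for j using z0[of j] that k by (simp add: w_def)
  \<comment> \<open>A weighted inclusion of the first \<open>k\<close> coordinates into all
    \<open>l\<close> of them.\<close>
  define J where "J x = mat l k (\<lambda>(i,j). if i = j then complex_of_real (x i) else 0)" for x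
  have J: "J x \<in> carrier_mat l k" for x by (simp add: J_def)
  have Ji: "J x $$ (i,j) = (if i = j then complex_of_real (x i) else 0)" if "i < l" "j < k" for x i j
    using that by (simp add: J_def)
  have Jd: "adj (J x) * rdiag l d * J y = rdiag k (\<lambda>i. x i * d i * y i)" for x y d
  proof (rule eq_matI)
    fix i j assume "i < dim_row (rdiag k (\<lambda>i. x i * d i * y i))" "j < dim_col (rdiag k (\<lambda>i. x i * d i * y i))"
    then have ij: "i < k" "j < k" by auto
    have 1: "(adj (J x) * rdiag l d) $$ (i,m) = (if i = m then of_real (x i * d i) else 0)" if "m < l" for m
      unfolding rdiag_cdiag using ij that k adj_carrier[OF J]
      by (subst index_mult_cdiag[of _ k l]) (auto simp: Ji carrier_matD[OF J])
    have "(adj (J x) * rdiag l d * J y) $$ (i,j)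
        = (\<Sum>m<l. (adj (J x) * rdiag l d) $$ (i,m) * J y $$ (m,j))"
      using ij J adj_carrier[OF J] by (intro index_mult_sum[of _ k l _ k] mult_carrier_mat[of _ k l]) auto
    also have "\<dots> = (\<Sum>m<l. if m = i then (if i = j then of_real (x i * d i * y i) else 0) else 0)"
      using ij k by (intro sum.cong refl) (auto simp: 1 Ji simp del: index_mult_mat(1))
    also have "\<dots> = rdiag k (\<lambda>i. x i * d i * y i) $$ (i,j)"
      using ij k by (simp add: rdiag_cdiag)
    finally show "(adj (J x) * rdiag l d * J y) $$ (i,j) = rdiag k (\<lambda>i. x i * d i * y i) $$ (i,j)" .
  qed (use J in auto)
  have one: "rdiag i (\<lambda>_. 1) = 1\<^sub>m i" for i by (simp add: rdiag_cdiag cdiag_one)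
  \<comment> \<open>In the bases \<open>T\<close> and \<open>adj T'\<close> the pair is the identity
    and \<open>z0 = w^(a + b)\<close>. The inverse weights \<open>w^(a/2)\<close> and
    \<open>w^(-a/2)\<close> keep the compressions dual and redistribute this pair as
    \<open>w^a\<close> and \<open>w^b\<close>, the form that Young's inequality expects.\<close>
  define V where "V = T * J (\<lambda>j. w j powr (a/2))"
  define W where "W = adj T' * J (\<lambda>j. w j powr (- a/2))"
  have V: "V \<in> carrier_mat l k" and W: "W \<in> carrier_mat l k"
    unfolding V_def W_def using T aT J by (auto intro: mult_carrier_mat)
  have sandwich: "adj (M * J x) * N * (M' * J y) = adj (J x) * (adj M * N * M') * J y"
    if "M \<in> carrier_mat l l" "M' \<in> carrier_mat l l" "N \<in> carrier_mat l l" for M M' N x y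
    using that J adj_carrier[OF J] adj_carrier[OF that(1)]
    by (simp add: adj_mult[of _ l l _ k] assoc_mult_mat[of _ k l _ l _ l] assoc_mult_mat[of _ k l _ l _ k]
        assoc_mult_mat[of _ l l _ l _ k] mult_assoc_sq[of _ l] mult_carrier_mat[of _ l l _ l]
        mult_carrier_mat[of _ k l _ l] mult_carrier_mat[of _ l l _ k])
  have rdiag_cong: "rdiag k x = rdiag k y" if "\<And>j. j < k \<Longrightarrow> x j = y j" for x y
    unfolding rdiag_cdiag by (rule cdiag_cong) (simp add: that)
  have s_ab: "s * (a + b) = 1" using s ab by simp
  have zw: "z0 j = w j powr (a + b)" if "j < k" for j
    unfolding w_def powr_powr s_ab using z0[of j] that k by simp
  have WV: "adj W * V = 1\<^sub>m k"
  proof -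
    have "adj W * V = adj W * 1\<^sub>m l * V" unfolding right_mult_one_mat[OF adj_carrier[OF W]] ..
    also have "\<dots> = adj (J (\<lambda>j. w j powr (- a/2))) * rdiag l (\<lambda>_. 1) * J (\<lambda>j. w j powr (a/2))"
      unfolding V_def W_def using T aT TT by (subst sandwich) (auto simp: one)
    also have "\<dots> = rdiag k (\<lambda>_. 1)"
      unfolding Jd using w by (intro rdiag_cong) (force simp flip: powr_add)
    finally show ?thesis by (simp add: one)
  qed
  have VX: "adj V * ?X * V = rdiag k (\<lambda>j. w j powr a)"
  proof -
    have "adj V * ?X * V = adj (J (\<lambda>j. w j powr (a/2))) * rdiag l (\<lambda>_. 1) * J (\<lambda>j. w j powr (a/2))"
      unfolding V_def using sandwich[OF T(1) T(1) X] TX by (simp add: one)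
    also have "\<dots> = rdiag k (\<lambda>j. w j powr a)"
      unfolding Jd by (intro rdiag_cong) (simp flip: powr_add)
    finally show ?thesis .
  qed
  have WY: "adj W * ?Y * W = rdiag k (\<lambda>j. w j powr b)"
  proof -
    have "adj W * ?Y * W = adj (J (\<lambda>j. w j powr (- a/2))) * rdiag l z0 * J (\<lambda>j. w j powr (- a/2))"
      unfolding W_def using sandwich[OF aT(2) aT(2) Y] TY by simp
    also have "\<dots> = rdiag k (\<lambda>j. w j powr b)"
      unfolding Jd by (intro rdiag_cong) (simp add: zw flip: powr_add)
    finally show ?thesis .
  qed
  from compressed_variational[OF \<Phi> \<Psi> A(1) B(1) ab s ps1 XY1 z1 X1 Y1 V W WV k]
  obtain \<tau>1 ZX1 ZY1 where 1: "pd k ZX1" "pd k ZY1" "mtrace ZX1 = of_real \<tau>1" "mtrace ZY1 = of_real \<tau>1"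
    "(\<Sum>j<k. z1 j powr s) \<le> \<tau>1"
    "2 * \<tau>1 \<le> Re (mtrace (adj V * \<Phi> (cpow n A1 (of_real a)) * V * cpow k ZX1 (of_real (1 - a))))
       + Re (mtrace (adj W * \<Psi> (cpow m B1 (of_real b)) * W * cpow k ZY1 (of_real (1 - b))))"
    by blast
  from compressed_variational[OF \<Phi> \<Psi> A(2) B(2) ab s ps2 XY2 z2 X2 Y2 V W WV k]
  obtain \<tau>2 ZX2 ZY2 where 2: "pd k ZX2" "pd k ZY2" "mtrace ZX2 = of_real \<tau>2" "mtrace ZY2 = of_real \<tau>2"
    "(\<Sum>j<k. z2 j powr s) \<le> \<tau>2"
    "2 * \<tau>2 \<le> Re (mtrace (adj V * \<Phi> (cpow n A2 (of_real a)) * V * cpow k ZX2 (of_real (1 - a))))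
       + Re (mtrace (adj W * \<Psi> (cpow m B2 (of_real b)) * W * cpow k ZY2 (of_real (1 - b))))"
    by blast
  define \<tau> where "\<tau> = t * \<tau>1 + (1 - t) * \<tau>2"
  define GX where "GX = complex_of_real t \<cdot>\<^sub>m ZX1 + complex_of_real (1 - t) \<cdot>\<^sub>m ZX2"
  define GY where "GY = complex_of_real t \<cdot>\<^sub>m ZY1 + complex_of_real (1 - t) \<cdot>\<^sub>m ZY2"
  have pdE: "pd k GX" "pd k GY" unfolding GX_def GY_def by (intro pd_convex 1 2 t)+
  have trE: "Re (mtrace GX) = \<tau>" "Re (mtrace GY) = \<tau>"
    unfolding GX_def GY_def \<tau>_def using 1 2
    by (simp_all add: mtrace_add[of _ k] mtrace_smult[of _ k] pd_carrier)
  define \<sigma> where "\<sigma> = (\<Sum>j<k. w j)"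
  note lX = lieb_concavity[OF positive_bilinear_mtrace[OF \<Phi> V] A 1(1) 2(1) t a C GX_def]
  note lY = lieb_concavity[OF positive_bilinear_mtrace[OF \<Psi> W] B 1(2) 2(2) t b D GY_def]
  have yX: "Re (mtrace (adj V * ?X * V * cpow k GX (of_real (1 - a)))) \<le> a * \<sigma> + (1 - a) * \<tau>"
    unfolding VX \<sigma>_def trE(1)[symmetric] by (intro mtrace_rdiag_cpow_le pdE w a)
  have yY: "Re (mtrace (adj W * ?Y * W * cpow k GY (of_real (1 - b)))) \<le> b * \<sigma> + (1 - b) * \<tau>"
    unfolding WY \<sigma>_def trE(2)[symmetric] by (intro mtrace_rdiag_cpow_le pdE w b)
  have "2 * \<tau> = t * (2 * \<tau>1) + (1 - t) * (2 * \<tau>2)" by (simp add: \<tau>_def algebra_simps)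
  also have "\<dots> \<le> t * (Re (mtrace (adj V * \<Phi> (cpow n A1 (of_real a)) * V * cpow k ZX1 (of_real (1 - a))))
       + Re (mtrace (adj W * \<Psi> (cpow m B1 (of_real b)) * W * cpow k ZY1 (of_real (1 - b)))))
     + (1 - t) * (Re (mtrace (adj V * \<Phi> (cpow n A2 (of_real a)) * V * cpow k ZX2 (of_real (1 - a))))
       + Re (mtrace (adj W * \<Psi> (cpow m B2 (of_real b)) * W * cpow k ZY2 (of_real (1 - b)))))"
    using t by (intro add_mono mult_left_mono 1 2) auto
  also have "\<dots> \<le> (a * \<sigma> + (1 - a) * \<tau>) + (b * \<sigma> + (1 - b) * \<tau>)"
    using order_trans[OF lX yX] order_trans[OF lY yY] by (simp add: algebra_simps)
  \<comment> \<open>\<tau> stands on both sides, with coefficient two on the left and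
    \<open>2 - a - b\<close> on the right; the difference \<open>a + b\<close> is positive.\<close>
  finally have "(a + b) * \<tau> \<le> (a + b) * \<sigma>" by (simp add: algebra_simps)
  then have "\<tau> \<le> \<sigma>" using ab by simp
  moreover have "t * (\<Sum>j<k. z1 j powr s) + (1 - t) * (\<Sum>j<k. z2 j powr s) \<le> \<tau>"
    unfolding \<tau>_def using t by (intro add_mono mult_left_mono 1 2) auto
  ultimately show ?thesis by (simp add: \<sigma>_def w_def)
qed

subsection \<open>Linear majorants of the inverse of a positive map\<close>

text \<open>Choi's inequality bounds \<open>\<Phi>(E) * \<Phi>(R^-1)^-1 * \<Phi>(E)\<close> by
  \<open>\<Phi>(E * R * E)\<close>. Multiplying by the inverse of \<open>\<Phi>(E)\<close> on both
  sides yields this upper bound for the inverse of \<open>\<Phi>(R^-1)\<close>. It is linear in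
  \<open>R\<close> for fixed \<open>E\<close> and attained where \<open>R\<close> is the inverse of
  \<open>E\<close>.\<close>

definition inverse_majorant :: "nat \<Rightarrow> (complex mat \<Rightarrow> complex mat) \<Rightarrow> complex mat \<Rightarrow> complex mat \<Rightarrow> complex mat" where
  "inverse_majorant l \<Phi> E R = cpow l (\<Phi> E) (-1) * \<Phi> (E * R * E) * cpow l (\<Phi> E) (-1)"

lemma pd_inverse:
  assumes "pd k X"
  shows "pd k (cpow k X (-1))" "adj (cpow k X (-1)) = cpow k X (-1)"
    "cpow k X (-1) * X = 1\<^sub>m k" "X * cpow k X (-1) = 1\<^sub>m k"
  using pd_cpow[OF assms, of "-1"] cpow_mult[OF assms, of "-1" 1] cpow_mult[OF assms, of 1 "-1"]
  by (simp_all add: adj_cpow[OF assms] cpow_1[OF assms] cpow_0[OF assms])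

lemma pd_hermitian_congruence:
  assumes E: "pd k E" and R: "pd k R" shows "pd k (E * R * E)"
  using pd_congruence[OF pd_carrier[OF E] cpow_carrier[OF E] pd_inverse(3)[OF E] R]
  by (simp add: hermitian_adj[OF pd_hermitian[OF E]])

lemma strictly_positive_inverse_majorant:
  assumes \<Phi>: "strictly_positive_map n l \<Phi>" and E: "pd n E"
  shows "strictly_positive_map n l (inverse_majorant l \<Phi> E)"
proof -
  note lin = strictly_positive_map_linear[OF \<Phi>]
  note N = pd_inverse(1)[OF strictly_positive_map_pd[OF \<Phi> E]]
  note Ec = pd_carrier[OF E] and Nc = pd_carrier[OF N]
  have "Defs.linear_map n l (inverse_majorant l \<Phi> E)"
    unfolding Defs.linear_map_def inverse_majorant_def using Ec Nc
    by (auto simp: lin mult_add_distrib_mat[of _ n n _ n] add_mult_distrib_mat[of _ n n _ _ n]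
        mult_add_distrib_mat[of _ l l _ l] add_mult_distrib_mat[of _ l l _ _ l]
        mult_smult_distrib[of _ n n _ n] mult_smult_assoc_mat[of _ n n _ n]
        mult_smult_distrib[of _ l l _ l] mult_smult_assoc_mat[of _ l l _ l]
        mult_carrier_mat[of _ n n _ n] mult_carrier_mat[of _ l l _ l])
  then show ?thesis
    unfolding strictly_positive_map_def inverse_majorant_def
    using pd_hermitian_congruence[OF E] pd_hermitian_congruence[OF N] strictly_positive_map_pd[OF \<Phi>] by blast
qed

lemma inverse_majorant_eq:
  assumes \<Phi>: "strictly_positive_map n l \<Phi>" and E: "pd n E"
  shows "inverse_majorant l \<Phi> E (cpow n E (-1)) = cpow l (\<Phi> E) (-1)"
proof -
  note PE = strictly_positive_map_pd[OF \<Phi> E]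
  have "E * cpow n E (-1) * E = E" using pd_inverse(4)[OF E] pd_carrier[OF E] by simp
  then show ?thesis
    using pd_inverse(3)[OF PE] E PE by (simp add: inverse_majorant_def left_mult_one_mat[of _ l l])
qed

section \<open>Choi's inequality in terms of sesquilinear forms\<close>

definition bform :: "nat \<Rightarrow> complex mat \<Rightarrow> (nat \<Rightarrow> complex) \<Rightarrow> (nat \<Rightarrow> complex) \<Rightarrow> complex" where
  "bform k A u v = (\<Sum>i<k. \<Sum>j<k. cnj (u i) * A $$ (i,j) * v j)"

lemma bform_mv: "bform k A u v = (\<Sum>i<k. cnj (u i) * mv k A v i)"
  by (simp add: bform_def mv_def sum_distrib_left mult.assoc)

lemma qform_bform: "qform k A v = bform k A v v"
  by (simp add: qform_def bform_def)

lemma linear_bform: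
  assumes \<Phi>: "strictly_positive_map n l \<Phi>" and K: "K \<in> carrier_mat n n"
  shows "linear_fun n (\<lambda>X. bform l (\<Phi> (K * X * K)) u v)"
  unfolding linear_fun_def
proof (intro conjI ballI allI)
  note lin = strictly_positive_map_linear[OF \<Phi>]
  have add: "bform l (S + S') u v = bform l S u v + bform l S' u v"
    if "S \<in> carrier_mat l l" "S' \<in> carrier_mat l l" for S S'
    unfolding bform_def sum.distrib[symmetric] using that by (intro sum.cong refl) (simp add: algebra_simps)
  have smult: "bform l (c \<cdot>\<^sub>m S) u v = c * bform l S u v" if "S \<in> carrier_mat l l" for S c
    unfolding bform_def sum_distrib_left using that by (intro sum.cong refl) (simp add: algebra_simps)
  fix X :: "complex mat" assume X: "X \<in> carrier_mat n n"
  show "bform l (\<Phi> (K * (c \<cdot>\<^sub>m X) * K)) u v = c * bform l (\<Phi> (K * X * K)) u v" for c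
    using X K by (simp add: lin smult mult_smult_distrib[of _ n n _ n] mult_smult_assoc_mat[of _ n n _ n]
        mult_carrier_mat[of _ n n _ n])
  fix Y :: "complex mat" assume Y: "Y \<in> carrier_mat n n"
  show "bform l (\<Phi> (K * (X + Y) * K)) u v = bform l (\<Phi> (K * X * K)) u v + bform l (\<Phi> (K * Y * K)) u v"
    using X Y K by (simp add: lin add mult_add_distrib_mat[of _ n n _ n] add_mult_distrib_mat[of _ n n _ _ n]
        mult_carrier_mat[of _ n n _ n])
qed

text \<open>Positivity of the form at \<open>u - \<mu> * v\<close>, divided by \<mu>. The weight is
  kept because it will be a different eigenvalue for each spectral projection.\<close>

lemma psd_bform_discriminant:
  assumes S: "psd k S" and \<mu>: "0 < (\<mu>::real)"
  shows "2 * Re (bform k S u v) \<le> Re (bform k S u u) / \<mu> + \<mu> * Re (bform k S v v)"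
proof -
  have sym: "Re (bform k S v u) = Re (bform k S u v)"
  proof -
    have "cnj (bform k S v u) = (\<Sum>i<k. \<Sum>j<k. cnj (u j) * S $$ (j,i) * v i)"
      unfolding bform_def by (auto simp: hermitian_index[OF psd_hermitian[OF S]] algebra_simps intro!: sum.cong)
    also have "\<dots> = bform k S u v" unfolding bform_def by (rule sum.swap)
    finally show ?thesis by (metis cnj.simps(1))
  qed
  have "0 \<le> Re (qform k S (\<lambda>i. u i - of_real \<mu> * v i))" using S by (simp add: psd_def)
  also have "qform k S (\<lambda>i. u i - of_real \<mu> * v i)
      = bform k S u u - of_real \<mu> * bform k S u v - of_real \<mu> * bform k S v u + of_real \<mu> * (of_real \<mu> * bform k S v v)"
    unfolding qform_def bform_def sum_distrib_left sum.distrib[symmetric] sum_subtractf[symmetric]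
    by (intro sum.cong refl) (simp add: algebra_simps)
  finally have "2 * \<mu> * Re (bform k S u v) \<le> Re (bform k S u u) + \<mu> * (\<mu> * Re (bform k S v v))"
    using sym by simp
  then show ?thesis using \<mu> by (simp add: field_simps)
qed

text \<open>A form of Choi's operator Schwarz inequality. A positive map preserves positivity of
  2-by-2 blocks here because \<open>E\<^sup>\<half> P E\<^sup>\<half>\<close> and its inverse commute.\<close>

lemma positive_map_block:
  assumes \<Phi>: "strictly_positive_map n l \<Phi>" and E: "pd n E" and P: "pd n P"
  shows "2 * Re (bform l (\<Phi> E) u v)
    \<le> Re (bform l (\<Phi> (cpow n P (-1))) u u) + Re (bform l (\<Phi> (E * P * E)) v v)"
proof -
  let ?K = "cpow n E (1/2)"
  note K = cpow_carrier[OF E, of "1/2"]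
  note sq = mult_carrier_mat[of _ n n _ n] mult_assoc_sq[of _ n] cpow_mult[OF E] cpow_mult_assoc[OF E, of _ n]
    left_mult_one_mat[of _ n n] right_mult_one_mat[of _ n n]
  note [simp] = E P pd_carrier[OF P] pd_carrier[OF E]
  define M where "M = ?K * P * ?K"
  have pM: "pd n M" unfolding M_def by (rule pd_sandwich[OF E P])
  obtain W \<mu> where dec: "udec n W \<mu> M" using hermitian_udec[OF pd_hermitian[OF pM]] by auto
  note \<mu> = udec_pd[OF dec pM] and Wc = unitary_carrier[OF udec_unitary[OF dec]]
  define Q where "Q j = \<Phi> (?K * rank_one n W j * ?K)" for j
  have Q: "psd l (Q j)" for j
    using psd_congruence[OF K psd_rank_one[OF Wc], of j] unfolding Q_def pd_half(2)[OF E]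
    by (rule strictly_positive_map_psd[OF \<Phi>])
  \<comment> \<open>\<open>E\<close>, \<open>E * P * E\<close> and the inverse of \<open>P\<close>
    all have the shape expanded here, with diagonals \<open>1\<close>, \<open>\<mu>\<close> and
    \<open>1 / \<mu>\<close>. The claim thereby splits into one scalar-weighted inequality for each
    positive semidefinite \<open>Q j\<close>.\<close>
  have expand: "bform l (\<Phi> (?K * (W * rdiag n d * adj W) * ?K)) x y = (\<Sum>j<n. of_real (d j) * bform l (Q j) x y)" for d x y
    unfolding rdiag_cdiag linear_fun_conjugate_cdiag[OF linear_bform[OF \<Phi> K] Wc] Q_def ..
  have e1: "E = ?K * (W * rdiag n (\<lambda>_. 1) * adj W) * ?K"
    using udec_unitary[OF dec] Wc
    by (simp add: rdiag_cdiag cdiag_one unitary_def sq cpow_1)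
  have e2: "E * P * E = ?K * (W * rdiag n \<mu> * adj W) * ?K"
  proof -
    have "?K * (W * rdiag n \<mu> * adj W) * ?K = ?K * M * ?K" using dec by (simp add: udec_def)
    also have "\<dots> = E * P * E"
      using cpow_mult_assoc[OF E, of _ n "1/2" "1/2"] unfolding M_def by (simp add: sq cpow_1)
    finally show ?thesis by simp
  qed
  have e3: "cpow n P (-1) = ?K * (W * rdiag n (\<lambda>j. 1 / \<mu> j) * adj W) * ?K"
  proof -
    have "rdiag n (\<lambda>j. \<mu> j powr (-1)) = rdiag n (\<lambda>j. 1 / \<mu> j)"
      unfolding rdiag_cdiag using \<mu> by (intro cdiag_cong) (force simp: powr_minus_divide)
    then have Mi: "W * rdiag n (\<lambda>j. 1 / \<mu> j) * adj W = cpow n M (-1)"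
      using udec_cpow[OF pM dec, of "-1"] by (simp add: udec_def)
    have "P * (?K * cpow n M (-1) * ?K) = cpow n E (-1/2) * (M * cpow n M (-1)) * ?K"
      unfolding M_def using pM[unfolded M_def] by (simp add: sq cpow_0)
    also have "\<dots> = 1\<^sub>m n" by (simp add: pd_inverse(4)[OF pM] sq cpow_0)
    finally have "cpow n P (-1) * (P * (?K * cpow n M (-1) * ?K)) = cpow n P (-1)" by (simp add: sq)
    then show ?thesis
      unfolding Mi using pM by (simp add: mult_cancel_inverse[of _ n _ _ n, OF _ _ _ pd_inverse(3)[OF P]] sq)
  qed
  have "2 * Re (bform l (\<Phi> E) u v) = (\<Sum>j<n. 2 * Re (bform l (Q j) u v))"
    by (subst e1, subst expand) (simp add: sum_distrib_left)
  also have "\<dots> \<le> (\<Sum>j<n. Re (bform l (Q j) u u) / \<mu> j + \<mu> j * Re (bform l (Q j) v v))"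
    by (intro sum_mono psd_bform_discriminant Q \<mu>) simp
  also have "\<dots> = Re (bform l (\<Phi> (cpow n P (-1))) u u) + Re (bform l (\<Phi> (E * P * E)) v v)"
    unfolding e2 e3 expand by (simp add: sum.distrib)
  finally show ?thesis .
qed

lemma inverse_majorant_ge:
  assumes \<Phi>: "strictly_positive_map n l \<Phi>" and E: "pd n E" and P: "pd n P"
  shows "Re (qform l (cpow l (\<Phi> (cpow n P (-1))) (-1)) v) \<le> Re (qform l (inverse_majorant l \<Phi> E P) v)"
proof -
  let ?X = "\<Phi> (cpow n P (-1))" and ?N = "cpow l (\<Phi> E) (-1)" and ?Y = "\<Phi> (E * P * E)"
  have X: "pd l ?X" by (intro strictly_positive_map_pd[OF \<Phi>] pd_inverse(1)[OF P])
  have PE: "pd l (\<Phi> E)" by (intro strictly_positive_map_pd[OF \<Phi>] E)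
  have Y: "?Y \<in> carrier_mat l l"
    by (intro pd_carrier strictly_positive_map_pd[OF \<Phi>] pd_hermitian_congruence E P)
  note Xc = pd_carrier[OF X] and Ic = cpow_carrier[OF X, of "-1"] and Nc = cpow_carrier[OF PE, of "-1"]
  \<comment> \<open>With these vectors the mixed term and the first square term are both equal to
    the left-hand side, so the factor two in the block inequality leaves exactly one copy of
    it.\<close>
  let ?u = "mv l (cpow l ?X (-1)) v" and ?w = "mv l ?N v"
  have "adj (cpow l ?X (-1)) * ?X * cpow l ?X (-1) = cpow l ?X (-1)"
    using pd_inverse[OF X] left_mult_one_mat[OF Ic] by simp
  then have 1: "bform l ?X ?u ?u = qform l (cpow l ?X (-1)) v"
    using qform_congruence_mv[OF Ic Xc, of v] by (simp add: qform_bform)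
  have 2: "bform l ?Y ?w ?w = qform l (inverse_majorant l \<Phi> E P) v"
    using qform_congruence_mv[OF Nc Y, of v] by (simp add: qform_bform inverse_majorant_def pd_inverse(2)[OF PE])
  have "bform l (\<Phi> E) ?u ?w = (\<Sum>i<l. cnj (?u i) * mv l (\<Phi> E * ?N) v i)"
    unfolding bform_mv using mv_mult[OF pd_carrier[OF PE] Nc] by (intro sum.cong refl) auto
  also have "\<dots> = (\<Sum>i<l. cnj (?u i) * v i)"
    unfolding pd_inverse(4)[OF PE] by (intro sum.cong refl) (simp add: mv_one)
  also have "\<dots> = qform l (cpow l ?X (-1)) v"
    unfolding mv_adj[OF Ic] pd_inverse(2)[OF X] qform_bform bform_mv ..
  finally have 3: "bform l (\<Phi> E) ?u ?w = qform l (cpow l ?X (-1)) v" .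
  show ?thesis
    using positive_map_block[OF \<Phi> E P, of ?u ?w] unfolding 1 2 3 by simp
qed

subsection \<open>Monotone concave functions of a positive variable\<close>

definition concave_increasing :: "(real \<Rightarrow> real) \<Rightarrow> bool" where
  "concave_increasing h \<longleftrightarrow> (\<forall>x y. 0 < x \<longrightarrow> x \<le> y \<longrightarrow> h x \<le> h y) \<and>
     (\<forall>x y t. 0 < x \<longrightarrow> 0 < y \<longrightarrow> 0 \<le> t \<longrightarrow> t \<le> 1 \<longrightarrow> t * h x + (1 - t) * h y \<le> h (t * x + (1 - t) * y))"

lemma convex_combination_pos:
  fixes t x y :: real
  assumes "0 \<le> t" "t \<le> 1" "0 < x" "0 < y" shows "0 < t * x + (1 - t) * y"
  using assms by (cases "t = 0") (auto intro!: add_pos_nonneg mult_pos_pos mult_nonneg_nonneg simp: less_imp_le)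

text \<open>No continuity of \<open>h\<close> is assumed, so \<epsilon> cannot simply tend to zero.
  Instead both points are moved left by \<delta>, and taking \<open>\<epsilon> = \<delta>\<close>
  moves their average back. The cost is a drop of \<open>h\<close> to the left, which the same
  hypothesis shows to be at most linear in \<delta>.\<close>

lemma concave_increasing_approx:
  assumes mono: "\<And>x y. 0 < x \<Longrightarrow> x \<le> y \<Longrightarrow> h x \<le> h y"
    and approx: "\<And>x y t \<epsilon>. 0 < x \<Longrightarrow> 0 < y \<Longrightarrow> 0 \<le> t \<Longrightarrow> t \<le> 1 \<Longrightarrow> 0 < \<epsilon> \<Longrightarrow>
      t * h x + (1 - t) * h y \<le> h (t * x + (1 - t) * y + \<epsilon>)"
  shows "concave_increasing h"
  unfolding concave_increasing_def
proof (intro conjI allI impI)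
  show "h x \<le> h y" if "0 < x" "x \<le> y" for x y by (rule mono[OF that])
  fix x y t :: real assume x: "0 < x" and y: "0 < y" and t: "0 \<le> t" "t \<le> 1"
  have left: "\<exists>K. \<forall>\<delta>. 0 < \<delta> \<longrightarrow> \<delta> < z / 4 \<longrightarrow> h z - \<delta> * K \<le> h (z - \<delta>)" if z: "0 < z" for z
  proof (intro exI[of _ "4 / z * (h z - h (z/2))"] allI impI)
    fix \<delta> assume \<delta>: "0 < \<delta>" "\<delta> < z / 4"
    \<comment> \<open>With this weight the combination of \<open>z/2\<close> and \<open>z\<close> is
      \<open>z - 2 * \<delta>\<close>, and the additional \<open>\<epsilon> = \<delta>\<close> lands
      on \<open>z - \<delta>\<close>.\<close>
    define s where "s = 4 * \<delta> / z"
    have s: "0 \<le> s" "s \<le> 1" using \<delta> z by (auto simp: s_def field_simps)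
    have "s * h (z/2) + (1 - s) * h z \<le> h (s * (z/2) + (1 - s) * z + \<delta>)"
      using z s \<delta> by (intro approx) auto
    also have "s * (z/2) + (1 - s) * z + \<delta> = z - \<delta>" using z by (simp add: s_def field_simps)
    finally show "h z - \<delta> * (4 / z * (h z - h (z/2))) \<le> h (z - \<delta>)" by (simp add: s_def algebra_simps)
  qed
  obtain K where K: "\<And>\<delta>. 0 < \<delta> \<Longrightarrow> \<delta> < x / 4 \<Longrightarrow> h x - \<delta> * K \<le> h (x - \<delta>)" using left[OF x] by blast
  obtain L where L: "\<And>\<delta>. 0 < \<delta> \<Longrightarrow> \<delta> < y / 4 \<Longrightarrow> h y - \<delta> * L \<le> h (y - \<delta>)" using left[OF y] by blast
  let ?lhs = "t * h x + (1 - t) * h y" and ?rhs = "h (t * x + (1 - t) * y)"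
  have step: "?lhs - \<delta> * (t * K + (1 - t) * L) \<le> ?rhs" if \<delta>: "0 < \<delta>" "\<delta> < x / 4" "\<delta> < y / 4" for \<delta>
  proof -
    have "?lhs - \<delta> * (t * K + (1 - t) * L) = t * (h x - \<delta> * K) + (1 - t) * (h y - \<delta> * L)"
      by (simp add: algebra_simps)
    also have "\<dots> \<le> t * h (x - \<delta>) + (1 - t) * h (y - \<delta>)"
      using t by (intro add_mono mult_left_mono K L \<delta>) auto
    also have "\<dots> \<le> h (t * (x - \<delta>) + (1 - t) * (y - \<delta>) + \<delta>)"
      using \<delta> t x y by (intro approx) auto
    also have "t * (x - \<delta>) + (1 - t) * (y - \<delta>) + \<delta> = t * x + (1 - t) * y" by (simp add: algebra_simps)
    finally show ?thesis .
  qed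
  have "((\<lambda>\<delta>. ?lhs - \<delta> * (t * K + (1 - t) * L)) \<longlongrightarrow> ?lhs - 0 * (t * K + (1 - t) * L)) (at_right 0)"
    by (intro tendsto_intros)
  moreover have "eventually (\<lambda>\<delta>. ?lhs - \<delta> * (t * K + (1 - t) * L) \<le> ?rhs) (at_right 0)"
    using eventually_at_right_real[of 0 "min (x/4) (y/4)"] x y by (auto elim!: eventually_mono intro!: step)
  ultimately have "?lhs - 0 * (t * K + (1 - t) * L) \<le> ?rhs"
    by (intro tendsto_upperbound) auto
  then show "?lhs \<le> ?rhs" by simp
qed

lemma concave_increasing_slopes:
  assumes h: "concave_increasing h" and "0 < x" "x < y" "y < z"
  shows "(h z - h y) / (z - y) \<le> (h y - h x) / (y - x)"
proof -
  define t where "t = (z - y) / (z - x)"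
  have t: "0 \<le> t" "t \<le> 1" using assms by (auto simp: t_def field_simps)
  have tz: "t * (z - x) = z - y" using assms by (simp add: t_def)
  then have y: "y = t * x + (1 - t) * z" by (simp add: algebra_simps)
  have "t * h x + (1 - t) * h z \<le> h y"
    unfolding y using h assms(2-4) t by (auto simp: concave_increasing_def)
  then have "(t * h x + (1 - t) * h z) * (z - x) \<le> h y * (z - x)"
    using assms by (intro mult_right_mono) auto
  moreover have "(t * h x + (1 - t) * h z) * (z - x) = (t * (z - x)) * h x + ((z - x) - t * (z - x)) * h z"
    by (simp add: algebra_simps)
  ultimately have "(z - y) * h x + (y - x) * h z \<le> h y * (z - x)"
    unfolding tz by simp
  then have "(h z - h y) * (y - x) \<le> (h y - h x) * (z - y)" by (simp add: algebra_simps)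
  then show ?thesis using assms by (simp add: divide_simps mult.commute)
qed

text \<open>\<open>c\<close> is the left derivative, obtained as the infimum of the slopes to the
  left. Its sign and its monotonicity are what Abel summation will use.\<close>

lemma concave_increasing_supergradient:
  assumes h: "concave_increasing h"
  obtains c where "\<And>x y. 0 < x \<Longrightarrow> 0 < y \<Longrightarrow> h y \<le> h x + c x * (y - x)"
    "\<And>x. 0 < x \<Longrightarrow> 0 \<le> c x" "\<And>x y. 0 < x \<Longrightarrow> x \<le> y \<Longrightarrow> c y \<le> (c x :: real)"
proof -
  define S where "S x = (\<lambda>y. (h x - h y) / (x - y)) ` {0<..<x}" for x
  define c where "c x = Inf (S x)" for x
  have nn: "0 \<le> (h x - h y) / (x - y)" if "0 < y" "y < x" for x y
    using h that by (auto simp: concave_increasing_def)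
  have bdd: "bdd_below (S x)" for x unfolding S_def using nn by (intro bdd_belowI[of _ 0]) auto
  have ne: "S x \<noteq> {}" if "0 < x" for x unfolding S_def using that by simp
  have low: "c x \<le> (h x - h y) / (x - y)" if "0 < y" "y < x" for x y
    unfolding c_def using that bdd by (intro cInf_lower) (auto simp: S_def)
  have up: "m \<le> c x" if "0 < x" "\<And>y. 0 < y \<Longrightarrow> y < x \<Longrightarrow> m \<le> (h x - h y) / (x - y)" for m x
    unfolding c_def using that(2) by (intro cInf_greatest ne that(1)) (auto simp: S_def)
  have right: "(h z - h x) / (z - x) \<le> c x" if "0 < x" "x < z" for x z
    using that by (intro up concave_increasing_slopes[OF h]) auto
  show ?thesis
  proof (rule that[of c])
    fix x y :: real assume xy: "0 < x" "0 < y"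
    consider "y < x" | "y = x" | "x < y" by linarith
    then show "h y \<le> h x + c x * (y - x)"
    proof cases
      case 1
      then show ?thesis using low[OF xy(2) 1] by (simp add: field_simps)
    next
      case 3
      then show ?thesis using right[OF xy(1) 3] by (simp add: field_simps)
    qed simp
  next
    show "0 \<le> c x" if "0 < x" for x by (intro up nn that)
  next
    fix x y :: real assume "0 < x" "x \<le> y"
    then show "c y \<le> c x" using low[of x y] right[of x y] by (cases "x = y") auto
  qed
qed

section \<open>Abel summation and weak majorization\<close>

lemma sum_antimono_weights_nonpos:
  fixes c x :: "nat \<Rightarrow> real"
  assumes "\<And>i. i < l \<Longrightarrow> 0 \<le> c i" "\<And>i j. i \<le> j \<Longrightarrow> j < l \<Longrightarrow> c j \<le> c i"
    and "\<And>k. k \<le> l \<Longrightarrow> (\<Sum>j<k. x j) \<le> 0"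
  shows "(\<Sum>j<l. c j * x j) \<le> 0"
proof -
  \<comment> \<open>\<open>c (k - 1)\<close> is the weight of the last summand. Passing to the
    smaller weight \<open>c k\<close> raises the bound, as the partial sum is nonpositive; for
    \<open>k = 0\<close> both sums are empty.\<close>
  have "(\<Sum>j<k. c j * x j) \<le> c (k - 1) * (\<Sum>j<k. x j)" if "k \<le> l" for k
    using that
  proof (induction k)
    case (Suc k)
    have "(\<Sum>j<k. c j * x j) \<le> c (k - 1) * (\<Sum>j<k. x j)" using Suc by simp
    also have "\<dots> \<le> c k * (\<Sum>j<k. x j)"
      using Suc.prems assms(2)[of "k - 1" k] assms(3)[of k] by (intro mult_right_mono_neg) auto
    finally show ?case by (simp add: algebra_simps)
  qed simp
  from this[of l] show ?thesis
    using assms(1)[of "l - 1"] assms(3)[of l] by (cases "l = 0") (auto simp: mult_nonneg_nonpos intro: order_trans)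
qed

text \<open>Linearizing \<open>h\<close> at \<open>w j\<close> leaves the sum of
  \<open>c (w j) * (v j - w j)\<close>. As \<open>w\<close> is sorted increasingly, the weights
  decrease, and Abel summation makes this sum nonpositive.\<close>

lemma concave_increasing_majorization:
  fixes l :: nat
  assumes h: "concave_increasing h"
    and v: "\<And>j. j < l \<Longrightarrow> 0 < v j" and w: "\<And>j. j < l \<Longrightarrow> 0 < w j"
    and sorted: "\<And>i j. i \<le> j \<Longrightarrow> j < l \<Longrightarrow> w i \<le> w j"
    and le: "\<And>k. k \<le> l \<Longrightarrow> (\<Sum>j<k. v j) \<le> (\<Sum>j<k. w j)"
  shows "(\<Sum>j<l. h (v j)) \<le> (\<Sum>j<l. h (w j))"
proof -
  obtain c where c: "\<And>x y. 0 < x \<Longrightarrow> 0 < y \<Longrightarrow> h y \<le> h x + c x * (y - x)"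
    "\<And>x. 0 < x \<Longrightarrow> 0 \<le> c x" "\<And>x y. 0 < x \<Longrightarrow> x \<le> y \<Longrightarrow> c y \<le> c x"
    using concave_increasing_supergradient[OF h] by blast
  have "(\<Sum>j<l. h (v j)) \<le> (\<Sum>j<l. h (w j) + c (w j) * (v j - w j))"
    using v w by (intro sum_mono c(1)) auto
  also have "\<dots> = (\<Sum>j<l. h (w j)) + (\<Sum>j<l. c (w j) * (v j - w j))" by (rule sum.distrib)
  also have "(\<Sum>j<l. c (w j) * (v j - w j)) \<le> 0"
  proof (rule sum_antimono_weights_nonpos[where c="\<lambda>j. c (w j)" and x="\<lambda>j. v j - w j"])
    show "(\<Sum>j<k. v j - w j) \<le> 0" if "k \<le> l" for k using le[OF that] by (simp add: sum_subtractf)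
    show "c (w j) \<le> c (w i)" if "i \<le> j" "j < l" for i j using sorted[OF that] w that by (intro c(3)) auto
  qed (use c(2) w in auto)
  finally show ?thesis by simp
qed

lemma concave_increasing_sums:
  fixes l :: nat
  assumes h: "concave_increasing h" and t: "0 \<le> t" "t \<le> 1"
    and v1: "\<And>j. j < l \<Longrightarrow> 0 < v1 j" and v2: "\<And>j. j < l \<Longrightarrow> 0 < v2 j" and w: "\<And>j. j < l \<Longrightarrow> 0 < w j"
    and sorted: "\<And>i j. i \<le> j \<Longrightarrow> j < l \<Longrightarrow> w i \<le> w j"
    and le: "\<And>k. k \<le> l \<Longrightarrow> t * (\<Sum>j<k. v1 j) + (1 - t) * (\<Sum>j<k. v2 j) \<le> (\<Sum>j<k. w j)"
  shows "t * (\<Sum>j<l. h (v1 j)) + (1 - t) * (\<Sum>j<l. h (v2 j)) \<le> (\<Sum>j<l. h (w j))"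
proof -
  have "t * (\<Sum>j<l. h (v1 j)) + (1 - t) * (\<Sum>j<l. h (v2 j)) = (\<Sum>j<l. t * h (v1 j) + (1 - t) * h (v2 j))"
    by (simp add: sum.distrib sum_distrib_left)
  also have "\<dots> \<le> (\<Sum>j<l. h (t * v1 j + (1 - t) * v2 j))"
    using h t v1 v2 by (intro sum_mono) (simp add: concave_increasing_def)
  also have "\<dots> \<le> (\<Sum>j<l. h (w j))"
  proof (rule concave_increasing_majorization[OF h _ w sorted])
    show "0 < t * v1 j + (1 - t) * v2 j" if "j < l" for j
      by (rule convex_combination_pos[OF t v1[OF that] v2[OF that]])
    show "(\<Sum>j<k. t * v1 j + (1 - t) * v2 j) \<le> (\<Sum>j<k. w j)" if "k \<le> l" for k
      using le[OF that] by (simp add: sum.distrib sum_distrib_left)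
  qed
  finally show ?thesis .
qed

subsection \<open>Operator monotone functions are monotone and concave\<close>

lemma udec_rdiag: "udec k (1\<^sub>m k) d (rdiag k d)"
  by (simp add: udec_def unitary_def)

lemma mat_fun_rdiag: "mat_fun k h (rdiag k d) = rdiag k (h \<circ> d)"
  using mat_fun_udec[OF udec_rdiag] by simp

lemma psd_diagonal: assumes "psd k M" "i < k" shows "0 \<le> Re (M $$ (i,i))"
proof -
  have "qform k M (\<lambda>j. if j = i then 1 else 0) = (\<Sum>a<k. if a = i then \<Sum>b<k. if b = i then M $$ (a,b) else 0 else 0)"
    unfolding qform_def
    by (intro sum.cong refl) (auto simp: if_distrib[of "\<lambda>x. _ * x"] cong: if_cong)
  also have "\<dots> = M $$ (i,i)" using assms(2) by simp
  finally show ?thesis using assms(1) by (metis psd_def)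
qed

lemma operator_monotone_mono:
  assumes h: "operator_monotone h" and xy: "0 < x" "x \<le> y"
  shows "h x \<le> h y"
proof -
  have "rdiag 1 (\<lambda>_. y) - rdiag 1 (\<lambda>_. x) = rdiag 1 (\<lambda>_. y - x)"
    by (rule eq_matI) (auto simp: rdiag_cdiag)
  then have "loewner_le 1 (rdiag 1 (\<lambda>_. x)) (rdiag 1 (\<lambda>_. y))"
    using xy by (simp add: loewner_le_def hermitian_rdiag psd_rdiag)
  then have "loewner_le 1 (mat_fun 1 h (rdiag 1 (\<lambda>_. x))) (mat_fun 1 h (rdiag 1 (\<lambda>_. y)))"
    using h xy unfolding operator_monotone_def by (metis less_le_trans pd_rdiag)
  then have "psd 1 (rdiag 1 (\<lambda>_. h y) - rdiag 1 (\<lambda>_. h x))"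
    by (simp add: loewner_le_def mat_fun_rdiag o_def)
  from psd_diagonal[OF this, of 0] show ?thesis by (simp add: rdiag_cdiag)
qed

text \<open>Rotating \<open>diag(x, y)\<close> by an angle with squared cosine \<open>t\<close> puts \<open>t * x + (1 - t) * y\<close> in
  the corner. The off-diagonal entry is absorbed at the price of \<open>\<epsilon>\<close> by a diagonal majorant.\<close>

lemma operator_monotone_approx_concave:
  assumes h: "operator_monotone h" and x: "0 < x" and y: "0 < y" and t: "0 \<le> t" "t \<le> 1" and \<epsilon>: "0 < \<epsilon>"
  shows "t * h x + (1 - t) * h y \<le> h (t * x + (1 - t) * y + \<epsilon>)"
proof -
  define a where "a = sqrt t"
  define b where "b = sqrt (1 - t)"
  have a2: "a * a = t" and b2: "b * b = 1 - t" using t by (simp_all add: a_def b_def)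
  define e where "e = a * b * (y - x)"
  define d where "d i = (if i = 0 then x else y)" for i :: nat
  define \<alpha> where "\<alpha> = t * x + (1 - t) * y + \<epsilon>"
  \<comment> \<open>\<open>e\<close> is the off-diagonal entry of \<open>A\<close>. The surplus
    \<open>e^2 / \<epsilon>\<close> makes the difference of the diagonal majorant and
    \<open>A\<close> a rank-one matrix, built from the vector with entries
    \<open>sqrt \<epsilon>\<close> and \<open>- e / sqrt \<epsilon>\<close>.\<close>
  define \<beta> where "\<beta> = (1 - t) * x + t * y + e\<^sup>2 / \<epsilon>"
  define g where "g i = (if i = 0 then \<alpha> else \<beta>)" for i :: nat
  define c where "c i j = (if i = j then a else if i = 0 then b else - b)" for i j :: nat
  define U where "U = mat 2 2 (\<lambda>(i,j). complex_of_real (c i j))"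
  define A where "A = U * rdiag 2 d * adj U"
  have less2: "i < 2 \<longleftrightarrow> i = 0 \<or> i = (1::nat)" for i by auto
  have sum2: "(\<Sum>k<2. F k) = F 0 + F (1::nat)" for F :: "nat \<Rightarrow> complex"
    by (simp add: numeral_2_eq_2)
  have Uc: "U \<in> carrier_mat 2 2" by (simp add: U_def)
  have U: "unitary 2 U"
  proof (rule unitaryI[OF Uc], rule eq_matI)
    fix i j assume "i < dim_row (1\<^sub>m 2 :: complex mat)" "j < dim_col (1\<^sub>m 2 :: complex mat)"
    then have ij: "i < 2" "j < 2" by auto
    have "complex_of_real a * complex_of_real a + complex_of_real b * complex_of_real b = 1"
      using a2 b2 by (simp flip: of_real_mult of_real_add)
    then show "(adj U * U) $$ (i,j) = (1\<^sub>m 2 :: complex mat) $$ (i,j)"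
      using ij Uc adj_carrier[OF Uc]
      by (subst index_mult_sum[of _ 2 2 _ 2]) (auto simp: sum2 less2 U_def c_def algebra_simps)
  qed (use Uc in auto)
  have dec: "udec 2 U d A" using U by (simp add: udec_def A_def)
  have entry: "(U * rdiag 2 f * adj U) $$ (i,j)
      = of_real (f 0) * (U $$ (i,0) * cnj (U $$ (j,0))) + of_real (f 1) * (U $$ (i,1) * cnj (U $$ (j,1)))"
    if "i < 2" "j < 2" for f i j
    unfolding rdiag_cdiag index_conjugate_cdiag[OF Uc that] sum2 ..
  have pdA: "pd 2 A" by (rule udec_imp_pd[OF dec]) (simp add: d_def x y)
  have avg: "0 < t * x + (1 - t) * y" "0 < (1 - t) * x + t * y"
    using convex_combination_pos[OF t x y] convex_combination_pos[OF t y x] by (simp_all add: add.commute)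
  have g0: "0 < g i" for i
    using avg \<epsilon> by (auto simp: g_def \<alpha>_def \<beta>_def intro!: add_pos_nonneg)
  have pdB: "pd 2 (rdiag 2 g)" by (rule pd_rdiag) (rule g0)
  define \<sigma> where "\<sigma> j = (if j = 0 then sqrt \<epsilon> else - e / sqrt \<epsilon>)" for j :: nat
  define S where "S = mat 1 2 (\<lambda>(i,j). complex_of_real (\<sigma> j))"
  have S: "S \<in> carrier_mat 1 2" by (simp add: S_def)
  have diff: "(if i = j then g i else 0) - (d 0 * (c i 0 * c j 0) + d 1 * (c i 1 * c j 1)) = \<sigma> i * \<sigma> j"
    if "i < 2" "j < 2" for i j
  proof -
    have q: "sqrt \<epsilon> * (- e / sqrt \<epsilon>) = - e" "(- e / sqrt \<epsilon>) * sqrt \<epsilon> = - e"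
      "(- e / sqrt \<epsilon>) * (- e / sqrt \<epsilon>) = e\<^sup>2 / \<epsilon>" "sqrt \<epsilon> * sqrt \<epsilon> = \<epsilon>"
      using \<epsilon> by (simp_all add: power2_eq_square)
    have r: "(a * a) * x + (b * b) * y = t * x + (1 - t) * y" "(b * b) * x + (a * a) * y = (1 - t) * x + t * y"
      by (simp_all only: a2 b2)
    have eqs: "g 0 - (x * (a * a) + y * (b * b)) = sqrt \<epsilon> * sqrt \<epsilon>"
      "0 - (x * (a * - b) + y * (b * a)) = sqrt \<epsilon> * (- e / sqrt \<epsilon>)"
      "0 - (x * (- b * a) + y * (a * b)) = (- e / sqrt \<epsilon>) * sqrt \<epsilon>"
      "g 1 - (x * (- b * - b) + y * (a * a)) = (- e / sqrt \<epsilon>) * (- e / sqrt \<epsilon>)"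
      unfolding q using r by (simp_all add: g_def \<alpha>_def \<beta>_def e_def algebra_simps)
    have "c 0 0 = a" "c 0 1 = b" "c 1 0 = - b" "c 1 1 = a" "d 0 = x" "d 1 = y"
      "\<sigma> 0 = sqrt \<epsilon>" "\<sigma> 1 = - e / sqrt \<epsilon>"
      by (simp_all add: c_def d_def \<sigma>_def)
    note v = this
    have "i = 0 \<or> i = 1" "j = 0 \<or> j = 1" using that by (simp_all only: less2)
    then consider "i = 0 \<and> j = 0" | "i = 0 \<and> j = 1" | "i = 1 \<and> j = 0" | "i = 1 \<and> j = 1"
      by blast
    then show ?thesis
    proof cases
      case 1 then show ?thesis using eqs(1) by (simp only: v simp_thms if_True)
    next
      case 2 then show ?thesis using eqs(2) by (simp only: v zero_neq_one simp_thms if_False)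
    next
      case 3 then show ?thesis using eqs(3) by (simp only: v one_neq_zero simp_thms if_False)
    next
      case 4 then show ?thesis using eqs(4) by (simp only: v simp_thms if_True)
    qed
  qed
  have "rdiag 2 g - A = adj S * S"
  proof (rule eq_matI)
    fix i j assume "i < dim_row (adj S * S)" "j < dim_col (adj S * S)"
    then have ij: "i < 2" "j < 2" using S by auto
    have "(rdiag 2 g - A) $$ (i,j) = rdiag 2 g $$ (i,j) - A $$ (i,j)"
      using ij udec_carrier[OF dec] by simp
    also have "\<dots> = of_real ((if i = j then g i else 0) - (d 0 * (c i 0 * c j 0) + d 1 * (c i 1 * c j 1)))"
      unfolding A_def entry[OF ij] using ij by (simp add: rdiag_cdiag U_def)
    also have "\<dots> = of_real (\<sigma> i * \<sigma> j)" by (simp only: diff[OF ij])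
    also have "\<dots> = (adj S * S) $$ (i,j)"
      using ij S adj_carrier[OF S] by (subst index_mult_sum[of _ 2 1 _ 2]) (auto simp: S_def)
    finally show "(rdiag 2 g - A) $$ (i,j) = (adj S * S) $$ (i,j)" .
  qed (use S Uc in \<open>auto simp: A_def\<close>)
  then have "loewner_le 2 A (rdiag 2 g)"
    using psd_gram[OF S] pd_hermitian[OF pdA] by (simp add: loewner_le_def hermitian_rdiag)
  then have "psd 2 (mat_fun 2 h (rdiag 2 g) - mat_fun 2 h A)"
    using h pdA pdB by (simp add: operator_monotone_def loewner_le_def)
  then have "psd 2 (rdiag 2 (h \<circ> g) - U * rdiag 2 (h \<circ> d) * adj U)"
    by (simp add: mat_fun_rdiag mat_fun_udec[OF dec])
  from psd_diagonal[OF this, of 0]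
  have "0 \<le> Re (rdiag 2 (h \<circ> g) $$ (0,0)) - Re ((U * rdiag 2 (h \<circ> d) * adj U) $$ (0,0))"
    using Uc by (simp del: index_mult_mat(1) add: index_minus_mat)
  moreover have "a * (a * h x) = t * h x" "b * (b * h y) = (1 - t) * h y"
    by (simp_all only: mult.assoc[symmetric] a2 b2)
  ultimately show ?thesis
    unfolding entry[of 0 0, simplified]
    by (simp add: rdiag_cdiag U_def c_def d_def g_def \<alpha>_def algebra_simps)
qed

lemma operator_monotone_concave_increasing:
  "operator_monotone h \<Longrightarrow> concave_increasing h"
  by (rule concave_increasing_approx) (simp_all add: operator_monotone_mono operator_monotone_approx_concave)

text \<open>Changing the sign of \<open>f\<close> also changes the sign of the trace function, so
  the convex half of the theorem becomes an instance of the concave half.\<close>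

lemma operator_monotone_uminus:
  assumes "operator_monotone_decreasing h" shows "operator_monotone (\<lambda>x. - h x)"
proof -
  have neg: "mat_fun k (\<lambda>x. - h x) A = - mat_fun k h A" if A: "pd k A" for k A
  proof -
    obtain U d where dec: "udec k U d A" using hermitian_udec[OF pd_hermitian[OF A]] by auto
    note U = unitary_carrier[OF udec_unitary[OF dec]]
    show ?thesis
      unfolding mat_fun_udec[OF dec] rdiag_cdiag
      by (rule eq_matI) (use U in \<open>auto simp: index_conjugate_cdiag[OF U] sum_negf simp del: index_mult_mat(1)\<close>)
  qed
  have car: "mat_fun k h A \<in> carrier_mat k k" if A: "pd k A" for k A
    using hermitian_udec[OF pd_hermitian[OF A]] udec_mat_fun udec_carrier by metis
  show ?thesis unfolding operator_monotone_def
  proof (intro allI impI)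
    fix k A B assume *: "pd k A" "pd k B" "loewner_le k A B"
    then have le: "loewner_le k (mat_fun k h B) (mat_fun k h A)"
      using assms by (simp add: operator_monotone_decreasing_def)
    have "- mat_fun k h B - - mat_fun k h A = mat_fun k h A - mat_fun k h B"
      by (rule eq_matI) (use car[OF *(1)] car[OF *(2)] in auto)
    moreover have "hermitian k (- M)" if "hermitian k M" for M
    proof -
      have "adj (- M) = - adj M" by (rule eq_matI) auto
      then show ?thesis using that by (simp add: hermitian_def)
    qed
    ultimately show "loewner_le k (mat_fun k (\<lambda>x. - h x) A) (mat_fun k (\<lambda>x. - h x) B)"
      using le by (simp add: neg * loewner_le_def)
  qed
qed

subsection \<open>The trace function\<close>

definition lieb_trace :: "nat \<Rightarrow> nat \<Rightarrow> nat \<Rightarrow> (complex mat \<Rightarrow> complex mat) \<Rightarrow> (complex mat \<Rightarrow> complex mat)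
    \<Rightarrow> real \<Rightarrow> real \<Rightarrow> (real \<Rightarrow> real) \<Rightarrow> complex mat \<Rightarrow> complex mat \<Rightarrow> real" where
  "lieb_trace n m l \<Phi> \<Psi> p q f A B = Re (mtrace (mat_fun l f
              (mat_fun l (\<lambda>x. x powr (1/2)) (\<Phi> (mat_fun n (\<lambda>x. x powr p) A))
               * \<Psi> (mat_fun m (\<lambda>x. x powr q) B)
               * mat_fun l (\<lambda>x. x powr (1/2)) (\<Phi> (mat_fun n (\<lambda>x. x powr p) A)))))"

lemma lieb_trace_eigen:
  fixes g :: "real \<Rightarrow> real"
  assumes \<Phi>: "strictly_positive_map n l \<Phi>" and \<Psi>: "strictly_positive_map m l \<Psi>"
    and A: "pd n A" and B: "pd m B"
  obtains d where "pair_spec l (\<Phi> (cpow n A (of_real p))) (\<Psi> (cpow m B (of_real q))) d"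
    "\<And>j. j < l \<Longrightarrow> 0 < d j" "\<And>i j. i \<le> j \<Longrightarrow> j < l \<Longrightarrow> g (d i) \<le> g (d j)"
    "\<And>f. lieb_trace n m l \<Phi> \<Psi> p q f A B = (\<Sum>j<l. f (d j))"
proof -
  let ?X = "\<Phi> (cpow n A (of_real p))" and ?Y = "\<Psi> (cpow m B (of_real q))"
  have X: "pd l ?X" and Y: "pd l ?Y"
    by (intro strictly_positive_map_pd[OF \<Phi>] strictly_positive_map_pd[OF \<Psi>] pd_cpow A B)+
  obtain U d where dec: "udec l U d (cpow l ?X (1/2) * ?Y * cpow l ?X (1/2))" and ps: "pair_spec l ?X ?Y d"
    and d: "\<And>j. j < l \<Longrightarrow> 0 < d j" "\<And>i j. i \<le> j \<Longrightarrow> j < l \<Longrightarrow> g (d i) \<le> g (d j)"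
    using pair_spec_exists[OF X Y, of g] by metis
  have "lieb_trace n m l \<Phi> \<Psi> p q f A B = (\<Sum>j<l. f (d j))" for f
    using mtrace_udec[OF udec_mat_fun[OF dec, of f]] mat_fun_powr[OF X, of "1/2"]
    by (simp add: lieb_trace_def mat_fun_powr[OF A] mat_fun_powr[OF B])
  from that[OF ps d this] show ?thesis .
qed

lemma lieb_trace_uminus:
  assumes \<Phi>: "strictly_positive_map n l \<Phi>" and \<Psi>: "strictly_positive_map m l \<Psi>"
    and A: "pd n A" and B: "pd m B"
  shows "lieb_trace n m l \<Phi> \<Psi> p q (\<lambda>x. - f x) A B = - lieb_trace n m l \<Phi> \<Psi> p q f A B"
proof -
  obtain d where "\<And>f. lieb_trace n m l \<Phi> \<Psi> p q f A B = (\<Sum>j<l. f (d j))"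
    using lieb_trace_eigen[OF \<Phi> \<Psi> A B, of p q id] by metis
  then show ?thesis by (simp add: sum_negf)
qed

lemma lieb_trace_concave_pos:
  assumes \<Phi>: "strictly_positive_map n l \<Phi>" and \<Psi>: "strictly_positive_map m l \<Psi>"
    and pq: "0 \<le> p" "p \<le> 1" "0 \<le> q" "q \<le> 1" "0 < p + q"
    and h: "concave_increasing (\<lambda>x. f (x powr (p + q)))"
  shows "jointly_concave n m (lieb_trace n m l \<Phi> \<Psi> p q f)"
  unfolding jointly_concave_def
proof (intro allI impI)
  fix A1 A2 B1 B2 and t :: real
  assume A: "pd n A1" "pd n A2" and B: "pd m B1" "pd m B2" and t: "0 \<le> t" "t \<le> 1"
  define C where "C = complex_of_real t \<cdot>\<^sub>m A1 + complex_of_real (1 - t) \<cdot>\<^sub>m A2"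
  define D where "D = complex_of_real t \<cdot>\<^sub>m B1 + complex_of_real (1 - t) \<cdot>\<^sub>m B2"
  have C: "pd n C" unfolding C_def by (intro pd_convex A t)
  have D: "pd m D" unfolding D_def by (intro pd_convex B t)
  define s where "s = 1 / (p + q)"
  obtain z0 where z0: "pair_spec l (\<Phi> (cpow n C (of_real p))) (\<Psi> (cpow m D (of_real q))) z0"
    "\<And>j. j < l \<Longrightarrow> 0 < z0 j" "\<And>i j. i \<le> j \<Longrightarrow> j < l \<Longrightarrow> z0 i \<le> z0 j"
    "\<And>f. lieb_trace n m l \<Phi> \<Psi> p q f C D = (\<Sum>j<l. f (z0 j))"
    using lieb_trace_eigen[OF \<Phi> \<Psi> C D, of p q id] by (metis id_apply)
  obtain z1 where z1: "pair_spec l (\<Phi> (cpow n A1 (of_real p))) (\<Psi> (cpow m B1 (of_real q))) z1"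
    "\<And>j. j < l \<Longrightarrow> 0 < z1 j" "\<And>i j. i \<le> j \<Longrightarrow> j < l \<Longrightarrow> z1 i \<le> z1 j"
    "\<And>f. lieb_trace n m l \<Phi> \<Psi> p q f A1 B1 = (\<Sum>j<l. f (z1 j))"
    using lieb_trace_eigen[OF \<Phi> \<Psi> A(1) B(1), of p q id] by (metis id_apply)
  obtain z2 where z2: "pair_spec l (\<Phi> (cpow n A2 (of_real p))) (\<Psi> (cpow m B2 (of_real q))) z2"
    "\<And>j. j < l \<Longrightarrow> 0 < z2 j" "\<And>i j. i \<le> j \<Longrightarrow> j < l \<Longrightarrow> z2 i \<le> z2 j"
    "\<And>f. lieb_trace n m l \<Phi> \<Psi> p q f A2 B2 = (\<Sum>j<l. f (z2 j))"
    using lieb_trace_eigen[OF \<Phi> \<Psi> A(2) B(2), of p q id] by (metis id_apply)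
  note car = strictly_positive_map_linear(1)[OF \<Phi> cpow_carrier] strictly_positive_map_linear(1)[OF \<Psi> cpow_carrier]
  have le: "t * (\<Sum>j<k. z1 j powr s) + (1 - t) * (\<Sum>j<k. z2 j powr s) \<le> (\<Sum>j<k. z0 j powr s)" if "k \<le> l" for k
    by (rule smallest_eigenvalue_sums_concave[OF \<Phi> \<Psi> A B t pq s_def C_def D_def z0(1,2)
        z1(1) car(1)[OF A(1)] car(2)[OF B(1)] z1(2,3) order_refl order_refl
        z2(1) car(1)[OF A(2)] car(2)[OF B(2)] z2(2,3) order_refl order_refl that])
  \<comment> \<open>The trace becomes a sum of values of the concave increasing function at the
    numbers \<open>z powr s\<close>, whose partial sums have just been compared.\<close>
  have f: "f z = f ((z powr s) powr (p + q))" if "0 < z" for z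
    using that pq by (simp add: s_def powr_powr)
  have "t * (\<Sum>j<l. f ((z1 j powr s) powr (p + q))) + (1 - t) * (\<Sum>j<l. f ((z2 j powr s) powr (p + q)))
      \<le> (\<Sum>j<l. f ((z0 j powr s) powr (p + q)))"
  proof (rule concave_increasing_sums[where h="\<lambda>x. f (x powr (p + q))" and ?v1.0="\<lambda>j. z1 j powr s"
        and ?v2.0="\<lambda>j. z2 j powr s" and w="\<lambda>j. z0 j powr s"])
    show "z0 i powr s \<le> z0 j powr s" if "i \<le> j" "j < l" for i j
      using z0(2)[of i] z0(3)[OF that] that pq by (intro powr_mono2) (auto simp: s_def)
    show "0 < z0 j powr s" "0 < z1 j powr s" "0 < z2 j powr s" if "j < l" for j
      using z0(2)[OF that] z1(2)[OF that] z2(2)[OF that] by simp_all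
  qed (use h t le in auto)
  moreover have "(\<Sum>j<l. f (z0 j)) = (\<Sum>j<l. f ((z0 j powr s) powr (p + q)))"
    "(\<Sum>j<l. f (z1 j)) = (\<Sum>j<l. f ((z1 j powr s) powr (p + q)))"
    "(\<Sum>j<l. f (z2 j)) = (\<Sum>j<l. f ((z2 j powr s) powr (p + q)))"
    using z0(2) z1(2) z2(2) by (intro sum.cong refl f; simp)+
  ultimately have "t * (\<Sum>j<l. f (z1 j)) + (1 - t) * (\<Sum>j<l. f (z2 j)) \<le> (\<Sum>j<l. f (z0 j))"
    by presburger
  then show "t * lieb_trace n m l \<Phi> \<Psi> p q f A1 B1 + (1 - t) * lieb_trace n m l \<Phi> \<Psi> p q f A2 B2
      \<le> lieb_trace n m l \<Phi> \<Psi> p q f (of_real t \<cdot>\<^sub>m A1 + of_real (1 - t) \<cdot>\<^sub>m A2)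
          (of_real t \<cdot>\<^sub>m B1 + of_real (1 - t) \<cdot>\<^sub>m B2)"
    unfolding C_def[symmetric] D_def[symmetric] z0(4) z1(4) z2(4) .
qed

text \<open>For negative exponents the inverses of the two positive matrices are bounded above, with
  equality at the convex combination, by linear images of positive powers, and everything is monotone.\<close>

lemma lieb_trace_concave_neg:
  assumes \<Phi>: "strictly_positive_map n l \<Phi>" and \<Psi>: "strictly_positive_map m l \<Psi>"
    and ab: "0 \<le> a" "a \<le> 1" "0 \<le> b" "b \<le> 1" "0 < a + b"
    and h: "concave_increasing (\<lambda>x. f (x powr (- a + - b)))"
  shows "jointly_concave n m (lieb_trace n m l \<Phi> \<Psi> (- a) (- b) f)"
  unfolding jointly_concave_def
proof (intro allI impI)
  fix A1 A2 B1 B2 and t :: real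
  assume A: "pd n A1" "pd n A2" and B: "pd m B1" "pd m B2" and t: "0 \<le> t" "t \<le> 1"
  define C where "C = complex_of_real t \<cdot>\<^sub>m A1 + complex_of_real (1 - t) \<cdot>\<^sub>m A2"
  define D where "D = complex_of_real t \<cdot>\<^sub>m B1 + complex_of_real (1 - t) \<cdot>\<^sub>m B2"
  have C: "pd n C" unfolding C_def by (intro pd_convex A t)
  have D: "pd m D" unfolding D_def by (intro pd_convex B t)
  define s where "s = 1 / (a + b)"
  define X where "X M = cpow l (\<Phi> (cpow n M (of_real (- a)))) (-1)" for M
  define Y where "Y M = cpow l (\<Psi> (cpow m M (of_real (- b)))) (-1)" for M
  define \<Phi>' where "\<Phi>' = inverse_majorant l \<Phi> (cpow n C (of_real (- a)))"
  define \<Psi>' where "\<Psi>' = inverse_majorant l \<Psi> (cpow m D (of_real (- b)))"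
  have \<Phi>': "strictly_positive_map n l \<Phi>'" and \<Psi>': "strictly_positive_map m l \<Psi>'"
    unfolding \<Phi>'_def \<Psi>'_def by (intro strictly_positive_inverse_majorant \<Phi> \<Psi> pd_cpow C D)+
  have inv: "cpow k (cpow k M (of_real r)) (-1) = cpow k M (of_real (- r))" if M: "pd k M" for k M r
  proof -
    note P = pd_cpow[OF M, of r]
    have "cpow k (cpow k M (of_real r)) (-1) * (cpow k M (of_real r) * cpow k M (of_real (- r))) = cpow k M (of_real (- r))"
      by (rule mult_cancel_inverse[of _ k _ _ k]) (simp_all add: M P pd_inverse(3)[OF P])
    then show ?thesis using M P by (simp add: cpow_mult cpow_0 right_mult_one_mat[of _ k k])
  qed
  \<comment> \<open>The majorants are anchored at \<open>C\<close> and \<open>D\<close>, so they are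
    exact here, while the next two facts give inequalities at every other point. This matches the
    asymmetric hypotheses of the eigenvalue theorem.\<close>
  have X0: "\<Phi>' (cpow n C (of_real a)) = X C" and Y0: "\<Psi>' (cpow m D (of_real b)) = Y D"
    using inverse_majorant_eq[OF \<Phi> pd_cpow[OF C, of "- a"]] inverse_majorant_eq[OF \<Psi> pd_cpow[OF D, of "- b"]]
    unfolding \<Phi>'_def \<Psi>'_def X_def Y_def inv[OF C] inv[OF D] by simp_all
  have X1: "Re (qform l (X M) v) \<le> Re (qform l (\<Phi>' (cpow n M (of_real a))) v)" if "pd n M" for M v
    using inverse_majorant_ge[OF \<Phi> pd_cpow[OF C, of "- a"] pd_cpow[OF that, of a]]
    unfolding \<Phi>'_def X_def inv[OF that] .
  have Y1: "Re (qform l (Y M) v) \<le> Re (qform l (\<Psi>' (cpow m M (of_real b))) v)" if "pd m M" for M v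
    using inverse_majorant_ge[OF \<Psi> pd_cpow[OF D, of "- b"] pd_cpow[OF that, of b]]
    unfolding \<Psi>'_def Y_def inv[OF that] .
  have car: "X M \<in> carrier_mat l l" if "pd n M" for M
    unfolding X_def by (intro cpow_carrier strictly_positive_map_pd[OF \<Phi>] pd_cpow that)
  have car': "Y M \<in> carrier_mat l l" if "pd m M" for M
    unfolding Y_def by (intro cpow_carrier strictly_positive_map_pd[OF \<Psi>] pd_cpow that)
  have eig: "\<exists>z. pair_spec l (X M) (Y N) z \<and> (\<forall>j<l. 0 < z j) \<and> (\<forall>j<l. \<forall>i\<le>j. z i \<le> z j) \<and>
      (\<forall>f. lieb_trace n m l \<Phi> \<Psi> (- a) (- b) f M N = (\<Sum>j<l. f (1 / z j)))"
    if M: "pd n M" and N: "pd m N" for M N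
  proof -
    \<comment> \<open>The key \<open>uminus\<close> lists the eigenvalues in decreasing order, so
      that their reciprocals come out increasing.\<close>
    obtain d where d: "pair_spec l (\<Phi> (cpow n M (of_real (- a)))) (\<Psi> (cpow m N (of_real (- b)))) d"
      "\<And>j. j < l \<Longrightarrow> 0 < d j" "\<And>i j. i \<le> j \<Longrightarrow> j < l \<Longrightarrow> - d i \<le> - d j"
      "\<And>f. lieb_trace n m l \<Phi> \<Psi> (- a) (- b) f M N = (\<Sum>j<l. f (d j))"
      using lieb_trace_eigen[OF \<Phi> \<Psi> M N, of "- a" "- b" uminus] by metis
    have "pair_spec l (X M) (Y N) (\<lambda>j. 1 / d j)"
      unfolding X_def Y_def
      by (intro pair_spec_inverse d strictly_positive_map_pd[OF \<Phi>] strictly_positive_map_pd[OF \<Psi>] pd_cpow M N)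
    moreover have "1 / d i \<le> 1 / d j" if "i \<le> j" "j < l" for i j
      using d(2)[of j] d(3)[OF that] that by (intro divide_left_mono mult_pos_pos d(2)) auto
    ultimately show ?thesis using d(2,4) by (intro exI[of _ "\<lambda>j. 1 / d j"]) auto
  qed
  obtain z0 where z0: "pair_spec l (X C) (Y D) z0"
    "\<And>j. j < l \<Longrightarrow> 0 < z0 j" "\<And>i j. i \<le> j \<Longrightarrow> j < l \<Longrightarrow> z0 i \<le> z0 j"
    "\<And>f. lieb_trace n m l \<Phi> \<Psi> (- a) (- b) f C D = (\<Sum>j<l. f (1 / z0 j))"
    using eig[OF C D] by metis
  obtain z1 where z1: "pair_spec l (X A1) (Y B1) z1"
    "\<And>j. j < l \<Longrightarrow> 0 < z1 j" "\<And>i j. i \<le> j \<Longrightarrow> j < l \<Longrightarrow> z1 i \<le> z1 j"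
    "\<And>f. lieb_trace n m l \<Phi> \<Psi> (- a) (- b) f A1 B1 = (\<Sum>j<l. f (1 / z1 j))"
    using eig[OF A(1) B(1)] by metis
  obtain z2 where z2: "pair_spec l (X A2) (Y B2) z2"
    "\<And>j. j < l \<Longrightarrow> 0 < z2 j" "\<And>i j. i \<le> j \<Longrightarrow> j < l \<Longrightarrow> z2 i \<le> z2 j"
    "\<And>f. lieb_trace n m l \<Phi> \<Psi> (- a) (- b) f A2 B2 = (\<Sum>j<l. f (1 / z2 j))"
    using eig[OF A(2) B(2)] by metis
  have le: "t * (\<Sum>j<k. z1 j powr s) + (1 - t) * (\<Sum>j<k. z2 j powr s) \<le> (\<Sum>j<k. z0 j powr s)" if "k \<le> l" for k
    by (rule smallest_eigenvalue_sums_concave[OF \<Phi>' \<Psi>' A B t ab s_def C_def D_def z0(1,2)[folded X0 Y0]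
        z1(1) car[OF A(1)] car'[OF B(1)] z1(2,3) X1[OF A(1)] Y1[OF B(1)]
        z2(1) car[OF A(2)] car'[OF B(2)] z2(2,3) X1[OF A(2)] Y1[OF B(2)] that])
  have f: "f (1 / z) = f ((z powr s) powr (- a + - b))" if "0 < z" for z
  proof -
    have "s * (- a + - b) = - (s * (a + b))" by (simp add: algebra_simps)
    also have "\<dots> = - 1" using ab by (simp add: s_def)
    finally show ?thesis using that by (simp add: powr_powr powr_minus_divide)
  qed
  have "t * (\<Sum>j<l. f ((z1 j powr s) powr (- a + - b))) + (1 - t) * (\<Sum>j<l. f ((z2 j powr s) powr (- a + - b)))
      \<le> (\<Sum>j<l. f ((z0 j powr s) powr (- a + - b)))"
  proof (rule concave_increasing_sums[where h="\<lambda>x. f (x powr (- a + - b))" and ?v1.0="\<lambda>j. z1 j powr s"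
        and ?v2.0="\<lambda>j. z2 j powr s" and w="\<lambda>j. z0 j powr s"])
    show "z0 i powr s \<le> z0 j powr s" if "i \<le> j" "j < l" for i j
      using z0(2)[of i] z0(3)[OF that] that ab by (intro powr_mono2) (auto simp: s_def)
    show "0 < z0 j powr s" "0 < z1 j powr s" "0 < z2 j powr s" if "j < l" for j
      using z0(2)[OF that] z1(2)[OF that] z2(2)[OF that] by simp_all
  qed (use h t le in auto)
  moreover have "(\<Sum>j<l. f (1 / z0 j)) = (\<Sum>j<l. f ((z0 j powr s) powr (- a + - b)))"
    "(\<Sum>j<l. f (1 / z1 j)) = (\<Sum>j<l. f ((z1 j powr s) powr (- a + - b)))"
    "(\<Sum>j<l. f (1 / z2 j)) = (\<Sum>j<l. f ((z2 j powr s) powr (- a + - b)))"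
    using z0(2) z1(2) z2(2) by (intro sum.cong refl f; simp)+
  ultimately have "t * (\<Sum>j<l. f (1 / z1 j)) + (1 - t) * (\<Sum>j<l. f (1 / z2 j)) \<le> (\<Sum>j<l. f (1 / z0 j))"
    by presburger
  then show "t * lieb_trace n m l \<Phi> \<Psi> (- a) (- b) f A1 B1 + (1 - t) * lieb_trace n m l \<Phi> \<Psi> (- a) (- b) f A2 B2
      \<le> lieb_trace n m l \<Phi> \<Psi> (- a) (- b) f (of_real t \<cdot>\<^sub>m A1 + of_real (1 - t) \<cdot>\<^sub>m A2)
          (of_real t \<cdot>\<^sub>m B1 + of_real (1 - t) \<cdot>\<^sub>m B2)"
    unfolding C_def[symmetric] D_def[symmetric] z0(4) z1(4) z2(4) .
qed

theorem theorem2p1: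
  fixes n m l :: nat
    and \<Phi> \<Psi> :: "complex mat \<Rightarrow> complex mat"
    and p q :: real
    and f :: "real \<Rightarrow> real"
  assumes "strictly_positive_map n l \<Phi>"
    and "strictly_positive_map m l \<Psi>"
    and "(p, q) \<noteq> (0, 0)"
    and "(0 \<le> p \<and> p \<le> 1 \<and> 0 \<le> q \<and> q \<le> 1) \<or> (-1 \<le> p \<and> p \<le> 0 \<and> -1 \<le> q \<and> q \<le> 0)"
  defines "F \<equiv> (\<lambda>A B. Re (mtrace (mat_fun l f
              (mat_fun l (\<lambda>x. x powr (1/2)) (\<Phi> (mat_fun n (\<lambda>x. x powr p) A))
               * \<Psi> (mat_fun m (\<lambda>x. x powr q) B)
               * mat_fun l (\<lambda>x. x powr (1/2)) (\<Phi> (mat_fun n (\<lambda>x. x powr p) A))))))"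
  shows "(operator_monotone (\<lambda>x. f (x powr (p + q))) \<longrightarrow> jointly_concave n m F)
       \<and> (operator_monotone_decreasing (\<lambda>x. f (x powr (p + q))) \<longrightarrow> jointly_convex n m F)"
proof -
  have F: "F = lieb_trace n m l \<Phi> \<Psi> p q f"
    by (simp add: F_def lieb_trace_def fun_eq_iff)
  have concave: "jointly_concave n m (lieb_trace n m l \<Phi> \<Psi> p q g)"
    if h: "operator_monotone (\<lambda>x. g (x powr (p + q)))" for g
    using assms(4)
  proof
    assume pq: "0 \<le> p \<and> p \<le> 1 \<and> 0 \<le> q \<and> q \<le> 1"
    then have "0 < p + q" using assms(3) by auto
    with pq show ?thesis
      by (intro lieb_trace_concave_pos assms(1,2) operator_monotone_concave_increasing h) auto
  next
    assume pq: "-1 \<le> p \<and> p \<le> 0 \<and> -1 \<le> q \<and> q \<le> 0"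
    then have "0 < - p + - q" using assms(3) by auto
    with pq show ?thesis
      using lieb_trace_concave_neg[OF assms(1,2), of "- p" "- q" g]
        operator_monotone_concave_increasing[OF h] by simp
  qed
  have "jointly_convex n m F" if h: "operator_monotone_decreasing (\<lambda>x. f (x powr (p + q)))"
    unfolding jointly_convex_def F
  proof (intro allI impI)
    fix A1 A2 B1 B2 and t :: real
    assume A: "pd n A1" "pd n A2" and B: "pd m B1" "pd m B2" and t: "0 \<le> t" "t \<le> 1"
    have "t * lieb_trace n m l \<Phi> \<Psi> p q (\<lambda>x. - f x) A1 B1 + (1 - t) * lieb_trace n m l \<Phi> \<Psi> p q (\<lambda>x. - f x) A2 B2
      \<le> lieb_trace n m l \<Phi> \<Psi> p q (\<lambda>x. - f x) (of_real t \<cdot>\<^sub>m A1 + of_real (1 - t) \<cdot>\<^sub>m A2)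
          (of_real t \<cdot>\<^sub>m B1 + of_real (1 - t) \<cdot>\<^sub>m B2)"
      using concave[OF operator_monotone_uminus[OF h]] A B t unfolding jointly_concave_def by blast
    then show "lieb_trace n m l \<Phi> \<Psi> p q f (of_real t \<cdot>\<^sub>m A1 + of_real (1 - t) \<cdot>\<^sub>m A2)
          (of_real t \<cdot>\<^sub>m B1 + of_real (1 - t) \<cdot>\<^sub>m B2)
      \<le> t * lieb_trace n m l \<Phi> \<Psi> p q f A1 B1 + (1 - t) * lieb_trace n m l \<Phi> \<Psi> p q f A2 B2"
      unfolding lieb_trace_uminus[OF assms(1,2) A(1) B(1)] lieb_trace_uminus[OF assms(1,2) A(2) B(2)]
        lieb_trace_uminus[OF assms(1,2) pd_convex[OF A t] pd_convex[OF B t]] by simp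
  qed
  then show ?thesis using concave F by blast
qed

end
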